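(* Let $\mathbb{H}$ be one of the algebras $\mathbb{H}^{Cl}_{W(A_{n-1})}$, $\mathbb{H}^{Cl}_{W(B_n)}(\mathbf k,N)$ or $\mathbb{H}^{Cl}_{W(D_n)}(\mathbf k,N)$, with Weyl group $W$ and Dirac element $D$. Then $$D^2=\Omega_{\mathbb{H}}-\Omega_{\mathrm{Seg}(W)},$$ where $$\Omega_{\mathbb{H}}=\sum_{i=1}^nx_i^2,\qquad \Omega_{\mathrm{Seg}(W)}=\frac12\sum_{\alpha>0,\ \beta>0,\ s_\alpha(\beta)<0}|\langle\alpha,\alpha\rangle||\langle\beta,\beta\rangle|\,\mathbf{k}_\alpha\mathbf{k}_\beta\,\widetilde s_\alpha\widetilde s_\beta .$$ Moreover, $\mathbb{H}$ satisfies property ( ** ): if $h\in\mathbb{H}$ supercommutes with all elements of $\mathrm{Seg}(W)$, then $D^2h-hD^2=0$.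
   Context: Everything is over $\mathbb{C}$; $e_1,\dots,e_n$ is the standard basis of $\mathbb{R}^n$ with $\langle e_i,e_j\rangle=\delta_{ij}$. Root systems: $R(A_{n-1})=\{e_i-e_j:i\ne j\}$, $R(B_n)=\{\pm e_i\pm e_j:i<j\}\cup\{\pm e_i\}$, $R(D_n)=\{\pm e_i\pm e_j:i<j\}$, with positive roots $e_i-e_j$ ($i<j$) in type $A_{n-1}$; $e_i\pm e_j$ ($i<j$) and $e_i$ in type $B_n$; $e_i\pm e_j$ ($i<j$) in type $D_n$. $\alpha>0$ means $\alpha$ is positive, $\alpha<0$ means $-\alpha>0$; $W(\cdot)$ is the Weyl group and $s_\alpha$ the reflection in $\alpha$. $\mathbf{k}:R\to\mathbb{C}$, $\alpha\mapsto\mathbf{k}_\alpha$, is a $W$-invariant function. Write $s_{i,j}=s_{e_i-e_j}$, $s_n=s_{e_n}$. Type $A_{n-1}$: $\mathbb{H}^{Cl}_{W(A_{n-1})}$ is the unital algebra generated by $x_i,c_i$ ($1\le i\le n$) and $w\in W(A_{n-1})=S_n$ such that $\mathbb{C}[S_n]$ embeds as a subalgebra, with relations: $x_ix_j=x_jx_i$; $x_ic_j=c_jx_i$ ($i\ne j$), $x_ic_i=-c_ix_i$; $c_ic_j=-c_jc_i$ ($i\neq j$), $c_i^2=-1$; $wc_i=c_{w(i)}w$; $s_{i,i+1}x_i-x_{i+1}s_{i,i+1}=\mathbf{k}(-1+c_ic_{i+1})$, and $s_{i,i+1}x_j=x_js_{i,i+1}$ for $j\ne i,i+1$, where $\mathbf{k}$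 is the common value of $\mathbf{k}_\alpha$. Type $B_n$: for an arbitrary $N\in\mathbb{C}$, $\mathbb{H}^{Cl}_{W(B_n)}(\mathbf{k},N)$ is generated by $x_i,c_i$ and $w\in W(B_n)$ with $\mathbb{C}[W(B_n)]$ embedded, subject to all relations of type $A_{n-1}$ above except $x_ix_j=x_jx_i$ (for $w\in W(A_{n-1})=S_n\subset W(B_n)$ and $\mathbf{k}$ the value on long roots $\pm e_i\pm e_j$), together with $s_nc_n=-c_ns_n$, $s_nc_i=c_is_n$ ($i\ne n$); $s_nx_n+x_ns_n=-\sqrt2\,\mathbf{k}_{e_n}$, $s_nx_j=x_js_n$ ($j\ne n$); $x_ix_j-x_jx_i=N c_jc_i$ ($i\ne j$). Type $D_n$: given $\mathbf{k}$ on $R(D_n)$ and an arbitrary $N\in\mathbb{C}$, let $\mathbf{k}^B$ on $R(B_n)$ equal $\mathbf{k}$ on $R(D_n)$ and $0$ on short roots $\pm e_i$; $\mathbb{H}^{Cl}_{W(D_n)}(\mathbf{k},N)$ is the subalgebra of $\mathbb{H}^{Cl}_{W(B_n)}(\mathbf{k}^B,N)$ generated by $W(D_n)\subset W(B_n)$, the $x_i$ and the $c_i$. These are superalgebras with $\deg c_i=1$, $\deg x_i=\deg w=0$. $\mathrm{Seg}(W)$ is the subalgebra generated by $W$ and the $c_i$. For positive roots: $c_{e_i\pm e_j}=\frac{\sqrt2}{2}(c_i\pm c_j)$ ($i<j$), $c_{e_i}=c_i$, and $\widetilde s_\alpha=s_\alpha c_\alpha$. The Dirac element is $$D=\sum_{i=1}^nx_ic_i+\frac{\sqrt2}{2}\sum_{\alpha>0}\mathbf{k}_\alpha\langle\alpha,\alpha\rangle\,\widetilde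 s_\alpha .$$ Homogeneous $h_1,h_2$ supercommute if $h_1h_2=(-1)^{\deg(h_1)\deg(h_2)}h_2h_1$ (extended bilinearly).
   Formalization: The printed identity fails in types B and D when N≠0, n≥2 (e.g. k=0); proved instead is D² = Ω_H − Ω_Seg + N·n(n−1)/2 there, and as printed in type A. In type D, k^B is assumed W(B_n)-invariant, which is needed for the algebra to be defined and is automatic unless n=2. *)

theory Defs
  imports
    Complex_Main
    "HOL-Library.Poly_Mapping"
    "HOL-Library.Function_Algebras"
    "HOL-Algebra.QuotRing"
    "HOL-Algebra.Generated_Rings"
begin

section \<open>Root systems and Weyl groups\<close>

text \<open>A vector of \<open>\<real>\<^sup>n\<close> is a function on \<open>nat\<close> whose relevant coordinates are \<open>1, \<dots>, n\<close>.
  Reflections are maps on all of \<open>nat \<Rightarrow> real\<close>; a reflection in a root leaves the coordinates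
  outside \<open>{1..n}\<close> alone, so the group generated by them is the usual Weyl group.\<close>

type_synonym vec = "nat \<Rightarrow> real"

definition unit_vec :: "nat \<Rightarrow> vec" where
  "unit_vec i = (\<lambda>l. if l = i then 1 else 0)"

definition ip :: "nat \<Rightarrow> vec \<Rightarrow> vec \<Rightarrow> real" where
  "ip n u v = (\<Sum>l=1..n. u l * v l)"

definition reflection :: "nat \<Rightarrow> vec \<Rightarrow> vec \<Rightarrow> vec" where
  "reflection n \<alpha> v = (\<lambda>l. v l - 2 * ip n v \<alpha> / ip n \<alpha> \<alpha> * \<alpha> l)"

text \<open>\<open>TypeA\<close> with parameter \<open>n\<close> stands for \<open>A\<^bsub>n-1\<^esub>\<close>, \<open>TypeB\<close> for \<open>B\<^sub>n\<close>, \<open>TypeD\<close> for \<open>D\<^sub>n\<close>.\<close>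

datatype root_type = TypeA | TypeB | TypeD

definition long_minus :: "nat \<Rightarrow> vec set" where
  "long_minus n = {unit_vec i - unit_vec j | i j. 1 \<le> i \<and> i < j \<and> j \<le> n}"

definition long_plus :: "nat \<Rightarrow> vec set" where
  "long_plus n = {unit_vec i + unit_vec j | i j. 1 \<le> i \<and> i < j \<and> j \<le> n}"

fun pos_roots :: "root_type \<Rightarrow> nat \<Rightarrow> vec set" where
  "pos_roots TypeA n = long_minus n"
| "pos_roots TypeB n = long_minus n \<union> long_plus n \<union> {unit_vec i | i. 1 \<le> i \<and> i \<le> n}"
| "pos_roots TypeD n = long_minus n \<union> long_plus n"

definition roots :: "root_type \<Rightarrow> nat \<Rightarrow> vec set" where
  "roots T n = pos_roots T n \<union> uminus ` pos_roots T n"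

text \<open>Reflections are involutions, so closure under multiplication by reflections already gives
  the whole group they generate. \<open>weyl TypeA n\<close> is \<open>S\<^sub>n\<close> acting by permutation of the basis
  vectors, and it is literally a subset of \<open>weyl TypeB n\<close>.\<close>

inductive_set weyl :: "root_type \<Rightarrow> nat \<Rightarrow> (vec \<Rightarrow> vec) set" for T n where
  weyl_id: "id \<in> weyl T n"
| weyl_refl: "\<alpha> \<in> roots T n \<Longrightarrow> w \<in> weyl T n \<Longrightarrow> reflection n \<alpha> \<circ> w \<in> weyl T n"

definition weyl_invariant :: "root_type \<Rightarrow> nat \<Rightarrow> (vec \<Rightarrow> complex) \<Rightarrow> bool" where
  "weyl_invariant T n k \<longleftrightarrow> (\<forall>w\<in>weyl T n. \<forall>\<alpha>\<in>roots T n. k (w \<alpha>) = k \<alpha>)"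

definition ext_zero :: "nat \<Rightarrow> (vec \<Rightarrow> complex) \<Rightarrow> vec \<Rightarrow> complex" where
  "ext_zero n k \<alpha> = (if \<alpha> \<in> roots TypeD n then k \<alpha> else 0)"

section \<open>Free complex algebras\<close>

text \<open>The free algebra on a set \<open>G\<close> consists of the finitely supported complex functions on
  words over \<open>G\<close>. Writing concatenation of words additively makes the product of
  \<^theory>\<open>HOL-Library.Poly_Mapping\<close> the (noncommutative) convolution product.\<close>

datatype 'g word = Word (letters: "'g list")

instantiation word :: (type) monoid_add
begin

definition zero_word :: "'a word" where
  "zero_word = Word []"

definition plus_word :: "'a word \<Rightarrow> 'a word \<Rightarrow> 'a word" where
  "plus_word u v = Word (letters u @ letters v)"

instance
  by standard (simp_all add: zero_word_def plus_word_def)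

end

definition free_algebra :: "'g set \<Rightarrow> ('g word \<Rightarrow>\<^sub>0 complex) ring" where
  "free_algebra G =
     \<lparr>carrier = {p. \<forall>u \<in> Poly_Mapping.keys p. set (letters u) \<subseteq> G},
      mult = (*), one = 1, zero = 0, add = (+)\<rparr>"

definition scal :: "complex \<Rightarrow> 'g word \<Rightarrow>\<^sub>0 complex" where
  "scal a = Poly_Mapping.single 0 a"

definition letter :: "'g \<Rightarrow> 'g word \<Rightarrow>\<^sub>0 complex" where
  "letter g = Poly_Mapping.single (Word [g]) 1"

section \<open>The algebras as quotients of free algebras\<close>

datatype generator = GenX nat | GenC nat | GenW "vec \<Rightarrow> vec"

type_synonym falg = "generator word \<Rightarrow>\<^sub>0 complex"

abbreviation x_gen :: "nat \<Rightarrow> falg" where "x_gen i \<equiv> letter (GenX i)"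
abbreviation c_gen :: "nat \<Rightarrow> falg" where "c_gen i \<equiv> letter (GenC i)"
abbreviation w_gen :: "(vec \<Rightarrow> vec) \<Rightarrow> falg" where "w_gen w \<equiv> letter (GenW w)"

definition s_adj :: "nat \<Rightarrow> nat \<Rightarrow> falg" where
  "s_adj n i = w_gen (reflection n (unit_vec i - unit_vec (Suc i)))"

definition s_last :: "nat \<Rightarrow> falg" where
  "s_last n = w_gen (reflection n (unit_vec n))"

text \<open>An equation \<open>p = q\<close> between generators is encoded by the relator \<open>p - q\<close>.\<close>

definition group_relators :: "root_type \<Rightarrow> nat \<Rightarrow> falg set" where
  "group_relators T n =
     {w_gen id - 1} \<union>
     {w_gen (u \<circ> v) - w_gen u * w_gen v | u v. u \<in> weyl T n \<and> v \<in> weyl T n}"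

text \<open>The relations common to types \<open>A\<close> and \<open>B\<close>: all those of type \<open>A\<close> except the group
  relations and the commutation of the \<open>x\<^sub>i\<close>.\<close>

definition common_relators :: "nat \<Rightarrow> (vec \<Rightarrow> complex) \<Rightarrow> falg set" where
  "common_relators n k =
     {x_gen i * c_gen j - c_gen j * x_gen i | i j. i \<in> {1..n} \<and> j \<in> {1..n} \<and> i \<noteq> j} \<union>
     {x_gen i * c_gen i - (- (c_gen i * x_gen i)) | i. i \<in> {1..n}} \<union>
     {c_gen i * c_gen j - (- (c_gen j * c_gen i)) | i j. i \<in> {1..n} \<and> j \<in> {1..n} \<and> i \<noteq> j} \<union>
     {c_gen i * c_gen i - (- 1) | i. i \<in> {1..n}} \<union>
     {w_gen w * c_gen i - c_gen j * w_gen w | w i j.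
        w \<in> weyl TypeA n \<and> i \<in> {1..n} \<and> j \<in> {1..n} \<and> w (unit_vec i) = unit_vec j} \<union>
     {s_adj n i * x_gen i - x_gen (Suc i) * s_adj n i
        - scal (k (unit_vec i - unit_vec (Suc i))) * (- 1 + c_gen i * c_gen (Suc i)) | i.
        1 \<le> i \<and> i < n} \<union>
     {s_adj n i * x_gen j - x_gen j * s_adj n i | i j.
        1 \<le> i \<and> i < n \<and> j \<in> {1..n} \<and> j \<noteq> i \<and> j \<noteq> Suc i}"

definition relators_A :: "nat \<Rightarrow> (vec \<Rightarrow> complex) \<Rightarrow> falg set" where
  "relators_A n k =
     group_relators TypeA n \<union> common_relators n k \<union>
     {x_gen i * x_gen j - x_gen j * x_gen i | i j. i \<in> {1..n} \<and> j \<in> {1..n}}"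

definition relators_B :: "nat \<Rightarrow> (vec \<Rightarrow> complex) \<Rightarrow> complex \<Rightarrow> falg set" where
  "relators_B n k N =
     group_relators TypeB n \<union> common_relators n k \<union>
     {s_last n * c_gen n - (- (c_gen n * s_last n))} \<union>
     {s_last n * c_gen i - c_gen i * s_last n | i. i \<in> {1..n} \<and> i \<noteq> n} \<union>
     {s_last n * x_gen n + x_gen n * s_last n
        - scal (- (complex_of_real (sqrt 2) * k (unit_vec n)))} \<union>
     {s_last n * x_gen j - x_gen j * s_last n | j. j \<in> {1..n} \<and> j \<noteq> n} \<union>
     {x_gen i * x_gen j - x_gen j * x_gen i - scal N * (c_gen j * c_gen i) | i j.
        i \<in> {1..n} \<and> j \<in> {1..n} \<and> i \<noteq> j}"

text \<open>In type \<open>A\<close> the parameter \<open>N\<close> is ignored. In type \<open>D\<close> the presented algebra is the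
  ambient algebra of type \<open>B\<close> with parameter function vanishing on the short roots.\<close>

fun relators :: "root_type \<Rightarrow> nat \<Rightarrow> (vec \<Rightarrow> complex) \<Rightarrow> complex \<Rightarrow> falg set" where
  "relators TypeA n k N = relators_A n k"
| "relators TypeB n k N = relators_B n k N"
| "relators TypeD n k N = relators_B n (ext_zero n k) N"

definition generators :: "root_type \<Rightarrow> nat \<Rightarrow> generator set" where
  "generators T n = GenX ` {1..n} \<union> GenC ` {1..n} \<union>
     GenW ` weyl (if T = TypeA then TypeA else TypeB) n"

definition rel_ideal :: "root_type \<Rightarrow> nat \<Rightarrow> (vec \<Rightarrow> complex) \<Rightarrow> complex \<Rightarrow> falg set" where
  "rel_ideal T n k N = genideal (free_algebra (generators T n)) (relators T n k N)"

definition presented :: "root_type \<Rightarrow> nat \<Rightarrow> (vec \<Rightarrow> complex) \<Rightarrow> complex \<Rightarrow> falg set ring" where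
  "presented T n k N = free_algebra (generators T n) Quot rel_ideal T n k N"

definition cls :: "root_type \<Rightarrow> nat \<Rightarrow> (vec \<Rightarrow> complex) \<Rightarrow> complex \<Rightarrow> falg \<Rightarrow> falg set" where
  "cls T n k N p = rel_ideal T n k N +>\<^bsub>free_algebra (generators T n)\<^esub> p"

text \<open>The unital complex subalgebra generated by the classes of \<open>S\<close>: the subring generated by
  them together with the scalars.\<close>

definition gen_subalgebra ::
    "root_type \<Rightarrow> nat \<Rightarrow> (vec \<Rightarrow> complex) \<Rightarrow> complex \<Rightarrow> falg set \<Rightarrow> falg set set" where
  "gen_subalgebra T n k N S =
     generate_ring (presented T n k N) (cls T n k N ` (range scal \<union> S))"

definition hecke_clifford ::
    "root_type \<Rightarrow> nat \<Rightarrow> (vec \<Rightarrow> complex) \<Rightarrow> complex \<Rightarrow> falg set ring" where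
  "hecke_clifford T n k N =
     (if T = TypeD
      then presented T n k N
        \<lparr>carrier := gen_subalgebra T n k N
           (w_gen ` weyl TypeD n \<union> x_gen ` {1..n} \<union> c_gen ` {1..n})\<rparr>
      else presented T n k N)"

definition Seg :: "root_type \<Rightarrow> nat \<Rightarrow> (vec \<Rightarrow> complex) \<Rightarrow> complex \<Rightarrow> falg set set" where
  "Seg T n k N = gen_subalgebra T n k N (w_gen ` weyl T n \<union> c_gen ` {1..n})"

section \<open>The superalgebra structure\<close>

definition c_degree :: "generator word \<Rightarrow> nat" where
  "c_degree u = length (filter (\<lambda>g. \<exists>i. g = GenC i) (letters u))"

text \<open>All relators are homogeneous, so the images of the even and the odd part of the free
  algebra grade the quotient.\<close>

definition component ::
    "root_type \<Rightarrow> nat \<Rightarrow> (vec \<Rightarrow> complex) \<Rightarrow> complex \<Rightarrow> nat \<Rightarrow> falg set set" where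
  "component T n k N d = carrier (hecke_clifford T n k N) \<inter>
     cls T n k N ` {p \<in> carrier (free_algebra (generators T n)).
                      \<forall>u \<in> Poly_Mapping.keys p. c_degree u mod 2 = d}"

definition supercommute ::
    "root_type \<Rightarrow> nat \<Rightarrow> (vec \<Rightarrow> complex) \<Rightarrow> complex \<Rightarrow> falg set \<Rightarrow> falg set \<Rightarrow> bool" where
  "supercommute T n k N a b \<longleftrightarrow>
     (let H = hecke_clifford T n k N in
      \<exists>a0 \<in> component T n k N 0. \<exists>a1 \<in> component T n k N 1.
      \<exists>b0 \<in> component T n k N 0. \<exists>b1 \<in> component T n k N 1.
        a = a0 \<oplus>\<^bsub>H\<^esub> a1 \<and> b = b0 \<oplus>\<^bsub>H\<^esub> b1 \<and>
        a \<otimes>\<^bsub>H\<^esub> b =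
          (b0 \<otimes>\<^bsub>H\<^esub> a0 \<oplus>\<^bsub>H\<^esub> b1 \<otimes>\<^bsub>H\<^esub> a0 \<oplus>\<^bsub>H\<^esub> b0 \<otimes>\<^bsub>H\<^esub> a1) \<ominus>\<^bsub>H\<^esub> b1 \<otimes>\<^bsub>H\<^esub> a1)"

section \<open>The Dirac element and the Casimir-type elements\<close>

text \<open>For \<open>\<alpha> = \<Sum>\<^sub>i \<alpha>\<^sub>i e\<^sub>i\<close> this is \<open>c\<^sub>\<alpha> = (\<Sum>\<^sub>i \<alpha>\<^sub>i c\<^sub>i) / \<bar>\<alpha>\<bar>\<close>; the lemmas below give its values on
  the positive roots.\<close>

definition c_root :: "nat \<Rightarrow> vec \<Rightarrow> falg" where
  "c_root n \<alpha> = scal (of_real (1 / sqrt (ip n \<alpha> \<alpha>))) *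
     (\<Sum>i=1..n. scal (of_real (\<alpha> i)) * c_gen i)"

lemma scal_0: "scal 0 = 0"
  and scal_1: "scal 1 = 1"
  and scal_minus: "scal (- a) = - scal a"
  by (simp_all add: scal_def single_uminus)

lemma sum_unit_vec:
  assumes "i \<in> {1..n}"
  shows "(\<Sum>l=1..n. scal (of_real (unit_vec i l)) * c_gen l) = c_gen i"
proof -
  have "(\<Sum>l=1..n. scal (of_real (unit_vec i l)) * c_gen l) = (\<Sum>l=1..n. if l = i then c_gen l else 0)"
    by (rule sum.cong) (simp_all add: unit_vec_def scal_0 scal_1)
  also have "\<dots> = c_gen i"
    using assms by simp
  finally show ?thesis .
qed

lemma ip_unit_vec:
  assumes "i \<in> {1..n}" "j \<in> {1..n}"
  shows "ip n (unit_vec i) (unit_vec j) = (if i = j then 1 else 0)"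
proof -
  have "ip n (unit_vec i) (unit_vec j) = (\<Sum>l=1..n. if l = i then (if i = j then 1 else 0) else 0)"
    unfolding ip_def by (rule sum.cong) (simp_all add: unit_vec_def)
  then show ?thesis using assms by simp
qed

lemma scal_add: "scal (a + b) = scal a + scal b"
  by (simp add: scal_def single_add)

lemma ip_add_left: "ip n (u + v) w = ip n u w + ip n v w"
  and ip_add_right: "ip n w (u + v) = ip n w u + ip n w v"
  and ip_diff_left: "ip n (u - v) w = ip n u w - ip n v w"
  and ip_diff_right: "ip n w (u - v) = ip n w u - ip n w v"
  by (simp_all add: ip_def algebra_simps sum.distrib sum_subtractf)

lemma inverse_sqrt2: "1 / sqrt 2 = sqrt 2 / 2"
  by (simp add: field_simps)

lemma c_root_short:
  assumes "i \<in> {1..n}"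
  shows "c_root n (unit_vec i) = c_gen i"
  using assms by (simp add: c_root_def ip_unit_vec sum_unit_vec[unfolded One_nat_def] scal_1)

lemma c_root_plus:
  assumes "1 \<le> i" "i < j" "j \<le> n"
  shows "c_root n (unit_vec i + unit_vec j) = scal (of_real (sqrt 2 / 2)) * (c_gen i + c_gen j)"
  using assms
  by (simp add: c_root_def ip_add_left ip_add_right ip_unit_vec scal_add distrib_right sum.distrib
      sum_unit_vec[unfolded One_nat_def] inverse_sqrt2 del: of_real_divide)

lemma c_root_minus:
  assumes "1 \<le> i" "i < j" "j \<le> n"
  shows "c_root n (unit_vec i - unit_vec j) = scal (of_real (sqrt 2 / 2)) * (c_gen i - c_gen j)"
proof -
  have "scal (a - b) = scal a - (scal b :: falg)" for a b
    using scal_add[of a "- b"] by (simp add: scal_minus)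
  then show ?thesis
    using assms
    by (simp add: c_root_def ip_diff_left ip_diff_right ip_unit_vec left_diff_distrib sum_subtractf
        sum_unit_vec[unfolded One_nat_def] inverse_sqrt2 del: of_real_divide)
qed

definition s_tilde :: "nat \<Rightarrow> vec \<Rightarrow> falg" where
  "s_tilde n \<alpha> = w_gen (reflection n \<alpha>) * c_root n \<alpha>"

definition dirac :: "root_type \<Rightarrow> nat \<Rightarrow> (vec \<Rightarrow> complex) \<Rightarrow> complex \<Rightarrow> falg set" where
  "dirac T n k N = cls T n k N
     ((\<Sum>i=1..n. x_gen i * c_gen i) +
      scal (of_real (sqrt 2 / 2)) *
        (\<Sum>\<alpha>\<in>pos_roots T n. scal (k \<alpha> * of_real (ip n \<alpha> \<alpha>)) * s_tilde n \<alpha>))"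

definition Omega_H :: "root_type \<Rightarrow> nat \<Rightarrow> (vec \<Rightarrow> complex) \<Rightarrow> complex \<Rightarrow> falg set" where
  "Omega_H T n k N = cls T n k N (\<Sum>i=1..n. x_gen i * x_gen i)"

definition Omega_Seg :: "root_type \<Rightarrow> nat \<Rightarrow> (vec \<Rightarrow> complex) \<Rightarrow> complex \<Rightarrow> falg set" where
  "Omega_Seg T n k N = cls T n k N
     (scal (1 / 2) *
        (\<Sum>(\<alpha>, \<beta>)\<in>{(\<alpha>, \<beta>). \<alpha> \<in> pos_roots T n \<and> \<beta> \<in> pos_roots T n \<and>
                               - reflection n \<alpha> \<beta> \<in> pos_roots T n}.
           scal (of_real (\<bar>ip n \<alpha> \<alpha>\<bar> * \<bar>ip n \<beta> \<beta>\<bar>) * k \<alpha> * k \<beta>) *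
             (s_tilde n \<alpha> * s_tilde n \<beta>)))"

end

theory Submission
  imports Defs
begin

text \<open>
  Write \<open>D = X + S\<close> with \<open>X = \<Sum>\<^sub>i x\<^sub>i c\<^sub>i\<close>, and put \<open>m\<^sub>\<alpha> = (sqrt 2 / 2) k\<^sub>\<alpha> \<langle>\<alpha>, \<alpha>\<rangle>\<close>. For a simple root \<open>\<alpha>\<close> the
  commutators of \<open>X\<close> and of \<open>S\<close> with \<open>s\<^sub>\<alpha>\<close> are opposite multiples of \<open>c\<^sub>\<alpha>\<close>, because \<open>s\<^sub>\<alpha>\<close> permutes
  the positive roots other than \<open>\<alpha>\<close>; hence \<open>D\<close> commutes with every reflection. Moreover \<open>X\<close>
  anticommutes with all \<open>c\<^sub>i\<close>, and \<open>s\<^sub>\<alpha> (s\<^sub>\<beta> c\<^sub>\<beta>) c\<^sub>\<alpha> = - (s\<^sub>\<alpha> c\<^sub>\<alpha>) (s\<^sub>\<beta> c\<^sub>\<beta>)\<close>. Moving \<open>D\<close> past the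
  reflections in \<open>D S\<close> therefore gives \<open>D S = - S X - S\<^sup>2\<close>, that is, \<open>D\<^sup>2 = X\<^sup>2 - S\<^sup>2\<close>. The same
  identity shows that in \<open>S\<^sup>2\<close> the pairs \<open>(\<alpha>, \<beta>)\<close> with \<open>s\<^sub>\<alpha>(\<beta>) > 0\<close> cancel, so \<open>S\<^sup>2 = \<Omega>\<^sub>S\<^sub>e\<^sub>g\<close>.
  Each pair \<open>i < j\<close> contributes \<open>N\<close> to \<open>X\<^sup>2\<close>, whence the scalar \<open>N n (n - 1) / 2\<close>.
  Since \<open>\<Sum>\<^sub>i x\<^sub>i\<^sup>2\<close> is central and \<open>\<Omega>\<^sub>S\<^sub>e\<^sub>g\<close> is even, \<open>D\<^sup>2\<close> commutes with everything that
  supercommutes with \<open>Seg\<close>. Type \<open>D\<close> is type \<open>B\<close> with parameter zero on the short roots.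
\<close>

section \<open>Reflections and positive roots\<close>

lemma ip_commute: "ip n u v = ip n v u"
  by (simp add: ip_def mult.commute)

lemma ip_minus_left: "ip n (- u) v = - ip n u v"
  and ip_minus_right: "ip n u (- v) = - ip n u v"
  by (simp_all add: ip_def sum_negf)

lemma ip_scale_left: "ip n (\<lambda>l. a * u l) v = a * ip n u v"
  by (simp add: ip_def sum_distrib_left mult_ac)

lemma reflection_alt: "reflection n \<alpha> v = v - (\<lambda>l. 2 * ip n v \<alpha> / ip n \<alpha> \<alpha> * \<alpha> l)"
  by (simp add: reflection_def fun_eq_iff)

lemma reflection_add: "reflection n \<alpha> (u + v) = reflection n \<alpha> u + reflection n \<alpha> v"
  and reflection_diff: "reflection n \<alpha> (u - v) = reflection n \<alpha> u - reflection n \<alpha> v"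
  and reflection_minus: "reflection n \<alpha> (- v) = - reflection n \<alpha> v"
  by (simp_all add: reflection_def fun_eq_iff ip_add_left ip_diff_left ip_minus_left
      algebra_simps add_divide_distrib diff_divide_distrib)

lemma reflection_scale: "reflection n \<alpha> (\<lambda>l. a * v l) = (\<lambda>l. a * reflection n \<alpha> v l)"
  by (simp add: reflection_def fun_eq_iff ip_scale_left algebra_simps)

lemma reflection_uminus: "reflection n (- \<alpha>) = reflection n \<alpha>"
  by (simp add: reflection_def fun_eq_iff ip_minus_left ip_minus_right)

lemma reflection_self: "ip n \<alpha> \<alpha> \<noteq> 0 \<Longrightarrow> reflection n \<alpha> \<alpha> = - \<alpha>"
  by (simp add: reflection_def fun_eq_iff)

lemma ip_reflection_left:
  "ip n (reflection n \<alpha> u) v = ip n u v - 2 * ip n u \<alpha> / ip n \<alpha> \<alpha> * ip n \<alpha> v"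
  unfolding reflection_alt ip_diff_left ip_scale_left ..

lemma reflection_involution: "ip n \<alpha> \<alpha> \<noteq> 0 \<Longrightarrow> reflection n \<alpha> (reflection n \<alpha> v) = v"
  unfolding reflection_def[of n \<alpha> "reflection n \<alpha> v"] ip_reflection_left
  by (simp add: fun_eq_iff reflection_def)

lemma reflection_comp_self: "ip n \<alpha> \<alpha> \<noteq> 0 \<Longrightarrow> reflection n \<alpha> \<circ> reflection n \<alpha> = id"
  by (simp add: fun_eq_iff reflection_involution)

lemma ip_reflection_swap: "ip n (reflection n \<alpha> u) v = ip n u (reflection n \<alpha> v)"
  unfolding ip_commute[of n u "reflection n \<alpha> v"] ip_reflection_left
  by (simp add: ip_commute mult_ac)

lemma ip_reflection: "ip n \<alpha> \<alpha> \<noteq> 0 \<Longrightarrow> ip n (reflection n \<alpha> u) (reflection n \<alpha> v) = ip n u v"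
  by (simp add: ip_reflection_swap reflection_involution)

text \<open>Reflections are self-adjoint isometries: applying the outer reflection to the formula
  for the inner one keeps the pairing with \<alpha>, and self-adjointness moves that pairing onto
  the reflected root.\<close>

lemma reflection_conj:
  assumes "ip n \<beta> \<beta> \<noteq> 0"
  shows "reflection n (reflection n \<beta> \<alpha>) = reflection n \<beta> \<circ> reflection n \<alpha> \<circ> reflection n \<beta>"
proof
  fix v
  have "reflection n \<beta> (reflection n \<alpha> (reflection n \<beta> v))
      = v - (\<lambda>l. 2 * ip n v (reflection n \<beta> \<alpha>) / ip n \<alpha> \<alpha> * reflection n \<beta> \<alpha> l)"
    unfolding reflection_alt[of n \<alpha>] reflection_diff reflection_scale
    by (simp add: assms reflection_involution ip_reflection_swap)
  then show "reflection n (reflection n \<beta> \<alpha>) v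
      = (reflection n \<beta> \<circ> reflection n \<alpha> \<circ> reflection n \<beta>) v"
    by (simp add: reflection_alt[of n "reflection n \<beta> \<alpha>"] ip_reflection assms)
qed

lemma unit_vec_apply: "unit_vec i l = (if l = i then 1 else 0)"
  by (simp add: unit_vec_def)

lemma ip_unit_vec_left: "i \<in> {1..n} \<Longrightarrow> ip n (unit_vec i) v = v i"
proof -
  assume i: "i \<in> {1..n}"
  have "ip n (unit_vec i) v = (\<Sum>l=1..n. if l = i then v l else 0)"
    unfolding ip_def by (rule sum.cong) (simp_all add: unit_vec_apply)
  then show ?thesis using i by simp
qed

lemma reflection_unit_minus:
  assumes "i \<in> {1..n}" "j \<in> {1..n}" "l \<in> {1..n}" "i \<noteq> j"
  shows "reflection n (unit_vec i - unit_vec j) (unit_vec l)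
    = unit_vec (if l = i then j else if l = j then i else l)"
  using assms
  by (auto simp: reflection_def fun_eq_iff ip_diff_left ip_diff_right ip_unit_vec_left)
     (auto simp: unit_vec_apply)

lemma reflection_unit_short:
  assumes "i \<in> {1..n}" "l \<in> {1..n}"
  shows "reflection n (unit_vec i) (unit_vec l) = (if l = i then - unit_vec i else unit_vec l)"
  using assms
  by (auto simp: reflection_def fun_eq_iff ip_unit_vec_left) (auto simp: unit_vec_apply)

lemma norm_pos_roots:
  assumes "\<alpha> \<in> pos_roots T n"
  shows "ip n \<alpha> \<alpha> = 1 \<or> ip n \<alpha> \<alpha> = 2"
  using assms
  by (cases T) (auto simp: long_minus_def long_plus_def ip_add_left ip_diff_left ip_unit_vec_left unit_vec_apply)

lemma norm_pos_roots_nz: "\<alpha> \<in> pos_roots T n \<Longrightarrow> ip n \<alpha> \<alpha> \<noteq> 0"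
  using norm_pos_roots[of \<alpha> T n] by auto

lemma finite_pos_roots: "finite (pos_roots T n)"
proof -
  have "finite (long_minus n)"
    by (rule finite_subset[of _ "(\<lambda>(i, j). unit_vec i - unit_vec j) ` ({1..n} \<times> {1..n})"])
       (auto simp: long_minus_def)
  moreover have "finite (long_plus n)"
    by (rule finite_subset[of _ "(\<lambda>(i, j). unit_vec i + unit_vec j) ` ({1..n} \<times> {1..n})"])
       (auto simp: long_plus_def)
  moreover have "finite {unit_vec i | i. 1 \<le> i \<and> i \<le> n}"
    by (rule finite_subset[of _ "unit_vec ` {1..n}"]) auto
  ultimately show ?thesis by (cases T) auto
qed

lemma pos_roots_uminus:
  assumes "\<alpha> \<in> pos_roots T n"
  shows "- \<alpha> \<notin> pos_roots T n"
proof -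
  \<comment> \<open>The weights are n, n - 1, ..., 1: since they decrease, e_i - e_j is positive,
    and since they end at 1 rather than 0, e_n is positive as well.\<close>
  define h where "h v = ip n v (\<lambda>l. real (Suc n - l))" for v
  have pos: "h \<beta> > 0" if "\<beta> \<in> pos_roots T n" for \<beta>
    using that
    by (cases T)
       (auto simp: h_def long_minus_def long_plus_def ip_add_left ip_diff_left ip_unit_vec_left)
  moreover have "h (- \<alpha>) = - h \<alpha>" by (simp add: h_def ip_minus_left)
  ultimately show ?thesis
    using pos[OF assms] pos[of "- \<alpha>"] by (metis neg_0_less_iff_less not_less_iff_gr_or_eq)
qed

section \<open>Simple roots and generation by simple reflections\<close>

lemma pos_rootsI:
  "1 \<le> i \<Longrightarrow> i < j \<Longrightarrow> j \<le> n \<Longrightarrow> unit_vec i - unit_vec j \<in> pos_roots T n"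
  "i \<noteq> j \<Longrightarrow> i \<in> {1..n} \<Longrightarrow> j \<in> {1..n} \<Longrightarrow> unit_vec i + unit_vec j \<in> pos_roots TypeB n"
  "i \<in> {1..n} \<Longrightarrow> unit_vec i \<in> pos_roots TypeB n"
proof -
  show "1 \<le> i \<Longrightarrow> i < j \<Longrightarrow> j \<le> n \<Longrightarrow> unit_vec i - unit_vec j \<in> pos_roots T n"
    by (cases T) (auto simp: long_minus_def)
  have *: "unit_vec i + unit_vec j \<in> pos_roots TypeB n" if "i < j" "i \<in> {1..n}" "j \<in> {1..n}" for i j
    using that by (auto simp: long_plus_def)
  show "i \<noteq> j \<Longrightarrow> i \<in> {1..n} \<Longrightarrow> j \<in> {1..n} \<Longrightarrow> unit_vec i + unit_vec j \<in> pos_roots TypeB n"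
    using *[of i j] *[of j i] by (metis add.commute linorder_neqE_nat)
qed auto

lemma pos_roots_cases [consumes 2, case_names minus plus short]:
  assumes "\<beta> \<in> pos_roots T n" "T \<noteq> TypeD"
  obtains (minus) a b where "\<beta> = unit_vec a - unit_vec b" "1 \<le> a" "a < b" "b \<le> n"
  | (plus) a b where "\<beta> = unit_vec a + unit_vec b" "1 \<le> a" "a < b" "b \<le> n" "T = TypeB"
  | (short) a where "\<beta> = unit_vec a" "1 \<le> a" "a \<le> n" "T = TypeB"
  using assms by (cases T) (auto simp: long_minus_def long_plus_def)

text \<open>The standard base in types A and B. Type D has no base of its own here, because it is
  later treated inside type B.\<close>

definition simple_roots :: "root_type \<Rightarrow> nat \<Rightarrow> vec set" where
  "simple_roots T n = {unit_vec i - unit_vec (Suc i) | i. 1 \<le> i \<and> i < n} \<union>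
     (if T = TypeB \<and> 1 \<le> n then {unit_vec n} else {})"

lemma simple_roots_subset: "simple_roots T n \<subseteq> pos_roots T n"
  by (auto simp: simple_roots_def simp del: pos_roots.simps intro!: pos_rootsI(1,3) split: if_splits)

text \<open>An adjacent transposition preserves the order of every pair of indices other than its
  own, and the sign change of the last coordinate exchanges e_a - e_n with e_a + e_n. The only
  positive root that can become negative is the simple root itself.\<close>

lemma reflection_simple:
  assumes "\<alpha> \<in> simple_roots T n" "\<beta> \<in> pos_roots T n" "\<beta> \<noteq> \<alpha>" and T: "T \<noteq> TypeD"
  shows "reflection n \<alpha> \<beta> \<in> pos_roots T n"
proof (cases "\<exists>i. \<alpha> = unit_vec i - unit_vec (Suc i) \<and> 1 \<le> i \<and> i < n")
  case True
  then obtain i where i: "\<alpha> = unit_vec i - unit_vec (Suc i)" "1 \<le> i" "i < n" by blast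
  define \<tau> where "\<tau> l = (if l = i then Suc i else if l = Suc i then i else l)" for l
  have r: "reflection n \<alpha> (unit_vec l) = unit_vec (\<tau> l)" if "l \<in> {1..n}" for l
    unfolding i(1) \<tau>_def using i that by (intro reflection_unit_minus) auto
  have \<tau>: "\<tau> l \<in> {1..n}" if "l \<in> {1..n}" for l
    using i that by (auto simp: \<tau>_def)
  have inj: "\<tau> a \<noteq> \<tau> b" if "a \<noteq> b" for a b
    using that by (auto simp: \<tau>_def split: if_splits)
  from assms(2) T show ?thesis
  proof (cases rule: pos_roots_cases)
    case (minus a b)
    \<comment> \<open>The transposition reverses only the pair (i, i + 1), which
      \<open>\<beta> \<noteq> \<alpha>\<close> excludes.\<close>
    then have "\<tau> a < \<tau> b"
      using assms(3) i by (auto simp: \<tau>_def)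
    then show ?thesis
      using minus \<tau>[of a] \<tau>[of b] by (auto simp: reflection_diff r intro!: pos_rootsI(1))
  next
    case (plus a b)
    then show ?thesis
      using \<tau>[of a] \<tau>[of b] inj[of a b] by (auto simp: reflection_add r simp del: pos_roots.simps intro!: pos_rootsI(2))
  next
    case (short a)
    then show ?thesis
      using \<tau>[of a] by (auto simp: r simp del: pos_roots.simps intro!: pos_rootsI(3))
  qed
next
  case False
  then have n: "\<alpha> = unit_vec n" "T = TypeB" "1 \<le> n"
    using assms(1) by (auto simp: simple_roots_def split: if_splits)
  have r: "reflection n \<alpha> (unit_vec l) = (if l = n then - unit_vec n else unit_vec l)"
    if "l \<in> {1..n}" for l
    unfolding n(1) using n that by (intro reflection_unit_short) auto
  from assms(2) T show ?thesis
  proof (cases rule: pos_roots_cases)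
    case (minus a b)
    then show ?thesis
      using n by (auto simp: reflection_diff r[unfolded n(1)] simp del: pos_roots.simps intro!: pos_rootsI)
  next
    case (plus a b)
    then show ?thesis
      using n by (auto simp: reflection_add r[unfolded n(1)] simp del: pos_roots.simps intro!: pos_rootsI
          simp flip: diff_conv_add_uminus)
  next
    case (short a)
    then show ?thesis
      using n assms(3) by (auto simp: r[unfolded n(1)] simp del: pos_roots.simps intro!: pos_rootsI)
  qed
qed

lemma reflection_in_weyl: "\<alpha> \<in> roots T n \<Longrightarrow> reflection n \<alpha> \<in> weyl T n"
  using weyl_refl[OF _ weyl_id, of \<alpha> T n] by simp

lemma pos_root_in_roots: "\<alpha> \<in> pos_roots T n \<Longrightarrow> \<alpha> \<in> roots T n"
  by (simp add: roots_def)

lemmas pos_reflection_in_weyl = reflection_in_weyl[OF pos_root_in_roots]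

lemma weyl_comp: "u \<in> weyl T n \<Longrightarrow> v \<in> weyl T n \<Longrightarrow> u \<circ> v \<in> weyl T n"
  by (induction rule: weyl.induct) (simp_all add: comp_assoc weyl.weyl_refl)

text \<open>The defining relations speak of simple reflections only; this rule carries their
  consequences to all positive roots. Conjugating e_i - e_j by the transposition (j, j + 1) reaches
  e_i - e_{j+1}, conjugating e_{m+1} by (m, m + 1) reaches e_m, and conjugating e_a - e_b by the
  sign change at b reaches e_a + e_b.\<close>

lemma pos_reflection_induct [consumes 2, case_names simple comp]:
  assumes "\<alpha> \<in> pos_roots T n" "T \<noteq> TypeD"
    and simple: "\<And>\<alpha>. \<alpha> \<in> simple_roots T n \<Longrightarrow> Q (reflection n \<alpha>)"
    and comp: "\<And>u v. u \<in> weyl T n \<Longrightarrow> v \<in> weyl T n \<Longrightarrow> Q u \<Longrightarrow> Q v \<Longrightarrow> Q (u \<circ> v)"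
  shows "Q (reflection n \<alpha>)"
proof -
  have conj: "Q (reflection n (reflection n \<beta> \<gamma>))"
    if "\<beta> \<in> pos_roots T n" "Q (reflection n \<beta>)" "\<gamma> \<in> pos_roots T n" "Q (reflection n \<gamma>)" for \<beta> \<gamma>
    unfolding reflection_conj[OF norm_pos_roots_nz[OF that(1)]]
    by (intro comp weyl_comp pos_reflection_in_weyl that)
  have adj: "unit_vec i - unit_vec (Suc i) \<in> simple_roots T n" if "1 \<le> i" "i < n" for i
    using that by (auto simp: simple_roots_def)
  have refl_minus: "Q (reflection n (unit_vec i - unit_vec j))" if "1 \<le> i" "i < j" "j \<le> n" for i j
    using that(2,3)
  proof (induction j)
    case (Suc j)
    show ?case
    proof (cases "i = j")
      case True
      have "unit_vec j - unit_vec (Suc j) \<in> simple_roots T n"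
        by (rule adj) (use True that Suc.prems in auto)
      then show ?thesis unfolding True by (rule simple)
    next
      case False
      have "reflection n (unit_vec j - unit_vec (Suc j)) (unit_vec i - unit_vec j)
          = unit_vec i - unit_vec (Suc j)"
        using False Suc.prems that(1) by (simp add: reflection_diff reflection_unit_minus)
      moreover have "Q (reflection n (reflection n (unit_vec j - unit_vec (Suc j)) (unit_vec i - unit_vec j)))"
        by (rule conj[OF pos_rootsI(1) simple[OF adj] pos_rootsI(1) Suc.IH])
          (use False Suc.prems that(1) in auto)
      ultimately show ?thesis by (simp only:)
    qed
  qed simp
  have short_pos: "unit_vec i \<in> pos_roots T n" if "1 \<le> i" "i \<le> n" "T = TypeB" for i
    unfolding that(3) using that(1,2) by (intro pos_rootsI(3)) auto
  have refl_short: "Q (reflection n (unit_vec i))" if "1 \<le> i" "i \<le> n" "T = TypeB" for i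
    using that(2,1)
  \<comment> \<open>The induction runs downwards from n, because e_n is the only short simple
    root.\<close>
  proof (induction i rule: inc_induct)
    case base
    then show ?case using that by (intro simple) (auto simp: simple_roots_def)
  next
    case (step m)
    have "reflection n (unit_vec m - unit_vec (Suc m)) (unit_vec (Suc m)) = unit_vec m"
      using step by (simp add: reflection_unit_minus)
    moreover have "Q (reflection n (reflection n (unit_vec m - unit_vec (Suc m)) (unit_vec (Suc m))))"
      by (rule conj[OF pos_rootsI(1) simple[OF adj] short_pos step.IH])
        (use step.hyps step.prems that(3) in auto)
    ultimately show ?case by (simp only:)
  qed
  from assms(1,2) show ?thesis
  proof (cases rule: pos_roots_cases)
    case (minus a b)
    then show ?thesis unfolding minus(1) by (intro refl_minus)
  next
    case (plus a b)
    have "reflection n (unit_vec b) (unit_vec a - unit_vec b) = unit_vec a + unit_vec b"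
      using plus by (simp add: reflection_diff reflection_unit_short)
    moreover have "Q (reflection n (reflection n (unit_vec b) (unit_vec a - unit_vec b)))"
      by (rule conj[OF short_pos refl_short pos_rootsI(1) refl_minus]) (use plus in auto)
    ultimately show ?thesis unfolding plus(1) by (simp only:)
  next
    case (short a)
    then show ?thesis unfolding short(1) by (intro refl_short)
  qed
qed

lemma roots_iff: "\<beta> \<in> roots T n \<longleftrightarrow> \<beta> \<in> pos_roots T n \<or> - \<beta> \<in> pos_roots T n"
proof -
  have "\<beta> \<in> uminus ` P \<longleftrightarrow> - \<beta> \<in> P" for P
    by (metis image_iff minus_minus)
  then show ?thesis by (simp only: roots_def Un_iff)
qed

lemma reflection_pos_root_or:
  assumes "\<alpha> \<in> pos_roots T n" "T \<noteq> TypeD" "\<beta> \<in> pos_roots T n"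
  shows "reflection n \<alpha> \<beta> \<in> pos_roots T n \<or> - reflection n \<alpha> \<beta> \<in> pos_roots T n"
proof -
  \<comment> \<open>The induction composes reflections, so the invariant must concern all roots:
    positivity alone is not preserved by a factor.\<close>
  from assms(1,2) have "\<forall>\<beta> \<in> roots T n. reflection n \<alpha> \<beta> \<in> roots T n"
  proof (induction rule: pos_reflection_induct)
    case (simple \<alpha>)
    have *: "reflection n \<alpha> \<beta> \<in> pos_roots T n \<or> - reflection n \<alpha> \<beta> \<in> pos_roots T n"
      if "\<beta> \<in> pos_roots T n" for \<beta>
    proof (cases "\<beta> = \<alpha>")
      case True
      then show ?thesis
        using that by (simp only: reflection_self[OF norm_pos_roots_nz] minus_minus simp_thms)
    next
      case False
      then show ?thesis
        using reflection_simple[OF simple that _ assms(2)] by simp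
    qed
    show ?case
    proof
      fix \<beta>
      assume "\<beta> \<in> roots T n"
      then show "reflection n \<alpha> \<beta> \<in> roots T n"
        using *[of \<beta>] *[of "- \<beta>"] unfolding roots_iff reflection_minus minus_minus by blast
    qed
  qed simp
  then have "reflection n \<alpha> \<beta> \<in> roots T n"
    using pos_root_in_roots[OF assms(3)] by blast
  then show ?thesis by (simp only: roots_iff)
qed

section \<open>The Dirac element\<close>

text \<open>The ring is not assumed to be unital: \<open>sc 1\<close> is only a unit for the elements that occur.
  This is what the embedding of a quotient ring into a type of sort \<open>ring\<close> below provides.\<close>

locale hecke_clifford_relations =
  fixes T :: root_type and n :: nat and k :: "vec \<Rightarrow> complex" and N :: complex
    and sc :: "complex \<Rightarrow> 'a::ring" and x c :: "nat \<Rightarrow> 'a" and w :: "(vec \<Rightarrow> vec) \<Rightarrow> 'a"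
  assumes type: "T \<noteq> TypeD" and n_pos: "1 \<le> n"
    and k_inv: "weyl_invariant T n k"
    and sc_add: "sc (a + b) = sc a + sc b"
    and sc_mult: "sc a * sc b = sc (a * b)"
    and sc_x: "x i * sc a = sc a * x i"
    and sc_c: "c i * sc a = sc a * c i"
    and sc_w: "w g * sc a = sc a * w g"
    and one_x: "sc 1 * x i = x i"
    and one_c: "sc 1 * c i = c i"
    and one_w: "sc 1 * w g = w g"
    and w_id: "w id = sc 1"
    and w_comp: "u \<in> weyl T n \<Longrightarrow> v \<in> weyl T n \<Longrightarrow> w (u \<circ> v) = w u * w v"
    and xc: "i \<noteq> j \<Longrightarrow> x i * c j = c j * x i"
    and xc_same: "x i * c i = - (c i * x i)"
    and cc: "i \<noteq> j \<Longrightarrow> c i * c j = - (c j * c i)"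
    and cc_same: "i \<in> {1..n} \<Longrightarrow> c i * c i = - sc 1"
    and s_c: "1 \<le> i \<Longrightarrow> i < n \<Longrightarrow> l \<in> {1..n} \<Longrightarrow>
      w (reflection n (unit_vec i - unit_vec (Suc i))) * c l =
        c (if l = i then Suc i else if l = Suc i then i else l) *
          w (reflection n (unit_vec i - unit_vec (Suc i)))"
    and s_x: "1 \<le> i \<Longrightarrow> i < n \<Longrightarrow>
      w (reflection n (unit_vec i - unit_vec (Suc i))) * x i =
        x (Suc i) * w (reflection n (unit_vec i - unit_vec (Suc i))) +
        sc (k (unit_vec i - unit_vec (Suc i))) * (c i * c (Suc i) - sc 1)"
    and s_x_far: "1 \<le> i \<Longrightarrow> i < n \<Longrightarrow> l \<in> {1..n} \<Longrightarrow> l \<noteq> i \<Longrightarrow> l \<noteq> Suc i \<Longrightarrow>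
      w (reflection n (unit_vec i - unit_vec (Suc i))) * x l =
        x l * w (reflection n (unit_vec i - unit_vec (Suc i)))"
    and sn_c: "T = TypeB \<Longrightarrow>
      w (reflection n (unit_vec n)) * c n = - (c n * w (reflection n (unit_vec n)))"
    and sn_c_far: "T = TypeB \<Longrightarrow> i \<in> {1..n} \<Longrightarrow> i \<noteq> n \<Longrightarrow>
      w (reflection n (unit_vec n)) * c i = c i * w (reflection n (unit_vec n))"
    and sn_x: "T = TypeB \<Longrightarrow>
      w (reflection n (unit_vec n)) * x n =
        - (x n * w (reflection n (unit_vec n))) - sc (of_real (sqrt 2) * k (unit_vec n))"
    and sn_x_far: "T = TypeB \<Longrightarrow> i \<in> {1..n} \<Longrightarrow> i \<noteq> n \<Longrightarrow>
      w (reflection n (unit_vec n)) * x i = x i * w (reflection n (unit_vec n))"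
    and xx: "i \<in> {1..n} \<Longrightarrow> j \<in> {1..n} \<Longrightarrow> i \<noteq> j \<Longrightarrow>
      x i * x j = x j * x i + sc N * (c j * c i)"
begin

abbreviation P where "P \<equiv> pos_roots T n"

abbreviation s where "s \<alpha> \<equiv> w (reflection n \<alpha>)"

section \<open>Scalars in the ambient ring\<close>

lemma sc_0: "sc 0 = 0"
  using sc_add[of 0 0] by simp

lemma sc_minus: "sc (- a) = - sc a"
  using sc_add[of a "- a"] by (simp add: sc_0 eq_neg_iff_add_eq_0 add.commute)

lemma sc_diff: "sc (a - b) = sc a - sc b"
  using sc_add[of a "- b"] by (simp add: sc_minus)

lemma sc_sum: "sc (sum f A) = (\<Sum>i\<in>A. sc (f i))"
  by (induction A rule: infinite_finite_induct) (simp_all add: sc_0 sc_add)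

lemma sc_sc: "sc a * (sc b * y) = sc (a * b) * y"
  by (simp add: sc_mult flip: mult.assoc)

lemma sc_x_left: "x i * (sc a * y) = sc a * (x i * y)"
  and sc_c_left: "c i * (sc a * y) = sc a * (c i * y)"
  and sc_w_left: "w g * (sc a * y) = sc a * (w g * y)"
  by (simp_all add: sc_x sc_c sc_w flip: mult.assoc)

lemmas scalars = sc_x sc_c sc_w sc_x_left sc_c_left sc_w_left sc_mult sc_sc

lemma one_right: "x i * sc 1 = x i" "c i * sc 1 = c i" "w g * sc 1 = w g"
  by (simp_all add: scalars one_x one_c one_w)

lemma one_left: "sc 1 * (x i * y) = x i * y" "sc 1 * (c i * y) = c i * y" "sc 1 * (w g * y) = w g * y"
  by (simp_all add: one_x one_c one_w flip: mult.assoc)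

text \<open>Division by 2 is multiplication by \<open>sc (1 / 2)\<close>. As the ring need not have
  a unit, the hypotheses state that \<open>sc 1\<close> acts as one on both elements.\<close>

lemma halve:
  assumes "y + y = z + z" "sc 1 * y = y" "sc 1 * z = z"
  shows "y = z"
proof -
  have half: "u = sc (1 / 2) * (u + u)" if "sc 1 * u = u" for u
  proof -
    have "sc (1 / 2) * (u + u) = (sc (1 / 2) + sc (1 / 2)) * u"
      by (simp add: algebra_simps)
    also have "sc (1 / 2) + sc (1 / 2) = sc 1"
      by (simp flip: sc_add)
    finally show ?thesis using that by simp
  qed
  show ?thesis
    using half[OF assms(2)] half[OF assms(3)] assms(1) by simp
qed

section \<open>Clifford elements of vectors and their equivariance\<close>

definition cv :: "vec \<Rightarrow> 'a" where
  "cv v = (\<Sum>l=1..n. sc (of_real (v l)) * c l)"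

lemma cv_diff: "cv (u - v) = cv u - cv v"
  by (simp add: cv_def sc_diff left_diff_distrib sum_subtractf)

lemma cv_minus: "cv (- v) = - cv v"
  by (simp add: cv_def sc_minus sum_negf)

lemma cv_scale: "cv (\<lambda>l. a * v l) = sc (of_real a) * cv v"
  by (simp add: cv_def sum_distrib_left sc_sc)

lemma cv_unit: "i \<in> {1..n} \<Longrightarrow> cv (unit_vec i) = c i"
proof -
  assume i: "i \<in> {1..n}"
  have "cv (unit_vec i) = (\<Sum>l=1..n. if l = i then c l else 0)"
    unfolding cv_def by (rule sum.cong) (simp_all add: unit_vec_apply one_c sc_0)
  then show ?thesis using i by simp
qed

lemma cv_reflection:
  "cv (reflection n \<alpha> v) = cv v - sc (of_real (2 * ip n v \<alpha> / ip n \<alpha> \<alpha>)) * cv \<alpha>"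
  by (simp only: reflection_alt cv_diff cv_scale)

lemma sc_cv: "cv v * sc a = sc a * cv v"
  and one_cv: "sc 1 * cv v = cv v"
  by (simp_all add: cv_def sum_distrib_left sum_distrib_right scalars mult.assoc mult.commute[of _ a])

lemma sc_cv_left: "cv v * (sc a * y) = sc a * (cv v * y)"
  by (simp add: sc_cv flip: mult.assoc)

text \<open>The Clifford relation for the negative definite form. Off the diagonal of the double sum
  c_l and c_m anticommute, so only the squares c_l c_l = -1 survive.\<close>

lemma cv_anticommute: "cv u * cv v + cv v * cv u = - sc (of_real (2 * ip n u v))"
proof -
  have "cv u * cv v = (\<Sum>l=1..n. \<Sum>m=1..n. sc (of_real (u l * v m)) * (c l * c m))"
    by (simp add: cv_def sum_product scalars mult.assoc)
  moreover have "cv v * cv u = (\<Sum>m=1..n. \<Sum>l=1..n. sc (of_real (u l * v m)) * (c m * c l))"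
    by (simp add: cv_def sum_product scalars mult.assoc mult.commute)
  moreover have "(\<Sum>m=1..n. \<Sum>l=1..n. sc (of_real (u l * v m)) * (c m * c l)) =
      (\<Sum>l=1..n. \<Sum>m=1..n. sc (of_real (u l * v m)) * (c m * c l))"
    by (rule sum.swap)
  ultimately have "cv u * cv v + cv v * cv u =
      (\<Sum>l=1..n. \<Sum>m=1..n. sc (of_real (u l * v m)) * (c l * c m + c m * c l))"
    by (simp add: sum.distrib distrib_left)
  also have "\<dots> = (\<Sum>l=1..n. \<Sum>m=1..n. if m = l then - sc (of_real (2 * (u l * v l))) else 0)"
  proof (intro sum.cong refl)
    fix l m assume l: "l \<in> {1..n}" "m \<in> {1..n}"
    show "sc (of_real (u l * v m)) * (c l * c m + c m * c l) =
        (if m = l then - sc (of_real (2 * (u l * v l))) else 0)"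
    proof (cases "m = l")
      case True
      have "sc (of_real (u l * v l)) * (- sc 1 - sc 1) =
          - (sc (of_real (u l * v l)) + sc (of_real (u l * v l)))"
        by (simp add: right_diff_distrib sc_mult)
      also have "\<dots> = - sc (of_real (2 * (u l * v l)))"
        by (simp only: flip: sc_add) simp
      finally show ?thesis using True cc_same[OF l(1)] by simp
    qed (simp add: cc[of m l])
  qed
  also have "\<dots> = - sc (of_real (2 * ip n u v))"
    by (simp add: ip_def sum_negf sc_sum sum_distrib_left)
  finally show ?thesis .
qed

lemma cv_square: "cv v * cv v = - sc (of_real (ip n v v))"
proof (rule halve)
  show "cv v * cv v + cv v * cv v = - sc (of_real (ip n v v)) + - sc (of_real (ip n v v))"
    unfolding cv_anticommute by (simp flip: sc_minus sc_add)
qed (simp_all add: one_cv sc_mult flip: mult.assoc)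

text \<open>In a Clifford algebra, reflecting in \<beta> is, up to sign, conjugation by the element
  of \<beta>. In the formula for the reflection, the square of \<open>cv \<beta>\<close> turns the
  correction into exactly the scalar of the anticommutator.\<close>

lemma cv_reflection_mult:
  assumes "ip n \<beta> \<beta> \<noteq> 0"
  shows "cv (reflection n \<beta> \<alpha>) * cv \<beta> = - (cv \<beta> * cv \<alpha>)"
proof -
  have "cv (reflection n \<beta> \<alpha>) * cv \<beta> = cv \<alpha> * cv \<beta> + sc (of_real (2 * ip n \<alpha> \<beta>))"
    using assms by (simp add: cv_reflection left_diff_distrib mult.assoc cv_square sc_mult)
  also have "\<dots> = - (cv \<beta> * cv \<alpha>)"
    using cv_anticommute[of \<alpha> \<beta>] by (simp add: eq_neg_iff_add_eq_0 algebra_simps)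
  finally show ?thesis .
qed

lemma weyl_P: "\<alpha> \<in> P \<Longrightarrow> reflection n \<alpha> \<in> weyl T n"
  by (rule pos_reflection_in_weyl)

lemma s_square: "\<alpha> \<in> P \<Longrightarrow> s \<alpha> * s \<alpha> = sc 1"
  by (simp add: reflection_comp_self norm_pos_roots_nz weyl_P w_id flip: w_comp)

lemma s_s_left: "\<alpha> \<in> P \<Longrightarrow> s \<alpha> * (s \<alpha> * y) = sc 1 * y"
  by (simp add: s_square flip: mult.assoc)

lemma s_conj:
  assumes "\<alpha> \<in> P" "\<beta> \<in> P"
  shows "s (reflection n \<alpha> \<beta>) = s \<alpha> * (s \<beta> * s \<alpha>)"
  using assms by (simp add: reflection_conj norm_pos_roots_nz w_comp weyl_P weyl_comp mult.assoc)

text \<open>Both sides are linear in v, so equivariance has to be checked on the generators c_l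
  only, which is where the presentation provides it.\<close>

lemma w_cv_basis:
  assumes "\<And>l. l \<in> {1..n} \<Longrightarrow> s \<alpha> * c l = cv (reflection n \<alpha> (unit_vec l)) * s \<alpha>"
  shows "s \<alpha> * cv v = cv (reflection n \<alpha> v) * s \<alpha>"
proof -
  have "s \<alpha> * cv v = (\<Sum>l=1..n. sc (of_real (v l)) * (s \<alpha> * c l))"
    by (simp add: cv_def sum_distrib_left scalars)
  also have "\<dots> = (\<Sum>l=1..n. sc (of_real (v l)) *
      ((c l - sc (of_real (2 * \<alpha> l / ip n \<alpha> \<alpha>)) * cv \<alpha>) * s \<alpha>))"
    by (rule sum.cong) (simp_all only: assms cv_reflection cv_unit ip_unit_vec_left)
  also have "\<dots> = (cv v - (\<Sum>l=1..n. sc (of_real (v l * (2 * \<alpha> l / ip n \<alpha> \<alpha>)))) * cv \<alpha>) * s \<alpha>"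
    by (simp add: cv_def[of v] sum_distrib_right left_diff_distrib right_diff_distrib sum_subtractf
        sc_mult flip: mult.assoc)
  also have "(\<Sum>l=1..n. sc (of_real (v l * (2 * \<alpha> l / ip n \<alpha> \<alpha>)))) =
      sc (of_real (2 * ip n v \<alpha> / ip n \<alpha> \<alpha>))"
    by (simp add: ip_def sum_distrib_left sum_divide_distrib mult_ac flip: sc_sum)
  finally show ?thesis by (simp only: cv_reflection)
qed

lemma simple_cases [consumes 1, case_names adjacent last]:
  assumes "\<alpha> \<in> simple_roots T n"
  obtains (adjacent) i where "\<alpha> = unit_vec i - unit_vec (Suc i)" "1 \<le> i" "i < n"
  | (last) "\<alpha> = unit_vec n" "T = TypeB"
  using assms by (auto simp: simple_roots_def split: if_splits)

lemma simple_P: "\<alpha> \<in> simple_roots T n \<Longrightarrow> \<alpha> \<in> P"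
  using simple_roots_subset by blast

lemma s_cv:
  assumes "\<alpha> \<in> P"
  shows "s \<alpha> * cv v = cv (reflection n \<alpha> v) * s \<alpha>"
proof -
  \<comment> \<open>The quantifier over v stays inside the induction: in a product, the outer factor
    acts on the image of v under the inner one.\<close>
  from assms type have "\<forall>v. w (reflection n \<alpha>) * cv v = cv (reflection n \<alpha> v) * w (reflection n \<alpha>)"
  proof (induction rule: pos_reflection_induct)
    case (simple \<alpha>)
    then have "s \<alpha> * c l = cv (reflection n \<alpha> (unit_vec l)) * s \<alpha>" if "l \<in> {1..n}" for l
    proof (cases rule: simple_cases)
      case (adjacent i)
      have "reflection n \<alpha> (unit_vec l) = unit_vec (if l = i then Suc i else if l = Suc i then i else l)"
        unfolding adjacent(1) using adjacent that by (intro reflection_unit_minus) auto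
      moreover have "(if l = i then Suc i else if l = Suc i then i else l) \<in> {1..n}"
        using adjacent that by auto
      ultimately show ?thesis
        using s_c[OF adjacent(2,3) that] by (simp only: cv_unit adjacent(1))
    next
      case last
      have "reflection n \<alpha> (unit_vec l) = (if l = n then - unit_vec n else unit_vec l)"
        unfolding last(1) using that n_pos by (intro reflection_unit_short) auto
      then show ?thesis
        using sn_c[OF last(2)] sn_c_far[OF last(2) that] that
        by (cases "l = n") (simp_all only: cv_minus cv_unit last(1) if_True if_False mult_minus_left simp_thms)
    qed
    then show ?case using w_cv_basis by blast
  next
    case (comp u v)
    show ?case
    proof
      fix y
      have "w u * w v * cv y = w u * cv (v y) * w v"
        using comp(4) by (simp add: mult.assoc)
      also have "\<dots> = cv (u (v y)) * (w u * w v)"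
        using comp(3) by (simp add: mult.assoc)
      finally show "w (u \<circ> v) * cv y = cv ((u \<circ> v) y) * w (u \<circ> v)"
        unfolding w_comp[OF comp(1,2)] o_apply .
    qed
  qed
  then show ?thesis by blast
qed

section \<open>The elements s_\<alpha> c_\<alpha>\<close>

definition cr :: "vec \<Rightarrow> 'a" where
  "cr \<alpha> = sc (of_real (1 / sqrt (ip n \<alpha> \<alpha>))) * cv \<alpha>"

definition st :: "vec \<Rightarrow> 'a" where
  "st \<alpha> = s \<alpha> * cr \<alpha>"

lemma cr_minus: "cr (- \<alpha>) = - cr \<alpha>"
  by (simp add: cr_def cv_minus ip_minus_left ip_minus_right)

lemma st_minus: "st (- \<alpha>) = - st \<alpha>"
  by (simp add: st_def cr_minus reflection_uminus)

lemma s_cr: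
  assumes "\<alpha> \<in> P"
  shows "s \<alpha> * cr v = cr (reflection n \<alpha> v) * s \<alpha>"
  using assms by (simp add: cr_def sc_w_left s_cv ip_reflection norm_pos_roots_nz mult.assoc)

lemma cr_reflection_mult:
  assumes "\<alpha> \<in> P" "\<beta> \<in> P"
  shows "cr (reflection n \<beta> \<alpha>) * cr \<beta> = - (cr \<beta> * cr \<alpha>)"
  using assms cv_reflection_mult[of \<beta> \<alpha>]
  by (simp add: cr_def ip_reflection norm_pos_roots_nz mult.assoc sc_cv_left sc_sc mult.commute)

lemma one_cr: "sc 1 * cr v = cr v"
  by (simp add: cr_def sc_sc)

lemma sc_cr_left: "cr v * (sc a * y) = sc a * (cr v * y)"
  by (simp add: cr_def mult.assoc sc_cv_left sc_sc mult.commute)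

lemma sc_st_left: "st v * (sc a * y) = sc a * (st v * y)"
  by (simp add: st_def mult.assoc sc_cr_left sc_w_left)

lemma s_st:
  assumes "\<alpha> \<in> P" "\<beta> \<in> P"
  shows "s \<alpha> * st \<beta> = st (reflection n \<alpha> \<beta>) * s \<alpha>"
  using assms
  by (simp add: st_def s_conj mult.assoc)
     (simp add: s_s_left one_cr flip: s_cr)

text \<open>Used both for D S and for S^2. Moving c_\<alpha> to the right past s_\<beta> yields the
  Clifford element of the reflected root, and \<open>cr_reflection_mult\<close> then exchanges it
  with c_\<beta> at the cost of a sign.\<close>

lemma s_st_cr:
  assumes "\<alpha> \<in> P" "\<beta> \<in> P"
  shows "s \<alpha> * (st \<beta> * cr \<alpha>) = - (st \<alpha> * st \<beta>)"
proof -
  have "st \<alpha> * st \<beta> = s \<alpha> * ((cr \<alpha> * s \<beta>) * cr \<beta>)"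
    by (simp add: st_def mult.assoc)
  also have "cr \<alpha> * s \<beta> = s \<beta> * cr (reflection n \<beta> \<alpha>)"
    using assms by (simp add: s_cr reflection_involution norm_pos_roots_nz)
  also have "s \<alpha> * (s \<beta> * cr (reflection n \<beta> \<alpha>) * cr \<beta>) = - (s \<alpha> * (s \<beta> * (cr \<beta> * cr \<alpha>)))"
    by (simp add: mult.assoc cr_reflection_mult[OF assms])
  finally show ?thesis by (simp add: st_def mult.assoc)
qed

text \<open>The form of \<open>s_st_cr\<close> in which the reflection has been absorbed. It pairs
  (\<alpha>, \<beta>) with (s_\<alpha>(\<beta>), \<alpha>) and is the source of the cancellation in
  S^2.\<close>

lemma st_st:
  assumes "\<alpha> \<in> P" "\<beta> \<in> P"
  shows "st (reflection n \<alpha> \<beta>) * st \<alpha> = - (st \<alpha> * st \<beta>)"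
  using s_st_cr[OF assms] by (simp add: s_st[OF assms] st_def[of \<alpha>] flip: mult.assoc)

section \<open>The group part S of the Dirac element\<close>

definition m :: "vec \<Rightarrow> complex" where
  "m \<alpha> = of_real (sqrt 2 / 2) * (k \<alpha> * of_real (ip n \<alpha> \<alpha>))"

definition X :: 'a where "X = (\<Sum>i=1..n. x i * c i)"

definition S :: 'a where "S = (\<Sum>\<alpha>\<in>P. sc (m \<alpha>) * st \<alpha>)"

definition kept :: "vec \<Rightarrow> vec set" where
  "kept \<alpha> = {\<beta> \<in> P. reflection n \<alpha> \<beta> \<in> P}"

text \<open>This is the inversion set of the reflection; the pairs it defines index the sum
  \<open>Omega_Seg\<close>.\<close>

definition flipped :: "vec \<Rightarrow> vec set" where
  "flipped \<alpha> = {\<beta> \<in> P. - reflection n \<alpha> \<beta> \<in> P}"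

definition S_kept :: "vec \<Rightarrow> 'a" where
  "S_kept \<alpha> = (\<Sum>\<beta>\<in>kept \<alpha>. sc (m \<beta>) * st \<beta>)"

definition S_flipped :: "vec \<Rightarrow> 'a" where
  "S_flipped \<alpha> = (\<Sum>\<beta>\<in>flipped \<alpha>. sc (m \<beta>) * st \<beta>)"

lemma finite_kept: "finite (kept \<alpha>)" "finite (flipped \<alpha>)"
  by (simp_all add: kept_def flipped_def finite_pos_roots)

lemma S_split: "\<alpha> \<in> P \<Longrightarrow> S = S_kept \<alpha> + S_flipped \<alpha>"
proof -
  assume \<alpha>: "\<alpha> \<in> P"
  have P: "P = kept \<alpha> \<union> flipped \<alpha>"
    unfolding kept_def flipped_def using reflection_pos_root_or[OF \<alpha> type] by blast
  have disjoint: "kept \<alpha> \<inter> flipped \<alpha> = {}"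
    unfolding kept_def flipped_def using pos_roots_uminus[of _ T n] by blast
  show ?thesis
    unfolding S_def S_kept_def S_flipped_def P
    by (rule sum.union_disjoint[OF finite_kept disjoint])
qed

lemma k_reflection:
  assumes "\<alpha> \<in> P" "\<beta> \<in> roots T n"
  shows "k (reflection n \<alpha> \<beta>) = k \<beta>"
  using k_inv weyl_P[OF assms(1)] assms(2) unfolding weyl_invariant_def by blast

text \<open>A root and its negative are exchanged by the reflection in that root, so Weyl invariance
  covers the change of sign.\<close>

lemma k_minus:
  assumes "\<beta> \<in> P"
  shows "k (- \<beta>) = k \<beta>"
  using k_reflection[OF assms pos_root_in_roots[OF assms]]
  by (simp only: reflection_self[OF norm_pos_roots_nz[OF assms]])

lemma m_reflection:
  assumes "\<alpha> \<in> P" "\<beta> \<in> P"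
  shows "m (reflection n \<alpha> \<beta>) = m \<beta>"
  using assms by (simp add: m_def k_reflection pos_root_in_roots ip_reflection norm_pos_roots_nz)

lemma m_minus_reflection:
  assumes "\<alpha> \<in> P" "\<beta> \<in> P" "- reflection n \<alpha> \<beta> \<in> P"
  shows "m (- reflection n \<alpha> \<beta>) = m \<beta>"
  using m_reflection[OF assms(1,2)] k_minus[OF assms(3)]
  by (simp add: m_def ip_minus_left ip_minus_right)

lemma reflection_kept:
  assumes "\<alpha> \<in> P"
  shows "bij_betw (reflection n \<alpha>) (kept \<alpha>) (kept \<alpha>)"
  by (rule bij_betwI[where g = "reflection n \<alpha>"])
     (auto simp only: kept_def Pi_iff mem_Collect_eq simp_thms reflection_involution[OF norm_pos_roots_nz[OF assms]])

lemma reflection_flipped: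
  assumes "\<alpha> \<in> P"
  shows "bij_betw (\<lambda>\<beta>. - reflection n \<alpha> \<beta>) (flipped \<alpha>) (flipped \<alpha>)"
  by (rule bij_betwI[where g = "\<lambda>\<beta>. - reflection n \<alpha> \<beta>"])
     (auto simp only: flipped_def Pi_iff mem_Collect_eq simp_thms reflection_minus minus_minus
       reflection_involution[OF norm_pos_roots_nz[OF assms]])

lemma sum_kept:
  assumes "\<alpha> \<in> P"
  shows "(\<Sum>\<beta>\<in>kept \<alpha>. sc (m \<beta>) * st (reflection n \<alpha> \<beta>)) = S_kept \<alpha>"
proof -
  have "(\<Sum>\<beta>\<in>kept \<alpha>. sc (m \<beta>) * st (reflection n \<alpha> \<beta>)) =
      (\<Sum>\<beta>\<in>kept \<alpha>. sc (m (reflection n \<alpha> \<beta>)) * st (reflection n \<alpha> \<beta>))"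
    by (rule sum.cong) (simp_all add: kept_def m_reflection assms)
  also have "\<dots> = S_kept \<alpha>"
    unfolding S_kept_def by (rule sum.reindex_bij_betw[OF reflection_kept[OF assms]])
  finally show ?thesis .
qed

text \<open>Reindexing by the negated reflection keeps the coefficients, while \<open>st\<close> is
  odd in the root; each term thus picks up a minus sign, in contrast to
  \<open>sum_kept\<close>.\<close>

lemma sum_flipped:
  assumes "\<alpha> \<in> P"
  shows "(\<Sum>\<beta>\<in>flipped \<alpha>. sc (m \<beta>) * st (reflection n \<alpha> \<beta>)) = - S_flipped \<alpha>"
proof -
  have "(\<Sum>\<beta>\<in>flipped \<alpha>. sc (m \<beta>) * st (reflection n \<alpha> \<beta>)) =
      - (\<Sum>\<beta>\<in>flipped \<alpha>. sc (m (- reflection n \<alpha> \<beta>)) * st (- reflection n \<alpha> \<beta>))"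
    unfolding sum_negf[symmetric]
    by (rule sum.cong) (simp_all add: flipped_def m_minus_reflection assms st_minus)
  also have "\<dots> = - S_flipped \<alpha>"
    unfolding S_flipped_def
    by (subst sum.reindex_bij_betw[OF reflection_flipped[OF assms],
          where g = "\<lambda>\<beta>. sc (m \<beta>) * st \<beta>"]) simp
  finally show ?thesis .
qed

text \<open>Conjugation by s_\<alpha> permutes the terms of the kept part and permutes those of the
  flipped part with a sign.\<close>

lemma s_S:
  assumes "\<alpha> \<in> P"
  shows "s \<alpha> * S = (S_kept \<alpha> - S_flipped \<alpha>) * s \<alpha>"
proof -
  have *: "s \<alpha> * (\<Sum>\<beta>\<in>B. sc (m \<beta>) * st \<beta>) = (\<Sum>\<beta>\<in>B. sc (m \<beta>) * st (reflection n \<alpha> \<beta>)) * s \<alpha>"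
    if "B \<subseteq> P" for B
    unfolding sum_distrib_left sum_distrib_right
    by (rule sum.cong) (use that in \<open>auto simp: sc_w_left s_st assms mult.assoc simp del: pos_roots.simps\<close>)
  have "s \<alpha> * S = (\<Sum>\<beta>\<in>kept \<alpha>. sc (m \<beta>) * st (reflection n \<alpha> \<beta>)) * s \<alpha> +
      (\<Sum>\<beta>\<in>flipped \<alpha>. sc (m \<beta>) * st (reflection n \<alpha> \<beta>)) * s \<alpha>"
    unfolding S_split[OF assms] distrib_left S_kept_def S_flipped_def
    by (subst (1 2) *) (auto simp: kept_def flipped_def)
  then show ?thesis
    unfolding sum_kept[OF assms] sum_flipped[OF assms] by (simp add: algebra_simps)
qed

lemma flipped_simple:
  assumes "\<alpha> \<in> simple_roots T n"
  shows "flipped \<alpha> = {\<alpha>}"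
proof -
  have "\<beta> = \<alpha>" if "\<beta> \<in> P" "- reflection n \<alpha> \<beta> \<in> P" for \<beta>
    using reflection_simple[OF assms that(1) _ type] pos_roots_uminus[of _ T n] that(2) by blast
  moreover have "- reflection n \<alpha> \<alpha> \<in> P" "\<alpha> \<in> P"
    using simple_P[OF assms] by (simp_all only: reflection_self[OF norm_pos_roots_nz] minus_minus)
  ultimately show ?thesis unfolding flipped_def by blast
qed

text \<open>For a simple root only the term of \<alpha> is flipped. Its change of sign costs twice
  that term, and \<open>st \<alpha> * s \<alpha> = - cr \<alpha>\<close> removes the reflection from
  it.\<close>

lemma S_simple:
  assumes "\<alpha> \<in> simple_roots T n"
  shows "s \<alpha> * S = S * s \<alpha> + sc (2 * m \<alpha>) * cr \<alpha>"
proof -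
  note \<alpha> = simple_P[OF assms]
  have flip: "S_flipped \<alpha> = sc (m \<alpha>) * st \<alpha>"
    by (simp add: S_flipped_def flipped_simple[OF assms])
  have "cr \<alpha> * s \<alpha> = - (s \<alpha> * cr \<alpha>)"
    using s_cr[OF \<alpha>, of \<alpha>] by (simp add: reflection_self[OF norm_pos_roots_nz[OF \<alpha>]] cr_minus)
  then have "st \<alpha> * s \<alpha> = - cr \<alpha>"
    by (simp add: st_def mult.assoc s_s_left[OF \<alpha>] one_cr)
  then have "S_flipped \<alpha> * s \<alpha> = - (sc (m \<alpha>) * cr \<alpha>)"
    by (simp add: flip mult.assoc)
  moreover have "s \<alpha> * S = S * s \<alpha> - S_flipped \<alpha> * s \<alpha> - S_flipped \<alpha> * s \<alpha>"
    unfolding s_S[OF \<alpha>] by (subst S_split[OF \<alpha>]) (simp add: algebra_simps)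
  moreover have "sc (2 * m \<alpha>) = sc (m \<alpha>) + sc (m \<alpha>)"
    by (simp flip: sc_add)
  ultimately show ?thesis by (simp add: distrib_right)
qed

section \<open>The polynomial part X and its commutators\<close>

lemma X_c: "i \<in> {1..n} \<Longrightarrow> X * c i = - (c i * X)"
proof -
  assume "i \<in> {1..n}"
  \<comment> \<open>For l = i the sign comes from moving c_i past x_i, for all other l from moving
    it past c_l.\<close>
  have "x l * c l * c i = - (c i * (x l * c l))" for l
  proof (cases "l = i")
    case True
    have "x i * c i * c i = - (c i * (x i * c i))"
      by (subst xc_same) (simp add: mult.assoc)
    then show ?thesis using True by simp
  next
    case False
    have "c i * (x l * c l) = x l * (c i * c l)"
      using xc[OF False] by (simp flip: mult.assoc)
    then show ?thesis using cc[OF False] by (simp add: mult.assoc)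
  qed
  then show ?thesis
    by (simp add: X_def sum_distrib_left sum_distrib_right sum_negf)
qed

lemma sc_X: "X * sc a = sc a * X"
  by (simp add: X_def sum_distrib_left sum_distrib_right scalars mult.assoc)

lemma X_cr: "X * cr v = - (cr v * X)"
proof -
  have "X * (sc a * y) = sc a * (X * y)" for a y
    by (simp add: sc_X flip: mult.assoc)
  then have "X * cv v = - (cv v * X)"
    by (simp add: cv_def sum_distrib_left sum_distrib_right X_c mult.assoc sum_negf del: sum.cl_ivl_Suc)
  then show ?thesis
    by (simp add: cr_def sc_X mult.assoc flip: mult.assoc) (simp add: sc_X mult.assoc)
qed

text \<open>The mirror image of the defining relation \<open>s_x\<close>. Conjugation by the
  transposition sends c_i c_{i+1} to c_{i+1} c_i, its negative, and this accounts for
  \<open>+ sc 1\<close> in place of \<open>- sc 1\<close>.\<close>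

lemma s_x_Suc:
  assumes "1 \<le> i" "i < n"
  defines "\<alpha> \<equiv> unit_vec i - unit_vec (Suc i)"
  shows "s \<alpha> * x (Suc i) = x i * s \<alpha> + sc (k \<alpha>) * (c i * c (Suc i) + sc 1)"
proof -
  have \<alpha>: "\<alpha> \<in> P" unfolding \<alpha>_def using assms by (intro pos_rootsI(1)) auto
  have si: "s \<alpha> * c i = c (Suc i) * s \<alpha>" and sSuc: "s \<alpha> * c (Suc i) = c i * s \<alpha>"
    using s_c[of i i] s_c[of i "Suc i"] assms by (auto simp: \<alpha>_def)
  have cc': "s \<alpha> * (c i * (c (Suc i) * s \<alpha>)) = c (Suc i) * c i"
  proof -
    have "s \<alpha> * (c i * (c (Suc i) * s \<alpha>)) = c (Suc i) * (s \<alpha> * c (Suc i)) * s \<alpha>"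
      using si by (simp flip: mult.assoc)
    also have "\<dots> = c (Suc i) * c i"
      unfolding sSuc by (simp add: mult.assoc s_square[OF \<alpha>] one_right)
    finally show ?thesis .
  qed
  have "x (Suc i) * s \<alpha> = s \<alpha> * x i - sc (k \<alpha>) * (c i * c (Suc i) - sc 1)"
    using s_x[OF assms(1,2)] by (simp add: \<alpha>_def)
  \<comment> \<open>Multiplying by the involution s_\<alpha> from both sides isolates s_\<alpha>
    x_{i+1} on the left.\<close>
  then have "s \<alpha> * (x (Suc i) * s \<alpha>) * s \<alpha> =
      s \<alpha> * (s \<alpha> * x i - sc (k \<alpha>) * (c i * c (Suc i) - sc 1)) * s \<alpha>"
    by simp
  then have "s \<alpha> * x (Suc i) =
      x i * s \<alpha> - sc (k \<alpha>) * (s \<alpha> * (c i * (c (Suc i) * s \<alpha>)) - s \<alpha> * s \<alpha>)"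
    by (simp add: mult.assoc s_square[OF \<alpha>] s_s_left[OF \<alpha>] one_right one_left algebra_simps scalars one_w)
  then show ?thesis
    unfolding cc' s_square[OF \<alpha>] using cc[of "Suc i" i] by (simp add: algebra_simps)
qed

text \<open>The correction matches that of \<open>S_simple\<close>, so both cancel in the commutator
  with D. Only indices moved by the reflection contribute: in the adjacent case the two terms give
  the same multiple of c_{i+1} - c_i, in the last case the single term gives a multiple of
  c_n.\<close>

lemma X_simple:
  assumes "\<alpha> \<in> simple_roots T n"
  shows "X * s \<alpha> = s \<alpha> * X + sc (2 * m \<alpha>) * cr \<alpha>"
  using assms
proof (cases rule: simple_cases)
  case (adjacent i)
  let ?R = "{1..n} - {i, Suc i}"
  have X: "X = (\<Sum>l\<in>?R. x l * c l) + (x i * c i + x (Suc i) * c (Suc i))"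
    unfolding X_def using adjacent by (subst sum.subset_diff[of "{i, Suc i}"]) auto
  have far: "s \<alpha> * (x l * c l) = x l * c l * s \<alpha>" if "l \<in> ?R" for l
  proof -
    have "s \<alpha> * (x l * c l) = x l * (s \<alpha> * c l)"
      using s_x_far[OF adjacent(2,3), of l] that by (simp add: adjacent(1) flip: mult.assoc)
    then show ?thesis
      using s_c[OF adjacent(2,3), of l] that by (simp add: adjacent(1) mult.assoc)
  qed
  have far_sum: "s \<alpha> * (\<Sum>l\<in>?R. x l * c l) = (\<Sum>l\<in>?R. x l * c l) * s \<alpha>"
    unfolding sum_distrib_left sum_distrib_right by (rule sum.cong) (use far in auto)
  have i: "c i * c i = - sc 1" and Suc_i: "c (Suc i) * c (Suc i) = - sc 1"
    using adjacent by (auto intro!: cc_same)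
  have near: "s \<alpha> * (x i * c i) = x (Suc i) * c (Suc i) * s \<alpha> + sc (k \<alpha>) * (c (Suc i) - c i)"
  proof -
    have "c i * c (Suc i) * c i = c (Suc i)"
      using cc[of "Suc i" i] i by (simp add: mult.assoc) (simp add: one_c flip: mult.assoc)
    moreover have "s \<alpha> * c i = c (Suc i) * s \<alpha>"
      using s_c[OF adjacent(2,3), of i] adjacent by simp
    moreover have "s \<alpha> * (x i * c i) = x (Suc i) * (s \<alpha> * c i) + sc (k \<alpha>) * (c i * c (Suc i) * c i - sc 1 * c i)"
      unfolding mult.assoc[symmetric, of "s \<alpha>" "x i" "c i"]
      unfolding adjacent(1) s_x[OF adjacent(2,3)]
      by (simp add: distrib_right left_diff_distrib mult.assoc)
    ultimately show ?thesis by (simp add: one_c mult.assoc)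
  qed
  have near': "s \<alpha> * (x (Suc i) * c (Suc i)) = x i * c i * s \<alpha> + sc (k \<alpha>) * (c (Suc i) - c i)"
  proof -
    have "c i * c (Suc i) * c (Suc i) = - c i"
      by (simp add: mult.assoc Suc_i one_right)
    moreover have "s \<alpha> * c (Suc i) = c i * s \<alpha>"
      using s_c[OF adjacent(2,3), of "Suc i"] adjacent by simp
    moreover have "s \<alpha> * (x (Suc i) * c (Suc i)) =
        x i * (s \<alpha> * c (Suc i)) + sc (k \<alpha>) * (c i * c (Suc i) * c (Suc i) + sc 1 * c (Suc i))"
      unfolding mult.assoc[symmetric, of "s \<alpha>" "x (Suc i)" "c (Suc i)"]
      unfolding adjacent(1) s_x_Suc[OF adjacent(2,3)]
      by (simp add: distrib_right left_diff_distrib mult.assoc)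
    ultimately show ?thesis by (simp add: one_c mult.assoc)
  qed
  have cv: "cv \<alpha> = c i - c (Suc i)"
    using adjacent by (simp add: cv_diff cv_unit)
  have norm: "ip n \<alpha> \<alpha> = 2"
    using adjacent by (simp add: ip_diff_left ip_unit_vec_left unit_vec_apply)
  \<comment> \<open>For norm 2 the weight \<open>m \<alpha>\<close> is sqrt 2 times
    \<open>k \<alpha>\<close>, and normalising c_\<alpha> divides by sqrt 2, so exactly two copies
    of \<open>k \<alpha>\<close> remain.\<close>
  have "2 * m \<alpha> * of_real (1 / sqrt 2) = k \<alpha> + k \<alpha>"
    by (simp add: m_def norm power2_eq_square flip: of_real_mult)
  then have "sc (2 * m \<alpha>) * cr \<alpha> = sc (k \<alpha>) * cv \<alpha> + sc (k \<alpha>) * cv \<alpha>"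
    by (simp only: cr_def sc_sc norm sc_add distrib_right)
  moreover have "s \<alpha> * X = X * s \<alpha> - (sc (k \<alpha>) * cv \<alpha> + sc (k \<alpha>) * cv \<alpha>)"
    unfolding X distrib_left distrib_right far_sum near near' cv by (simp add: algebra_simps)
  ultimately show ?thesis by simp
next
  case last
  let ?R = "{1..n} - {n}"
  have X: "X = (\<Sum>l\<in>?R. x l * c l) + x n * c n"
    unfolding X_def using n_pos by (subst sum.subset_diff[of "{n}"]) auto
  have far: "s \<alpha> * (x l * c l) = x l * c l * s \<alpha>" if "l \<in> ?R" for l
  proof -
    have "s \<alpha> * (x l * c l) = x l * (s \<alpha> * c l)"
      using sn_x_far[OF last(2), of l] that by (simp add: last(1) flip: mult.assoc)
    then show ?thesis
      using sn_c_far[OF last(2), of l] that by (simp add: last(1) mult.assoc)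
  qed
  have far_sum: "s \<alpha> * (\<Sum>l\<in>?R. x l * c l) = (\<Sum>l\<in>?R. x l * c l) * s \<alpha>"
    unfolding sum_distrib_left sum_distrib_right by (rule sum.cong) (use far in auto)
  have near: "s \<alpha> * (x n * c n) = x n * c n * s \<alpha> - sc (of_real (sqrt 2) * k \<alpha>) * c n"
  proof -
    have "s \<alpha> * (x n * c n) = - (x n * (s \<alpha> * c n)) - sc (of_real (sqrt 2) * k \<alpha>) * c n"
      unfolding mult.assoc[symmetric, of "s \<alpha>" "x n" "c n"]
      unfolding last(1) sn_x[OF last(2)]
      by (simp add: left_diff_distrib mult.assoc)
    then show ?thesis
      using sn_c[OF last(2)] by (simp add: last(1) mult.assoc)
  qed
  have norm: "ip n \<alpha> \<alpha> = 1"
    using last n_pos by (simp add: ip_unit_vec_left unit_vec_apply)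
  have "sc (2 * m \<alpha>) * cr \<alpha> = sc (of_real (sqrt 2) * k \<alpha>) * c n"
  proof -
    have "cv \<alpha> = c n" unfolding last(1) using n_pos by (intro cv_unit) auto
    then show ?thesis by (simp add: cr_def norm m_def sc_sc)
  qed
  then show ?thesis
    unfolding X distrib_left distrib_right far_sum near by simp
qed

section \<open>The square of D in terms of X and S\<close>

definition D :: 'a where "D = X + S"

lemma D_s:
  assumes "\<alpha> \<in> P"
  shows "D * s \<alpha> = s \<alpha> * D"
  using assms type
proof (induction rule: pos_reflection_induct)
  case (simple \<alpha>)
  then show ?case
    by (simp add: D_def distrib_left distrib_right X_simple S_simple)
next
  case (comp u v)
  have "D * (w u * w v) = w u * (D * w v)"
    using comp(3) by (simp flip: mult.assoc)
  then show ?case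
    unfolding w_comp[OF comp(1,2)] using comp(4) by (simp add: mult.assoc)
qed

text \<open>In each term s_\<alpha> c_\<alpha> of the right factor, D passes s_\<alpha> and then
  meets c_\<alpha>. There X anticommutes with c_\<alpha>, and summing \<open>s_st_cr\<close> over
  \<beta> gives \<open>s \<alpha> * (S * cr \<alpha>) = - (st \<alpha> * S)\<close>.\<close>

lemma D_S: "D * S = - (S * X) - S * S"
proof -
  have sc_D: "D * (sc a * y) = sc a * (D * y)" for a y
  proof -
    have "D * sc a = sc a * D"
      by (simp add: D_def distrib_left distrib_right sc_X S_def sum_distrib_left sum_distrib_right)
         (simp add: st_def cr_def sc_cv sc_cv_left sc_w_left sc_sc mult.assoc mult.commute)
    then show ?thesis by (simp flip: mult.assoc)
  qed
  have "D * (sc (m \<alpha>) * st \<alpha>) = - (sc (m \<alpha>) * st \<alpha> * X) - sc (m \<alpha>) * st \<alpha> * S"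
    if \<alpha>: "\<alpha> \<in> P" for \<alpha>
  proof -
    have "s \<alpha> * (S * cr \<alpha>) = (\<Sum>\<beta>\<in>P. sc (m \<beta>) * (s \<alpha> * (st \<beta> * cr \<alpha>)))"
      by (simp add: S_def sum_distrib_left sum_distrib_right sc_w_left mult.assoc)
    also have "\<dots> = (\<Sum>\<beta>\<in>P. - (st \<alpha> * (sc (m \<beta>) * st \<beta>)))"
      by (rule sum.cong) (simp_all add: s_st_cr[OF \<alpha>] sc_st_left)
    also have "\<dots> = - (st \<alpha> * S)"
      by (simp add: S_def sum_distrib_left sum_negf)
    finally have S: "s \<alpha> * (S * cr \<alpha>) = - (st \<alpha> * S)" .
    have "D * st \<alpha> = s \<alpha> * (D * cr \<alpha>)"
      by (simp add: st_def D_s[OF \<alpha>] flip: mult.assoc)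
    also have "\<dots> = - (st \<alpha> * X) - st \<alpha> * S"
      by (simp add: D_def distrib_right distrib_left right_diff_distrib X_cr S) (simp add: st_def mult.assoc)
    finally show ?thesis
      unfolding sc_D by (simp add: right_diff_distrib mult.assoc)
  qed
  then have "D * S = (\<Sum>\<alpha>\<in>P. - (sc (m \<alpha>) * st \<alpha> * X) - sc (m \<alpha>) * st \<alpha> * S)"
    \<comment> \<open>The rewriting is confined to the factor after \<open>D\<close>, so that the
      \<open>S\<close> inside the summands stays folded.\<close>
    unfolding S_def[THEN arg_cong[of _ _ "(*) D"]] sum_distrib_left by (rule sum.cong[OF refl])
  also have "\<dots> = - (S * X) - S * S"
    by (simp add: sum_subtractf sum_negf S_def sum_distrib_right)
  finally show ?thesis .
qed

lemma D_square: "D * D = X * X - S * S"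
proof -
  have "D * D = D * X + D * S" by (simp add: D_def distrib_left)
  also have "\<dots> = X * X + S * X + D * S" by (simp add: D_def distrib_right)
  finally show ?thesis unfolding D_S by simp
qed

text \<open>The square is expanded twice, according to which factor is split into kept and flipped
  parts. Since \<open>st \<alpha>\<close> anticommutes with its kept part and commutes with its
  flipped part, the results are Z + Y and - Z + Y, which forces Z = 0.\<close>

lemma S_square: "S * S = (\<Sum>\<alpha>\<in>P. \<Sum>\<beta>\<in>flipped \<alpha>. sc (m \<alpha> * m \<beta>) * (st \<alpha> * st \<beta>))"
proof -
  have swap: "st \<alpha> * (\<Sum>\<beta>\<in>B. sc (m \<beta>) * st \<beta>) = - ((\<Sum>\<beta>\<in>B. sc (m \<beta>) * st (reflection n \<alpha> \<beta>)) * st \<alpha>)"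
    if "B \<subseteq> P" "\<alpha> \<in> P" for B \<alpha>
    unfolding sum_distrib_left sum_distrib_right sum_negf[symmetric]
    by (rule sum.cong)
       (use that in \<open>auto simp: sc_st_left st_st mult.assoc simp del: pos_roots.simps\<close>)
  have kept: "st \<alpha> * S_kept \<alpha> = - (S_kept \<alpha> * st \<alpha>)" if "\<alpha> \<in> P" for \<alpha>
  proof -
    have "kept \<alpha> \<subseteq> P" by (auto simp only: kept_def)
    from swap[OF this that] show ?thesis
      unfolding sum_kept[OF that] by (simp only: S_kept_def)
  qed
  have flipped: "st \<alpha> * S_flipped \<alpha> = S_flipped \<alpha> * st \<alpha>" if "\<alpha> \<in> P" for \<alpha>
  proof -
    have "flipped \<alpha> \<subseteq> P" by (auto simp only: flipped_def)
    from swap[OF this that] show ?thesis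
      unfolding sum_flipped[OF that] by (simp only: S_flipped_def mult_minus_left minus_minus)
  qed
  define Z where "Z = (\<Sum>\<alpha>\<in>P. sc (m \<alpha>) * (st \<alpha> * S_kept \<alpha>))"
  define Y where "Y = (\<Sum>\<alpha>\<in>P. sc (m \<alpha>) * (st \<alpha> * S_flipped \<alpha>))"
  have "S * S = (\<Sum>\<alpha>\<in>P. sc (m \<alpha>) * (st \<alpha> * S))"
    by (subst S_def) (simp add: sum_distrib_right mult.assoc)
  also have "\<dots> = (\<Sum>\<alpha>\<in>P. sc (m \<alpha>) * (st \<alpha> * S_kept \<alpha>) + sc (m \<alpha>) * (st \<alpha> * S_flipped \<alpha>))"
    by (rule sum.cong) (simp_all add: S_split distrib_left)
  finally have 1: "S * S = Z + Y"
    by (simp add: Z_def Y_def sum.distrib)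
  have sc_S: "S * (sc a * y) = sc a * (S * y)" for a y
    by (simp add: S_def sum_distrib_left sum_distrib_right mult.assoc sc_st_left sc_sc mult.commute)
  \<comment> \<open>Second expansion: now the right factor supplies \<open>st \<alpha>\<close>, and
    the left one is split relative to \<alpha>.\<close>
  have "S * S = (\<Sum>\<alpha>\<in>P. sc (m \<alpha>) * (S * st \<alpha>))"
    by (subst (2) S_def) (simp add: sum_distrib_left sc_S)
  also have "\<dots> = (\<Sum>\<alpha>\<in>P. - (sc (m \<alpha>) * (st \<alpha> * S_kept \<alpha>)) + sc (m \<alpha>) * (st \<alpha> * S_flipped \<alpha>))"
    by (rule sum.cong) (simp_all add: S_split distrib_left distrib_right kept flipped)
  finally have 2: "S * S = - Z + Y"
    unfolding Z_def Y_def by (simp add: sum.distrib sum_negf sum_subtractf)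
  have "Z = 0"
  proof (rule halve)
    have "Z + Y = - Z + Y" using 1 2 by simp
    then show "Z + Z = 0 + 0" by (simp add: eq_neg_iff_add_eq_0)
    show "sc 1 * Z = Z" by (simp add: Z_def sum_distrib_left sc_sc)
  qed simp
  then show ?thesis
    using 1 by (simp add: Y_def S_flipped_def sum_distrib_left sc_st_left sc_sc mult.assoc)
qed

section \<open>The square of X and the centrality of Omega\<close>

definition Omega :: 'a where "Omega = (\<Sum>i=1..n. x i * x i)"

text \<open>The doubled square symmetrises the double sum. A diagonal pair gives twice x_i^2; an
  off-diagonal pair gives N, because the commutator of x_i and x_j is N c_j c_i and c_j c_i c_i c_j
  = 1. Each i meets n - 1 indices j different from it.\<close>

lemma X_square: "X * X = Omega + sc (N * of_nat (n * (n - 1)) / 2)"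
proof (rule halve)
  define t where "t i j = x i * c i * (x j * c j)" for i j
  have tt: "t i j + t j i = (if j = i then x i * x i + x i * x i else sc N)"
    if "i \<in> {1..n}" "j \<in> {1..n}" for i j
  proof (cases "j = i")
    case True
    have "c i * x i = - (x i * c i)"
      by (simp add: xc_same)
    then have "t i i = - (x i * (x i * c i) * c i)"
      unfolding t_def mult.assoc[of "x i" "c i"] by (simp flip: mult.assoc)
    also have "\<dots> = x i * x i"
      by (simp add: mult.assoc cc_same[OF that(1)] one_right)
    finally show ?thesis using True by simp
  next
    case False
    have t: "t a b = x a * x b * (c a * c b)" if "a \<noteq> b" for a b
    proof -
      have "c a * (x b * y) = x b * (c a * y)" for y
        using xc[of b a] that by (simp flip: mult.assoc)
      then show ?thesis by (simp add: t_def mult.assoc)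
    qed
    have "t i j + t j i = (x i * x j - x j * x i) * (c i * c j)"
      using False cc[of j i] by (simp add: t left_diff_distrib)
    also have "\<dots> = sc N * (c j * (c i * c i) * c j)"
      using xx[OF that] False by (simp add: mult.assoc)
    also have "\<dots> = sc N * - (c j * c j)"
      by (simp add: cc_same[OF that(1)] mult.assoc one_c)
    also have "\<dots> = sc N"
      by (simp add: cc_same[OF that(2)] sc_mult)
    finally show ?thesis using False by simp
  qed
  have XX: "X * X = (\<Sum>i=1..n. \<Sum>j=1..n. t i j)"
    by (simp add: X_def sum_product t_def)
  have "X * X + X * X = (\<Sum>i=1..n. \<Sum>j=1..n. t i j + t j i)"
    unfolding sum.distrib XX by (subst (2) sum.swap) simp
  also have "\<dots> = (\<Sum>i=1..n. \<Sum>j=1..n. if j = i then x i * x i + x i * x i else sc N)"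
    by (intro sum.cong refl tt)
  also have "\<dots> = (\<Sum>i=1..n. x i * x i + x i * x i + sc (of_nat (n - 1) * N))"
  proof (rule sum.cong)
    fix i assume i: "i \<in> {1..n}"
    have "(\<Sum>j=1..n. if j = i then x i * x i + x i * x i else sc N) =
        x i * x i + x i * x i + (\<Sum>j\<in>{1..n} - {i}. sc N)"
      by (subst sum.remove[OF _ i]) (auto intro!: sum.cong)
    also have "(\<Sum>j\<in>{1..n} - {i}. sc N) = sc (of_nat (n - 1) * N)"
      using i by (simp flip: sc_sum)
    finally show "(\<Sum>j=1..n. if j = i then x i * x i + x i * x i else sc N) =
        x i * x i + x i * x i + sc (of_nat (n - 1) * N)" .
  qed simp
  also have "\<dots> = Omega + Omega + sc (of_nat (n * (n - 1)) * N)"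
  proof -
    have "(\<Sum>i=1..n. sc a) = sc (of_nat n * a)" for a
      by (simp flip: sc_sum)
    then show ?thesis
      by (simp only: Omega_def sum.distrib of_nat_mult mult.assoc)
  qed
  also have "sc (of_nat (n * (n - 1)) * N) =
      sc (N * of_nat (n * (n - 1)) / 2) + sc (N * of_nat (n * (n - 1)) / 2)"
    by (simp add: mult_ac flip: sc_add)
  finally show "X * X + X * X =
      (Omega + sc (N * of_nat (n * (n - 1)) / 2)) + (Omega + sc (N * of_nat (n * (n - 1)) / 2))"
    by (simp add: algebra_simps)
  show "sc 1 * (X * X) = X * X"
    by (simp add: X_def sum_distrib_left sum_distrib_right mult.assoc one_left)
  show "sc 1 * (Omega + sc (N * of_nat (n * (n - 1)) / 2)) = Omega + sc (N * of_nat (n * (n - 1)) / 2)"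
    by (simp add: Omega_def distrib_left sum_distrib_left one_left sc_mult)
qed

text \<open>Carrying x_j past x_i twice produces two correction terms N c_j c_i, one with x_i before
  it and one with x_i after it. They cancel because x_i anticommutes with c_i and commutes with
  c_j.\<close>

lemma Omega_x:
  assumes "j \<in> {1..n}"
  shows "Omega * x j = x j * Omega"
proof -
  have "x i * x i * x j = x j * (x i * x i)" if i: "i \<in> {1..n}" for i
  proof (cases "i = j")
    case False
    have xcc: "x i * (c j * c i) = - (c j * (c i * x i))"
    proof -
      have "x i * (c j * c i) = c j * (x i * c i)"
        using xc[OF False] by (simp flip: mult.assoc)
      then show ?thesis by (simp add: xc_same)
    qed
    have "x i * x i * x j = x i * (x j * x i + sc N * (c j * c i))"
      using xx[OF i assms False] by (simp add: mult.assoc)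
    also have "\<dots> = x i * x j * x i + sc N * (x i * (c j * c i))"
      by (simp add: distrib_left scalars mult.assoc)
    also have "x i * x j * x i = x j * (x i * x i) + sc N * (c j * (c i * x i))"
      using xx[OF i assms False] by (simp add: distrib_right mult.assoc)
    finally show ?thesis unfolding xcc by simp
  qed (simp add: mult.assoc)
  then show ?thesis
    by (simp add: Omega_def sum_distrib_left sum_distrib_right)
qed

lemma Omega_c: "Omega * c j = c j * Omega"
proof -
  have "x i * x i * c j = c j * (x i * x i)" for i
  proof (cases "i = j")
    case True
    have "x j * (x j * c j) = - (x j * c j * x j)"
      by (subst xc_same) (simp add: mult.assoc)
    also have "\<dots> = c j * (x j * x j)"
      by (subst xc_same) (simp add: mult.assoc)
    finally show ?thesis using True by (simp add: mult.assoc)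
  next
    case False
    then show ?thesis
      using xc[OF False] by (metis mult.assoc)
  qed
  then show ?thesis
    by (simp add: Omega_def sum_distrib_left sum_distrib_right)
qed

lemma Omega_sc: "Omega * sc a = sc a * Omega"
  by (simp add: Omega_def sum_distrib_left sum_distrib_right scalars mult.assoc)

lemma commute_square: "y * z = z * y \<Longrightarrow> y * (z * z) = z * z * y" for y z :: 'a
  by (metis mult.assoc)

text \<open>For an adjacent transposition the corrections of x_i^2 and x_{i+1}^2 are opposite, since
  c_i c_{i+1} anticommutes with both x_i and x_{i+1}. For the last reflection the two corrections
  already cancel within x_n^2.\<close>

lemma Omega_simple:
  assumes "\<alpha> \<in> simple_roots T n"
  shows "Omega * s \<alpha> = s \<alpha> * Omega"
  using assms
proof (cases rule: simple_cases)
  case (adjacent i)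
  let ?R = "{1..n} - {i, Suc i}" and ?x = "x i" and ?x' = "x (Suc i)"
    and ?cc = "c i * c (Suc i)" and ?\<kappa> = "sc (k \<alpha>)"
  have Omega: "Omega = (\<Sum>l\<in>?R. x l * x l) + (?x * ?x + ?x' * ?x')"
    unfolding Omega_def using adjacent by (subst sum.subset_diff[of "{i, Suc i}"]) auto
  have far: "s \<alpha> * (x l * x l) = x l * x l * s \<alpha>" if "l \<in> ?R" for l
    by (rule commute_square) (use s_x_far[OF adjacent(2,3), of l] that in \<open>simp add: adjacent(1)\<close>)
  have far_sum: "s \<alpha> * (\<Sum>l\<in>?R. x l * x l) = (\<Sum>l\<in>?R. x l * x l) * s \<alpha>"
    unfolding sum_distrib_left sum_distrib_right by (rule sum.cong) (use far in auto)
  have x: "s \<alpha> * ?x = ?x' * s \<alpha> + ?\<kappa> * (?cc - sc 1)"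
    unfolding adjacent(1) by (rule s_x[OF adjacent(2,3)])
  have x': "s \<alpha> * ?x' = ?x * s \<alpha> + ?\<kappa> * (?cc + sc 1)"
    unfolding adjacent(1) by (rule s_x_Suc[OF adjacent(2,3)])
  have cc_x: "?cc * ?x = - (?x * ?cc)"
  proof -
    have "?cc * ?x = c i * x i * c (Suc i)"
      using xc[of i "Suc i"] by (simp add: mult.assoc)
    also have "c i * x i = - (x i * c i)"
      by (simp add: xc_same)
    finally show ?thesis by (simp add: mult.assoc)
  qed
  have cc_x': "?cc * ?x' = - (?x' * ?cc)"
  proof -
    have "?x' * ?cc = c i * (x (Suc i) * c (Suc i))"
      using xc[of "Suc i" i] by (simp flip: mult.assoc)
    then show ?thesis by (simp add: xc_same mult.assoc)
  qed
  have "s \<alpha> * (?x * ?x) = (s \<alpha> * ?x) * ?x"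
    by (simp add: mult.assoc)
  also have "\<dots> = ?x' * (s \<alpha> * ?x) + ?\<kappa> * (?cc * ?x - ?x)"
    by (subst x) (simp add: distrib_right left_diff_distrib mult.assoc one_x)
  also have "\<dots> = ?x' * ?x' * s \<alpha> + ?\<kappa> * (?x' * ?cc - ?x' - ?x * ?cc - ?x)"
    unfolding x cc_x by (simp add: distrib_left right_diff_distrib mult.assoc sc_x_left one_right)
  finally have 1: "s \<alpha> * (?x * ?x) = \<dots>" .
  have "s \<alpha> * (?x' * ?x') = (s \<alpha> * ?x') * ?x'"
    by (simp add: mult.assoc)
  also have "\<dots> = ?x * (s \<alpha> * ?x') + ?\<kappa> * (?cc * ?x' + ?x')"
    by (subst x') (simp add: distrib_right mult.assoc one_x)
  also have "\<dots> = ?x * ?x * s \<alpha> + ?\<kappa> * (?x * ?cc + ?x - ?x' * ?cc + ?x')"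
    unfolding x' cc_x' by (simp add: distrib_left right_diff_distrib mult.assoc sc_x_left one_right)
  finally have 2: "s \<alpha> * (?x' * ?x') = \<dots>" .
  show ?thesis
    unfolding Omega distrib_left distrib_right far_sum 1 2
    by (simp add: algebra_simps)
next
  case last
  let ?R = "{1..n} - {n}"
  have Omega: "Omega = (\<Sum>l\<in>?R. x l * x l) + x n * x n"
    unfolding Omega_def using n_pos by (subst sum.subset_diff[of "{n}"]) auto
  have far: "s \<alpha> * (x l * x l) = x l * x l * s \<alpha>" if "l \<in> ?R" for l
    by (rule commute_square) (use sn_x_far[OF last(2), of l] that in \<open>simp add: last(1)\<close>)
  have far_sum: "s \<alpha> * (\<Sum>l\<in>?R. x l * x l) = (\<Sum>l\<in>?R. x l * x l) * s \<alpha>"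
    unfolding sum_distrib_left sum_distrib_right by (rule sum.cong) (use far in auto)
  have x: "s \<alpha> * x n = - (x n * s \<alpha>) - sc (of_real (sqrt 2) * k \<alpha>)"
    unfolding last(1) by (rule sn_x[OF last(2)])
  have "s \<alpha> * (x n * x n) = (s \<alpha> * x n) * x n"
    by (simp add: mult.assoc)
  also have "\<dots> = - (x n * (s \<alpha> * x n)) - sc (of_real (sqrt 2) * k \<alpha>) * x n"
    by (subst x) (simp add: left_diff_distrib mult.assoc)
  also have "\<dots> = x n * x n * s \<alpha>"
    unfolding x by (simp add: right_diff_distrib mult.assoc sc_x)
  finally show ?thesis
    unfolding Omega distrib_left distrib_right far_sum by simp
qed

lemma Omega_w:
  assumes "g \<in> weyl T n"
  shows "Omega * w g = w g * Omega"
  using assms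
proof (induction rule: weyl.induct)
  case weyl_id
  show ?case by (simp only: w_id Omega_sc)
next
  case (weyl_refl \<alpha> g)
  have comm: "Omega * (w u * w v) = w u * w v * Omega"
    if "Omega * w u = w u * Omega" "Omega * w v = w v * Omega" for u v
  proof -
    have "Omega * (w u * w v) = w u * (Omega * w v)"
      using that(1) by (simp flip: mult.assoc)
    then show ?thesis using that(2) by (simp add: mult.assoc)
  qed
  have pos: "Omega * s \<beta> = s \<beta> * Omega" if "\<beta> \<in> P" for \<beta>
    using that type
    by (induction rule: pos_reflection_induct) (simp_all only: Omega_simple w_comp comm)
  \<comment> \<open>The generators of \<open>weyl\<close> include reflections in negative roots,
    which coincide with those in the opposite positive roots.\<close>
  have "Omega * s \<alpha> = s \<alpha> * Omega"
    using weyl_refl(1) pos[of \<alpha>] pos[of "- \<alpha>"] unfolding roots_iff reflection_uminus by blast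
  then show ?case
    using weyl_refl by (simp only: w_comp reflection_in_weyl comm)
qed

theorem D_square_eq:
  "D * D = Omega - (\<Sum>\<alpha>\<in>P. \<Sum>\<beta>\<in>flipped \<alpha>. sc (m \<alpha> * m \<beta>) * (st \<alpha> * st \<beta>)) +
     sc (N * of_nat (n * (n - 1)) / 2)"
  unfolding D_square X_square S_square by (simp add: algebra_simps)

end

section \<open>Rings with carriers as parts of a type of sort \<open>ring\<close>\<close>

text \<open>The product of all rings whose carrier is a set of elements of a given type is a genuine
  type, into which each of these rings embeds as one factor (without preserving the unit).
  Identities can therefore be checked in the type class \<open>ring\<close>.\<close>

typedef 'c ring_prod =
    "{F :: 'c ring \<Rightarrow> 'c. \<forall>R. if Ring.ring R then F R \<in> carrier R else F R = undefined}"
  by (rule exI[of _ "\<lambda>R. if Ring.ring R then \<zero>\<^bsub>R\<^esub> else undefined"])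
     (auto intro: ring.ring_simprules)

setup_lifting type_definition_ring_prod

instantiation ring_prod :: (type) ring
begin

lift_definition zero_ring_prod :: "'a ring_prod" is
  "\<lambda>R. if Ring.ring R then \<zero>\<^bsub>R\<^esub> else undefined"
  by (auto intro: ring.ring_simprules)

lift_definition plus_ring_prod :: "'a ring_prod \<Rightarrow> 'a ring_prod \<Rightarrow> 'a ring_prod" is
  "\<lambda>F G R. if Ring.ring R then F R \<oplus>\<^bsub>R\<^esub> G R else undefined"
  by (auto intro: ring.ring_simprules split: if_splits)

lift_definition uminus_ring_prod :: "'a ring_prod \<Rightarrow> 'a ring_prod" is
  "\<lambda>F R. if Ring.ring R then \<ominus>\<^bsub>R\<^esub> F R else undefined"
  by (auto intro: ring.ring_simprules split: if_splits)

lift_definition minus_ring_prod :: "'a ring_prod \<Rightarrow> 'a ring_prod \<Rightarrow> 'a ring_prod" is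
  "\<lambda>F G R. if Ring.ring R then F R \<ominus>\<^bsub>R\<^esub> G R else undefined"
  by (auto intro: ring.ring_simprules split: if_splits)

lift_definition times_ring_prod :: "'a ring_prod \<Rightarrow> 'a ring_prod \<Rightarrow> 'a ring_prod" is
  "\<lambda>F G R. if Ring.ring R then F R \<otimes>\<^bsub>R\<^esub> G R else undefined"
  by (auto intro: ring.ring_simprules split: if_splits)

instance
proof
  fix a b c :: "'a ring_prod"
  show "a + b + c = a + (b + c)"
    by transfer (auto simp: fun_eq_iff intro!: ring.ring_simprules split: if_splits)
  show "a + b = b + a"
    by transfer (auto simp: fun_eq_iff intro!: ring.ring_simprules split: if_splits)
  show "0 + a = a"
    by transfer (auto simp: fun_eq_iff ring.ring_simprules split: if_splits)
  show "- a + a = 0"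
    by transfer (auto simp: fun_eq_iff ring.ring_simprules split: if_splits)
  show "a - b = a + - b"
    by transfer (auto simp: fun_eq_iff a_minus_def split: if_splits)
  show "a * b * c = a * (b * c)"
    by transfer (auto simp: fun_eq_iff intro!: ring.ring_simprules split: if_splits)
  show "(a + b) * c = a * c + b * c"
    by transfer (auto simp: fun_eq_iff intro!: ring.ring_simprules split: if_splits)
  show "a * (b + c) = a * b + a * c"
    by transfer (auto simp: fun_eq_iff intro!: ring.ring_simprules split: if_splits)
qed

end

text \<open>Filling all other factors with zero respects sums and products, at the price of the
  unit. Elements outside the carrier are sent to zero so that the map is total.\<close>

lift_definition ring_prod_of :: "'c ring \<Rightarrow> 'c \<Rightarrow> 'c ring_prod" is
  "\<lambda>R r R'. if R' = R \<and> Ring.ring R \<and> r \<in> carrier R then r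
     else if Ring.ring R' then \<zero>\<^bsub>R'\<^esub> else undefined"
  by (auto intro: ring.ring_simprules)

context
  fixes R :: "'c ring"
  assumes R: "Ring.ring R"
begin

lemma ring_prod_of_add: "a \<in> carrier R \<Longrightarrow> b \<in> carrier R \<Longrightarrow> ring_prod_of R (a \<oplus>\<^bsub>R\<^esub> b) = ring_prod_of R a + ring_prod_of R b"
  using R by transfer (auto simp: fun_eq_iff ring.ring_simprules)

lemma ring_prod_of_mult: "a \<in> carrier R \<Longrightarrow> b \<in> carrier R \<Longrightarrow> ring_prod_of R (a \<otimes>\<^bsub>R\<^esub> b) = ring_prod_of R a * ring_prod_of R b"
  using R by transfer (auto simp: fun_eq_iff ring.ring_simprules)

lemma ring_prod_of_minus: "a \<in> carrier R \<Longrightarrow> b \<in> carrier R \<Longrightarrow> ring_prod_of R (a \<ominus>\<^bsub>R\<^esub> b) = ring_prod_of R a - ring_prod_of R b"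
  using R by transfer (auto simp: fun_eq_iff ring.ring_simprules)

lemma ring_prod_of_zero: "ring_prod_of R \<zero>\<^bsub>R\<^esub> = 0"
  by transfer (auto simp: fun_eq_iff)

text \<open>Evaluation at the factor R is a left inverse on the carrier.\<close>

lemma ring_prod_of_inject:
  assumes "a \<in> carrier R" "b \<in> carrier R" "ring_prod_of R a = ring_prod_of R b"
  shows "a = b"
proof -
  have rep: "Rep_ring_prod (ring_prod_of R r) R = r" if "r \<in> carrier R" for r
    unfolding ring_prod_of.rep_eq using that R by (metis (full_types))
  have "a = Rep_ring_prod (ring_prod_of R a) R"
    by (rule rep[OF assms(1), symmetric])
  also have "\<dots> = b"
    unfolding assms(3) by (rule rep[OF assms(2)])
  finally show ?thesis .
qed

end

section \<open>Quotients of free algebras\<close>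

definition unital_subalgebra :: "('g word \<Rightarrow>\<^sub>0 complex) set \<Rightarrow> bool" where
  "unital_subalgebra V \<longleftrightarrow> range scal \<subseteq> V \<and> (\<forall>p\<in>V. \<forall>q\<in>V. p + q \<in> V \<and> p * q \<in> V)"

lemma unital_subalgebraI:
  assumes "\<And>a. scal a \<in> V" "\<And>p q. p \<in> V \<Longrightarrow> q \<in> V \<Longrightarrow> p + q \<in> V"
    "\<And>p q. p \<in> V \<Longrightarrow> q \<in> V \<Longrightarrow> p * q \<in> V"
  shows "unital_subalgebra V"
  using assms by (auto simp: unital_subalgebra_def)

lemma single_Cons: "Poly_Mapping.single (Word (g # gs)) a = letter g * Poly_Mapping.single (Word gs) a"
  by (simp add: letter_def mult_single plus_word_def)

lemma poly_mapping_sum_single: "p = (\<Sum>u\<in>Poly_Mapping.keys p. Poly_Mapping.single u (Poly_Mapping.lookup p u))"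
proof (rule poly_mapping_eqI)
  fix v
  have "(\<Sum>u\<in>Poly_Mapping.keys p. Poly_Mapping.lookup (Poly_Mapping.single u (Poly_Mapping.lookup p u)) v)
      = (\<Sum>u\<in>Poly_Mapping.keys p. if u = v then Poly_Mapping.lookup p u else 0)"
    by (rule sum.cong) (simp_all add: lookup_single)
  also have "\<dots> = Poly_Mapping.lookup p v"
    by (simp add: in_keys_iff)
  finally show "Poly_Mapping.lookup p v =
      Poly_Mapping.lookup (\<Sum>u\<in>Poly_Mapping.keys p. Poly_Mapping.single u (Poly_Mapping.lookup p u)) v"
    by (simp add: lookup_sum)
qed

context
  fixes V :: "('g word \<Rightarrow>\<^sub>0 complex) set"
  assumes V: "unital_subalgebra V"
begin

lemma subalgebra_scal: "scal a \<in> V"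
  and subalgebra_add: "p \<in> V \<Longrightarrow> q \<in> V \<Longrightarrow> p + q \<in> V"
  and subalgebra_mult: "p \<in> V \<Longrightarrow> q \<in> V \<Longrightarrow> p * q \<in> V"
  using V by (auto simp: unital_subalgebra_def)

lemma subalgebra_zero: "0 \<in> V" and subalgebra_one: "1 \<in> V"
  using subalgebra_scal[of 0] subalgebra_scal[of 1] by (simp_all add: scal_0 scal_1)

lemma subalgebra_minus: "p \<in> V \<Longrightarrow> - p \<in> V"
  using subalgebra_mult[OF subalgebra_scal[of "- 1"]] by (simp add: scal_minus scal_1)

lemma subalgebra_diff: "p \<in> V \<Longrightarrow> q \<in> V \<Longrightarrow> p - q \<in> V"
  using subalgebra_add[OF _ subalgebra_minus, of p q] by simp

lemma subalgebra_sum: "(\<And>i. i \<in> A \<Longrightarrow> f i \<in> V) \<Longrightarrow> sum f A \<in> V"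
  by (induction A rule: infinite_finite_induct) (auto intro: subalgebra_zero subalgebra_add)

text \<open>The induction principle for the free algebra: a polynomial is a finite sum of single
  words, and a word is built letter by letter from a scalar.\<close>

lemma free_algebra_least:
  assumes "letter ` G \<subseteq> V"
  shows "carrier (free_algebra G) \<subseteq> V"
proof
  fix p
  assume p: "p \<in> carrier (free_algebra G)"
  have single: "Poly_Mapping.single (Word gs) a \<in> V" if "set gs \<subseteq> G" for gs a
    using that
  proof (induction gs)
    case Nil
    then show ?case using subalgebra_scal[of a] by (simp add: scal_def zero_word_def)
  qed (use assms in \<open>auto simp: single_Cons intro!: subalgebra_mult\<close>)
  have "Poly_Mapping.single u (Poly_Mapping.lookup p u) \<in> V" if "u \<in> Poly_Mapping.keys p" for u
    using single[of "letters u"] p that by (auto simp: free_algebra_def)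
  then show "p \<in> V"
    by (subst poly_mapping_sum_single) (rule subalgebra_sum)
qed

end

lemma letter_in_free_algebra: "letter g \<in> carrier (free_algebra G) \<longleftrightarrow> g \<in> G"
  by (simp add: letter_def free_algebra_def)

lemma unital_subalgebra_free_algebra: "unital_subalgebra (carrier (free_algebra G))"
proof (rule unital_subalgebraI)
  fix p q :: "'a word \<Rightarrow>\<^sub>0 complex"
  assume pq: "p \<in> carrier (free_algebra G)" "q \<in> carrier (free_algebra G)"
  show "p + q \<in> carrier (free_algebra G)"
    using pq keys_add[of p q] by (fastforce simp: free_algebra_def)
  show "p * q \<in> carrier (free_algebra G)"
    using pq keys_mult[of p q] by (fastforce simp: free_algebra_def plus_word_def)
qed (simp add: scal_def free_algebra_def zero_word_def)

lemmas free_algebra_closed =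
  subalgebra_scal[OF unital_subalgebra_free_algebra] subalgebra_add[OF unital_subalgebra_free_algebra]
  subalgebra_mult[OF unital_subalgebra_free_algebra] subalgebra_zero[OF unital_subalgebra_free_algebra]
  subalgebra_one[OF unital_subalgebra_free_algebra] subalgebra_minus[OF unital_subalgebra_free_algebra]
  subalgebra_diff[OF unital_subalgebra_free_algebra] subalgebra_sum[OF unital_subalgebra_free_algebra]

lemma free_algebra_ops [simp]:
  "mult (free_algebra G) = (*)" "one (free_algebra G) = 1" "zero (free_algebra G) = 0"
  "add (free_algebra G) = (+)"
  by (simp_all add: free_algebra_def)

lemma ring_free_algebra: "Ring.ring (free_algebra G)"
proof (rule ringI)
  show "abelian_group (free_algebra G)"
  proof (rule abelian_groupI)
    fix p assume "p \<in> carrier (free_algebra G)"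
    then show "\<exists>q\<in>carrier (free_algebra G). q \<oplus>\<^bsub>free_algebra G\<^esub> p = \<zero>\<^bsub>free_algebra G\<^esub>"
      by (intro bexI[of _ "- p"]) (simp_all add: free_algebra_closed)
  qed (simp_all add: free_algebra_closed add_ac)
  show "Group.monoid (free_algebra G)"
    by (rule monoidI) (simp_all add: free_algebra_closed mult.assoc)
qed (simp_all add: algebra_simps)

lemma free_algebra_a_inv: "p \<in> carrier (free_algebra G) \<Longrightarrow> \<ominus>\<^bsub>free_algebra G\<^esub> p = - p"
  by (rule abelian_group.minus_equality[OF ring.is_abelian_group[OF ring_free_algebra]])
     (simp_all add: free_algebra_closed)

section \<open>The presented algebras and their quotient maps\<close>

lemma weyl_mono: "roots T n \<subseteq> roots T' n \<Longrightarrow> weyl T n \<subseteq> weyl T' n"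
proof
  fix g
  assume *: "roots T n \<subseteq> roots T' n" and "g \<in> weyl T n"
  from this(2) show "g \<in> weyl T' n"
    by induction (use * in \<open>auto simp only: intro: weyl.weyl_id weyl.weyl_refl\<close>)
qed

lemma roots_mono: "roots TypeA n \<subseteq> roots T n" "roots TypeD n \<subseteq> roots TypeB n"
  by (cases T) (auto simp: roots_def)

abbreviation ambient :: "root_type \<Rightarrow> root_type" where
  "ambient T \<equiv> if T = TypeA then TypeA else TypeB"

lemma weyl_ambient: "weyl T n \<subseteq> weyl (ambient T) n" "weyl TypeA n \<subseteq> weyl T n"
  by (cases T) (auto intro!: weyl_mono roots_mono)

lemma generators_simps:
  "GenX i \<in> generators T n \<longleftrightarrow> i \<in> {1..n}" "GenC i \<in> generators T n \<longleftrightarrow> i \<in> {1..n}"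
  "GenW g \<in> generators T n \<longleftrightarrow> g \<in> weyl (ambient T) n"
  by (auto simp: generators_def)

lemma reflection_adjacent_weyl:
  "1 \<le> i \<Longrightarrow> i < n \<Longrightarrow> reflection n (unit_vec i - unit_vec (Suc i)) \<in> weyl T n"
  by (intro pos_reflection_in_weyl pos_rootsI(1)) auto

lemma reflection_last_weyl: "1 \<le> n \<Longrightarrow> reflection n (unit_vec n) \<in> weyl TypeB n"
  by (intro pos_reflection_in_weyl pos_rootsI(3)) auto

text \<open>Needed for \<open>genideal\<close> to produce an ideal containing the relators. The
  bound on n enters because the type B relations mention the index n, which must lie in
  {1..n}.\<close>

lemma relators_carrier:
  assumes "1 \<le> n"
  shows "relators T n k N \<subseteq> carrier (free_algebra (generators T n))"
proof -
  have *: "w_gen g \<in> carrier (free_algebra (generators T n))" if "g \<in> weyl TypeA n" for g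
    using that weyl_ambient(2)[of n "ambient T"] by (auto simp: letter_in_free_algebra generators_simps)
  have "common_relators n k' \<subseteq> carrier (free_algebra (generators T n))" for k'
    unfolding common_relators_def s_adj_def using assms
    by (auto intro!: free_algebra_closed * reflection_adjacent_weyl
        simp: letter_in_free_algebra generators_simps)
  moreover have "group_relators (ambient T) n \<subseteq> carrier (free_algebra (generators T n))"
    unfolding group_relators_def
    by (intro Un_least subsetI)
       (auto intro!: free_algebra_closed weyl.weyl_id weyl_comp
        simp: letter_in_free_algebra generators_simps split del: if_split)
  ultimately show ?thesis
    using assms
    by (cases T)
       (auto simp: relators_A_def relators_B_def s_last_def letter_in_free_algebra generators_simps
         intro!: free_algebra_closed reflection_last_weyl)
qed

locale presentation =
  fixes T :: root_type and n :: nat and k :: "vec \<Rightarrow> complex" and N :: complex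
  assumes n_pos: "1 \<le> n"
begin

abbreviation A where "A \<equiv> free_algebra (generators T n)"
abbreviation Q where "Q \<equiv> presented T n k N"
abbreviation I where "I \<equiv> rel_ideal T n k N"
abbreviation cl where "cl \<equiv> cls T n k N"

text \<open>The quotient map followed by the embedding into the product type, so that relations
  between classes become equations in the type class \<open>ring\<close>.\<close>

definition q :: "falg \<Rightarrow> falg set ring_prod" where
  "q p = ring_prod_of Q (cl p)"

lemma ideal_I: "ideal I A"
  unfolding rel_ideal_def
  by (rule ring.genideal_ideal[OF ring_free_algebra relators_carrier[OF n_pos]])

lemma ring_Q: "Ring.ring Q"
  unfolding presented_def by (rule ideal.quotient_is_ring[OF ideal_I])

lemma cl_hom: "cl \<in> ring_hom A Q"
proof -
  have "cl = (+>\<^bsub>A\<^esub>) I" by (simp add: fun_eq_iff cls_def)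
  then show ?thesis
    unfolding presented_def using ideal.rcos_ring_hom[OF ideal_I] by simp
qed

lemma cl_closed: "p \<in> carrier A \<Longrightarrow> cl p \<in> carrier Q"
  by (rule ring_hom_closed[OF cl_hom])

lemma cl_add: "p \<in> carrier A \<Longrightarrow> r \<in> carrier A \<Longrightarrow> cl (p + r) = cl p \<oplus>\<^bsub>Q\<^esub> cl r"
  using ring_hom_add[OF cl_hom, of p r] by simp

lemma cl_mult: "p \<in> carrier A \<Longrightarrow> r \<in> carrier A \<Longrightarrow> cl (p * r) = cl p \<otimes>\<^bsub>Q\<^esub> cl r"
  using ring_hom_mult[OF cl_hom, of p r] by simp

lemma carrier_Q: "carrier Q = cl ` carrier A"
  by (auto simp: presented_def FactRing_def A_RCOSETS_def' cls_def)

lemma cl_eq_zero_iff: "p \<in> carrier A \<Longrightarrow> cl p = \<zero>\<^bsub>Q\<^esub> \<longleftrightarrow> p \<in> I"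
proof -
  assume p: "p \<in> carrier A"
  interpret ideal I A by (rule ideal_I)
  have "\<zero>\<^bsub>Q\<^esub> = I" by (simp add: presented_def FactRing_def)
  then show ?thesis
    using a_rcos_const[of p] a_rcos_self[OF p] by (auto simp: cls_def)
qed

lemma q_add: "p \<in> carrier A \<Longrightarrow> r \<in> carrier A \<Longrightarrow> q (p + r) = q p + q r"
  by (simp add: q_def cl_add cl_closed ring_prod_of_add ring_Q)

lemma q_mult: "p \<in> carrier A \<Longrightarrow> r \<in> carrier A \<Longrightarrow> q (p * r) = q p * q r"
  by (simp add: q_def cl_mult cl_closed ring_prod_of_mult ring_Q)

lemma q_eq_zero_iff: "p \<in> carrier A \<Longrightarrow> q p = 0 \<longleftrightarrow> p \<in> I"
  using ring_prod_of_inject[OF ring_Q cl_closed, of p "\<zero>\<^bsub>Q\<^esub>"]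
    ring_prod_of_zero[OF ring_Q] ring.ring_simprules(2)[OF ring_Q] cl_eq_zero_iff[of p]
  unfolding q_def by metis

lemma q_zero: "q 0 = 0"
  using q_add[of 0 0] by (simp add: free_algebra_closed)

lemma q_minus: "p \<in> carrier A \<Longrightarrow> q (- p) = - q p"
  using q_add[of p "- p"] by (simp add: free_algebra_closed q_zero eq_neg_iff_add_eq_0 add.commute)

lemma q_diff: "p \<in> carrier A \<Longrightarrow> r \<in> carrier A \<Longrightarrow> q (p - r) = q p - q r"
  using q_add[of p "- r"] by (simp add: free_algebra_closed q_minus)

lemma q_sum: "(\<And>i. i \<in> B \<Longrightarrow> f i \<in> carrier A) \<Longrightarrow> q (sum f B) = (\<Sum>i\<in>B. q (f i))"
  by (induction B rule: infinite_finite_induct) (simp_all add: q_zero q_add free_algebra_closed)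

lemma q_relator:
  assumes "p - r \<in> relators T n k N" "p \<in> carrier A" "r \<in> carrier A"
  shows "q p = q r"
proof -
  have "p - r \<in> I"
    using assms(1) ring.genideal_self[OF ring_free_algebra relators_carrier[OF n_pos]]
    unfolding rel_ideal_def by blast
  then have "q (p - r) = 0"
    using assms by (simp add: q_eq_zero_iff free_algebra_closed)
  then show ?thesis using assms by (simp add: q_diff)
qed

lemma x_carrier: "x_gen i \<in> carrier A \<longleftrightarrow> i \<in> {1..n}"
  and c_carrier: "c_gen i \<in> carrier A \<longleftrightarrow> i \<in> {1..n}"
  and w_carrier: "w_gen g \<in> carrier A \<longleftrightarrow> g \<in> weyl (ambient T) n"
  by (simp_all add: letter_in_free_algebra generators_simps)

text \<open>Extending the generators by zero makes most of the relations hold for all indices.\<close>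

definition xq where "xq i = (if i \<in> {1..n} then q (x_gen i) else 0)"
definition cq where "cq i = (if i \<in> {1..n} then q (c_gen i) else 0)"
definition wq where "wq g = (if g \<in> weyl T n then q (w_gen g) else 0)"

end

lemma scal_letter: "scal a * letter g = letter g * scal a"
  by (simp add: scal_def letter_def mult_single mult.commute)

lemma scal_mult: "scal a * scal b = scal (a * b)"
  by (simp add: scal_def mult_single)

locale main_presentation = presentation +
  assumes type: "T \<noteq> TypeD" and k_inv: "weyl_invariant T n k"
begin

lemma ambient_T: "ambient T = T"
  using type by (cases T) auto

lemmas gens_carrier = x_carrier c_carrier w_carrier[unfolded ambient_T] free_algebra_closed

lemma common_relator: "r \<in> common_relators n k \<Longrightarrow> r \<in> relators T n k N"
  using type by (cases T) (auto simp: relators_A_def relators_B_def)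

lemma group_relator: "r \<in> group_relators T n \<Longrightarrow> r \<in> relators T n k N"
  using type by (cases T) (auto simp: relators_A_def relators_B_def)

text \<open>Both types satisfy one list of relations: type A is the case in which the commutator
  parameter is 0, and the relations for the last reflection are guarded by
  \<open>T = TypeB\<close>.\<close>

sublocale hecke_clifford_relations T n k "if T = TypeA then 0 else N" "\<lambda>a. q (scal a)" xq cq wq
proof
  show "T \<noteq> TypeD" "1 \<le> n" "weyl_invariant T n k" by (fact type n_pos k_inv)+
  fix a b
  show "q (scal (a + b)) = q (scal a) + q (scal b)"
    by (simp add: scal_add q_add free_algebra_closed)
  show "q (scal a) * q (scal b) = q (scal (a * b))"
    by (simp add: free_algebra_closed flip: q_mult scal_mult)
  have letter: "q (letter g) * q (scal a) = q (scal a) * q (letter g)" if "letter g \<in> carrier A" for g a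
    using that by (simp add: free_algebra_closed scal_letter flip: q_mult)
  have one: "q (scal 1) * q (letter g) = q (letter g)" if "letter g \<in> carrier A" for g
    using that by (simp add: free_algebra_closed scal_1 flip: q_mult)
  show "xq i * q (scal a) = q (scal a) * xq i" "q (scal 1) * xq i = xq i" for i
    using letter one by (simp_all add: xq_def gens_carrier)
  show "cq i * q (scal a) = q (scal a) * cq i" "q (scal 1) * cq i = cq i" for i
    using letter one by (simp_all add: cq_def gens_carrier)
  show "wq g * q (scal a) = q (scal a) * wq g" "q (scal 1) * wq g = wq g" for g
    using letter one by (simp_all add: wq_def gens_carrier)
  show "wq id = q (scal 1)"
  proof -
    have "q (w_gen id) = q 1"
      by (rule q_relator) (simp_all only: group_relator group_relators_def gens_carrier weyl.weyl_id Un_iff singleton_iff simp_thms)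
    then show ?thesis by (simp add: wq_def weyl.weyl_id scal_1 del: id_apply)
  qed
next
  fix u v
  assume uv: "u \<in> weyl T n" "v \<in> weyl T n"
  have "q (w_gen (u \<circ> v)) = q (w_gen u * w_gen v)"
  proof (rule q_relator)
    show "w_gen (u \<circ> v) - w_gen u * w_gen v \<in> relators T n k N"
      by (rule group_relator) (use uv in \<open>auto simp only: group_relators_def\<close>)
  qed (simp_all only: gens_carrier uv weyl_comp)
  then show "wq (u \<circ> v) = wq u * wq v"
    using uv by (simp only: wq_def weyl_comp q_mult gens_carrier if_True)
next
  fix i j :: nat
  assume ij: "i \<noteq> j"
  show "xq i * cq j = cq j * xq i"
  proof (cases "i \<in> {1..n} \<and> j \<in> {1..n}")
    case True
    have "q (x_gen i * c_gen j) = q (c_gen j * x_gen i)"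
    proof (rule q_relator)
      show "x_gen i * c_gen j - c_gen j * x_gen i \<in> relators T n k N"
        by (rule common_relator) (use True ij in \<open>auto simp only: common_relators_def\<close>)
    qed (use True in \<open>simp_all add: gens_carrier\<close>)
    then show ?thesis
      using True by (simp add: xq_def cq_def q_mult gens_carrier)
  qed (auto simp: xq_def cq_def)
  show "cq i * cq j = - (cq j * cq i)"
  proof (cases "i \<in> {1..n} \<and> j \<in> {1..n}")
    case True
    have "q (c_gen i * c_gen j) = q (- (c_gen j * c_gen i))"
    proof (rule q_relator)
      show "c_gen i * c_gen j - (- (c_gen j * c_gen i)) \<in> relators T n k N"
        by (rule common_relator) (use True ij in \<open>auto simp only: common_relators_def\<close>)
    qed (use True in \<open>simp_all add: gens_carrier\<close>)
    then show ?thesis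
      using True by (simp add: cq_def q_mult q_minus gens_carrier)
  qed (auto simp: cq_def)
next
  fix i :: nat
  show "xq i * cq i = - (cq i * xq i)"
  proof (cases "i \<in> {1..n}")
    case True
    have "q (x_gen i * c_gen i) = q (- (c_gen i * x_gen i))"
    proof (rule q_relator)
      show "x_gen i * c_gen i - (- (c_gen i * x_gen i)) \<in> relators T n k N"
        by (rule common_relator) (use True in \<open>auto simp only: common_relators_def\<close>)
    qed (use True in \<open>simp_all add: gens_carrier\<close>)
    then show ?thesis
      using True by (simp add: xq_def cq_def q_mult q_minus gens_carrier)
  qed (auto simp: xq_def cq_def)
next
  fix i
  assume i: "i \<in> {1..n}"
  have "q (c_gen i * c_gen i) = q (- 1)"
  proof (rule q_relator)
    show "c_gen i * c_gen i - (- 1) \<in> relators T n k N"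
      by (rule common_relator) (use i in \<open>auto simp only: common_relators_def\<close>)
  qed (use i in \<open>simp_all add: gens_carrier\<close>)
  then show "cq i * cq i = - q (scal 1)"
    using i by (simp add: cq_def q_mult q_minus scal_1 gens_carrier)
next
  fix i l
  assume i: "1 \<le> i" "i < n" and l: "l \<in> {1..n}"
  let ?s = "reflection n (unit_vec i - unit_vec (Suc i))"
  let ?l = "if l = i then Suc i else if l = Suc i then i else l"
  have s: "?s \<in> weyl T' n" for T' by (rule reflection_adjacent_weyl[OF i])
  have l': "?l \<in> {1..n}" using i l by auto
  have "q (w_gen ?s * c_gen l) = q (c_gen ?l * w_gen ?s)"
  proof (rule q_relator)
    have "?s (unit_vec l) = unit_vec ?l"
      using i l by (intro reflection_unit_minus) auto
    with s[of TypeA] l l' show "w_gen ?s * c_gen l - c_gen ?l * w_gen ?s \<in> relators T n k N"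
      by (intro common_relator) (unfold common_relators_def, blast)
  qed (use l l' s in \<open>simp_all only: gens_carrier\<close>)
  then show "wq ?s * cq l = cq ?l * wq ?s"
    using l l' s by (simp only: wq_def cq_def q_mult gens_carrier if_True)
next
  fix i
  assume i: "1 \<le> i" "i < n"
  let ?s = "reflection n (unit_vec i - unit_vec (Suc i))"
  have s: "?s \<in> weyl T' n" for T' by (rule reflection_adjacent_weyl[OF i])
  have r: "i \<in> {1..n}" "Suc i \<in> {1..n}" using i by auto
  let ?k = "k (unit_vec i - unit_vec (Suc i))"
  have "q (w_gen ?s * x_gen i - x_gen (Suc i) * w_gen ?s) = q (scal ?k * (- 1 + c_gen i * c_gen (Suc i)))"
  proof (rule q_relator)
    show "w_gen ?s * x_gen i - x_gen (Suc i) * w_gen ?s -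
        scal ?k * (- 1 + c_gen i * c_gen (Suc i)) \<in> relators T n k N"
      by (rule common_relator) (use i in \<open>unfold common_relators_def s_adj_def, blast\<close>)
  qed (use r s in \<open>simp_all only: gens_carrier\<close>)
  then have "q (w_gen ?s) * q (x_gen i) - q (x_gen (Suc i)) * q (w_gen ?s) =
      q (scal ?k) * (- q (scal 1) + q (c_gen i) * q (c_gen (Suc i)))"
    using r s by (simp only: q_mult q_diff q_add q_minus gens_carrier scal_1)
  then show "wq ?s * xq i = xq (Suc i) * wq ?s + q (scal ?k) * (cq i * cq (Suc i) - q (scal 1))"
    using r s by (simp add: xq_def cq_def wq_def algebra_simps)
next
  fix i l
  assume i: "1 \<le> i" "i < n" and l: "l \<in> {1..n}" "l \<noteq> i" "l \<noteq> Suc i"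
  let ?s = "reflection n (unit_vec i - unit_vec (Suc i))"
  have s: "?s \<in> weyl T' n" for T' by (rule reflection_adjacent_weyl[OF i])
  have "q (w_gen ?s * x_gen l) = q (x_gen l * w_gen ?s)"
  proof (rule q_relator)
    show "w_gen ?s * x_gen l - x_gen l * w_gen ?s \<in> relators T n k N"
      by (rule common_relator) (use i l in \<open>unfold common_relators_def s_adj_def, blast\<close>)
  qed (use l s in \<open>simp_all only: gens_carrier\<close>)
  then show "wq ?s * xq l = xq l * wq ?s"
    using l s by (simp only: wq_def xq_def q_mult gens_carrier if_True)
next
  assume B: "T = TypeB"
  let ?s = "reflection n (unit_vec n)"
  have s: "?s \<in> weyl T n" unfolding B by (rule reflection_last_weyl[OF n_pos])
  have n: "n \<in> {1..n}" using n_pos by simp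
  have rel: "r \<in> relators T n k N" if "r \<in> relators_B n k N" for r
    using that by (simp add: B)
  have "q (w_gen ?s * c_gen n) = q (- (c_gen n * w_gen ?s))"
    by (rule q_relator, rule rel, unfold relators_B_def s_last_def, blast)
       (use n s in \<open>simp_all only: gens_carrier\<close>)
  then show "wq ?s * cq n = - (cq n * wq ?s)"
    using n s by (simp only: wq_def cq_def q_mult q_minus gens_carrier if_True)
  have "q (w_gen ?s * x_gen n + x_gen n * w_gen ?s) = q (scal (- (of_real (sqrt 2) * k (unit_vec n))))"
    by (rule q_relator, rule rel, unfold relators_B_def s_last_def, blast)
       (use n s in \<open>simp_all only: gens_carrier\<close>)
  then have "q (w_gen ?s) * q (x_gen n) + q (x_gen n) * q (w_gen ?s) =
      - q (scal (of_real (sqrt 2) * k (unit_vec n)))"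
    using n s by (simp only: q_mult q_add q_minus scal_minus gens_carrier)
  then show "wq ?s * xq n = - (xq n * wq ?s) - q (scal (of_real (sqrt 2) * k (unit_vec n)))"
    using n s by (simp add: xq_def wq_def algebra_simps eq_neg_iff_add_eq_0)
  fix i
  assume i: "i \<in> {1..n}" "i \<noteq> n"
  have "q (w_gen ?s * c_gen i) = q (c_gen i * w_gen ?s)"
    by (rule q_relator, rule rel, use i in \<open>unfold relators_B_def s_last_def, blast\<close>)
       (use i s in \<open>simp_all only: gens_carrier\<close>)
  then show "wq ?s * cq i = cq i * wq ?s"
    using i s by (simp only: wq_def cq_def q_mult gens_carrier if_True)
  have "q (w_gen ?s * x_gen i) = q (x_gen i * w_gen ?s)"
    by (rule q_relator, rule rel, use i in \<open>unfold relators_B_def s_last_def, blast\<close>)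
       (use i s in \<open>simp_all only: gens_carrier\<close>)
  then show "wq ?s * xq i = xq i * wq ?s"
    using i s by (simp only: wq_def xq_def q_mult gens_carrier if_True)
next
  fix i j
  assume ij: "i \<in> {1..n}" "j \<in> {1..n}" "i \<noteq> j"
  show "xq i * xq j = xq j * xq i + q (scal (if T = TypeA then 0 else N)) * (cq j * cq i)"
  proof (cases "T = TypeA")
    case True
    have "q (x_gen i * x_gen j) = q (x_gen j * x_gen i)"
    proof (rule q_relator)
      show "x_gen i * x_gen j - x_gen j * x_gen i \<in> relators T n k N"
        using ij unfolding True relators.simps relators_A_def by blast
    qed (use ij in \<open>simp_all only: gens_carrier\<close>)
    then show ?thesis
      unfolding if_P[OF True] scal_0 q_zero
      using ij by (simp add: xq_def q_mult gens_carrier)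
  next
    case False
    then have B: "T = TypeB" using type by (cases T) auto
    have "q (x_gen i * x_gen j - x_gen j * x_gen i) = q (scal N * (c_gen j * c_gen i))"
    proof (rule q_relator)
      show "x_gen i * x_gen j - x_gen j * x_gen i - scal N * (c_gen j * c_gen i) \<in> relators T n k N"
        using ij unfolding B relators.simps relators_B_def by blast
    qed (use ij in \<open>simp_all only: gens_carrier\<close>)
    then have "q (x_gen i) * q (x_gen j) - q (x_gen j) * q (x_gen i) =
        q (scal N) * (q (c_gen j) * q (c_gen i))"
      using ij by (simp only: q_mult q_diff gens_carrier)
    then show ?thesis
      using ij False by (simp add: xq_def cq_def algebra_simps)
  qed
qed

end

section \<open>The grading by parity\<close>

definition parity :: "bool \<Rightarrow> falg \<Rightarrow> bool" where
  "parity b p \<longleftrightarrow> (\<forall>u\<in>Poly_Mapping.keys p. odd (c_degree u) = b)"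

lemma c_degree_add: "c_degree (u + v) = c_degree u + c_degree v"
  by (simp add: c_degree_def plus_word_def)

lemma parity_add: "parity b p \<Longrightarrow> parity b r \<Longrightarrow> parity b (p + r)"
  using keys_add[of p r] by (fastforce simp: parity_def)

lemma parity_minus: "parity b p \<Longrightarrow> parity b (- p)"
  by (simp add: parity_def)

lemma parity_diff: "parity b p \<Longrightarrow> parity b r \<Longrightarrow> parity b (p - r)"
  using parity_add[OF _ parity_minus, of b p r] by simp

lemma parity_mult:
  assumes "parity a p" "parity b r"
  shows "parity (a \<noteq> b) (p * r)"
  using assms keys_mult[of p r] by (fastforce simp: parity_def c_degree_add)

lemma parity_zero: "parity b 0"
  by (simp add: parity_def)

lemma parity_scal: "parity False (scal a)"
  by (simp add: parity_def scal_def c_degree_def zero_word_def)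

lemma parity_one: "parity False 1"
  using parity_scal[of 1] by (simp add: scal_1)

lemma parity_gens: "parity False (x_gen i)" "parity True (c_gen i)" "parity False (w_gen g)"
  by (simp_all add: parity_def letter_def c_degree_def)

lemma parity_sum: "(\<And>i. i \<in> B \<Longrightarrow> parity b (f i)) \<Longrightarrow> parity b (sum f B)"
  by (induction B rule: infinite_finite_induct) (simp_all add: parity_zero parity_add)

lemma parity_both: "parity False p \<Longrightarrow> parity True p \<Longrightarrow> p = 0"
  by (metis (full_types) all_not_in_conv keys_eq_empty parity_def)

lemma parity_mult_rules:
  "parity False p \<Longrightarrow> parity b r \<Longrightarrow> parity b (p * r)"
  "parity True p \<Longrightarrow> parity True r \<Longrightarrow> parity False (p * r)"
  "parity True p \<Longrightarrow> parity False r \<Longrightarrow> parity True (p * r)"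
  using parity_mult[of False p b r] parity_mult[of True p True r] parity_mult[of True p False r] by simp_all

lemmas parity_intros = parity_scal parity_one parity_gens parity_add parity_minus parity_diff parity_mult_rules

text \<open>Homogeneity of the defining relations is what the ideal needs in order to inherit the
  grading.\<close>

lemma relators_parity:
  assumes "r \<in> relators T n k N"
  shows "parity False r \<or> parity True r"
proof -
  have common: "parity False r \<or> parity True r" if "r \<in> common_relators n k'" for k'
    using that unfolding common_relators_def s_adj_def Un_iff
    by (elim disjE CollectE exE conjE; hypsubst; blast intro: parity_intros)
  have group: "parity False r \<or> parity True r" if "r \<in> group_relators T' n" for T'
    using that unfolding group_relators_def Un_iff
    by (elim disjE CollectE exE conjE singletonE; hypsubst; blast intro: parity_intros)
  have "parity False r \<or> parity True r" if "r \<in> relators_A n k'" for k'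
    by (insert that, unfold relators_A_def Un_iff, elim disjE; (erule common | erule group |
          (elim CollectE exE conjE singletonE; hypsubst; blast intro: parity_intros)))
  moreover have "parity False r \<or> parity True r" if "r \<in> relators_B n k' N" for k'
    by (insert that, unfold relators_B_def s_last_def Un_iff, elim disjE; (erule common | erule group |
          (elim CollectE exE conjE singletonE; hypsubst; blast intro: parity_intros)))
  ultimately show ?thesis
    using assms by (cases T) auto
qed

text \<open>The decomposable elements contain all letters and form a unital subalgebra: in a
  product, even-even and odd-odd terms make up the even part.\<close>

lemma parity_decomp:
  assumes "p \<in> carrier (free_algebra G)"
  shows "\<exists>p0\<in>carrier (free_algebra G). \<exists>p1\<in>carrier (free_algebra G).
    parity False p0 \<and> parity True p1 \<and> p = p0 + p1"
proof -
  let ?A = "carrier (free_algebra G)"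
  let ?V = "{p. \<exists>p0\<in>?A. \<exists>p1\<in>?A. parity False p0 \<and> parity True p1 \<and> p = p0 + p1}"
  have evenI: "p \<in> ?V" if "p \<in> ?A" "parity False p" for p
    using that by (intro CollectI bexI[of _ p] bexI[of _ 0]) (auto simp: parity_zero free_algebra_closed)
  have oddI: "p \<in> ?V" if "p \<in> ?A" "parity True p" for p
    using that by (intro CollectI bexI[of _ p] bexI[of _ 0]) (auto simp: parity_zero free_algebra_closed)
  have "unital_subalgebra ?V"
  proof (rule unital_subalgebraI)
    fix a show "scal a \<in> ?V"
      by (intro evenI free_algebra_closed parity_intros)
  next
    fix p r
    assume "p \<in> ?V" "r \<in> ?V"
    then obtain p0 p1 r0 r1 where
      pr: "p0 \<in> ?A" "p1 \<in> ?A" "r0 \<in> ?A" "r1 \<in> ?A" "parity False p0" "parity True p1"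
        "parity False r0" "parity True r1" and eq: "p = p0 + p1" "r = r0 + r1"
      by blast
    show "p + r \<in> ?V"
      by (intro CollectI bexI[of _ "p0 + r0"] bexI[of _ "p1 + r1"] conjI parity_intros free_algebra_closed pr)
         (simp add: eq)
    show "p * r \<in> ?V"
      by (intro CollectI bexI[of _ "p0 * r0 + p1 * r1"] bexI[of _ "p0 * r1 + p1 * r0"] conjI
            parity_intros free_algebra_closed pr)
         (simp add: eq algebra_simps)
  qed
  moreover have "letter g \<in> ?V" if "g \<in> G" for g
    using that by (cases g) (simp_all only: letter_in_free_algebra parity_gens evenI oddI)
  ultimately show ?thesis
    using free_algebra_least[of ?V G] assms by blast
qed

context presentation
begin

text \<open>The ideal is graded: the elements whose even and odd parts both lie in it form an ideal
  containing the homogeneous relators, so minimality of the generated ideal applies.\<close>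

lemma ideal_parity:
  assumes "p \<in> I"
  shows "\<exists>e\<in>I. \<exists>u\<in>I. parity False e \<and> parity True u \<and> p = e + u"
proof -
  interpret I: ideal I A by (rule ideal_I)
  define J where "J = {p. \<exists>e\<in>I. \<exists>u\<in>I. parity False e \<and> parity True u \<and> p = e + u}"
  have add_I: "additive_subgroup I A"
    by (rule ideal.axioms(1)[OF ideal_I])
  have I_add: "a + b \<in> I" if "a \<in> I" "b \<in> I" for a b
    using additive_subgroup.a_closed[OF add_I that] by simp
  have I_zero: "0 \<in> I"
    using additive_subgroup.zero_closed[OF add_I] by simp
  have I_carr: "a \<in> carrier A" if "a \<in> I" for a
    using ideal.Icarr[OF ideal_I that] .
  have I_mult: "a * b \<in> I" "b * a \<in> I" if "a \<in> I" "b \<in> carrier A" for a b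
    using ideal.I_l_closed[OF ideal_I that] ideal.I_r_closed[OF ideal_I that] by simp_all
  have I_minus: "- a \<in> I" if "a \<in> I" for a
    using I_mult(2)[OF that, of "- 1"] by (simp add: free_algebra_closed)
  have "ideal J A"
  proof (rule idealI[OF ring_free_algebra])
    show "subgroup J (add_monoid A)"
    proof (rule I.add.subgroupI)
      show "J \<subseteq> carrier A"
        using I_carr by (auto simp: J_def free_algebra_closed)
      show "J \<noteq> {}"
        using I_zero parity_zero by (force simp: J_def)
      fix a assume a: "a \<in> J"
      then obtain e u where eu: "e \<in> I" "u \<in> I" "parity False e" "parity True u" "a = e + u"
        by (auto simp: J_def)
      have "\<ominus>\<^bsub>A\<^esub> a = - a"
        using free_algebra_a_inv[of a "generators T n"] \<open>J \<subseteq> carrier A\<close> a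
        by auto
      also have "\<dots> \<in> J"
        unfolding J_def
        by (intro CollectI bexI[of _ "- e"] bexI[of _ "- u"] conjI parity_intros eu I_minus) (simp add: eu)
      finally show "\<ominus>\<^bsub>A\<^esub> a \<in> J" .
      fix b assume "b \<in> J"
      then obtain e' u' where eu': "e' \<in> I" "u' \<in> I" "parity False e'" "parity True u'" "b = e' + u'"
        by (auto simp: J_def)
      have "a + b \<in> J"
        unfolding J_def
        by (intro CollectI bexI[of _ "e + e'"] bexI[of _ "u + u'"] conjI parity_intros eu eu' I_add)
           (simp add: eu eu')
      then show "a \<oplus>\<^bsub>A\<^esub> b \<in> J" by simp
    qed
  next
    fix a r
    assume "a \<in> J" "r \<in> carrier A"
    then obtain e u r0 r1 where *: "e \<in> I" "u \<in> I" "parity False e" "parity True u"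
      "r0 \<in> carrier A" "r1 \<in> carrier A" "parity False r0" "parity True r1" "a = e + u" "r = r0 + r1"
      using parity_decomp[of r] by (fastforce simp: J_def)
    have "r * a \<in> J"
      unfolding J_def
      by (intro CollectI bexI[of _ "r0 * e + r1 * u"] bexI[of _ "r0 * u + r1 * e"] conjI
            parity_intros * I_add I_mult) (simp add: * algebra_simps)
    moreover have "a * r \<in> J"
      unfolding J_def
      by (intro CollectI bexI[of _ "e * r0 + u * r1"] bexI[of _ "u * r0 + e * r1"] conjI
            parity_intros * I_add I_mult) (simp add: * algebra_simps)
    ultimately show "r \<otimes>\<^bsub>A\<^esub> a \<in> J" "a \<otimes>\<^bsub>A\<^esub> r \<in> J" by simp_all
  qed
  moreover have "relators T n k N \<subseteq> J"
  proof
    fix r assume r: "r \<in> relators T n k N"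
    then have "r \<in> I"
      using ring.genideal_self[OF ring_free_algebra relators_carrier[OF n_pos]]
      unfolding rel_ideal_def by blast
    from relators_parity[OF r] show "r \<in> J"
    proof
      assume "parity False r"
      then show ?thesis
        unfolding J_def using \<open>r \<in> I\<close> I_zero
        by (intro CollectI bexI[of _ r] bexI[of _ 0]) (simp_all add: parity_zero)
    next
      assume "parity True r"
      then show ?thesis
        unfolding J_def using \<open>r \<in> I\<close> I_zero
        by (intro CollectI bexI[of _ 0] bexI[of _ r]) (simp_all add: parity_zero)
    qed
  qed
  ultimately have "I \<subseteq> J"
    unfolding rel_ideal_def by (rule ring.genideal_minimal[OF ring_free_algebra])
  then show ?thesis using assms by (auto simp: J_def)
qed

text \<open>\<open>supercommute\<close> supplies some decomposition of a class, not one attached to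
  a given representative. Gradedness of the ideal makes the sum of even and odd classes direct, so
  an even class has zero odd part in every decomposition.\<close>

lemma odd_part_of_even:
  assumes carr: "p \<in> carrier A" "p0 \<in> carrier A" "p1 \<in> carrier A"
    and par: "parity False p" "parity False p0" "parity True p1"
    and eq: "q p = q p0 + q p1"
  shows "q p1 = 0"
proof -
  have "q (p - p0 - p1) = 0"
    using carr eq by (simp add: q_diff free_algebra_closed)
  then have "p - p0 - p1 \<in> I"
    using carr by (simp add: q_eq_zero_iff free_algebra_closed)
  from ideal_parity[OF this]
  obtain e u where eu: "e \<in> I" "u \<in> I" "parity False e" "parity True u" "p - p0 - p1 = e + u"
    by blast
  \<comment> \<open>The left side is even and the right side is odd, so both vanish already in the
    free algebra.\<close>
  have "p - p0 - e = p1 + u"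
    using eu(5) by (simp add: algebra_simps)
  moreover have "parity False (p - p0 - e)" "parity True (p1 + u)"
    using par eu by (simp_all add: parity_diff parity_add)
  ultimately have "p1 + u = 0"
    by (intro parity_both) simp_all
  moreover have u: "u \<in> carrier A"
    using ideal.Icarr[OF ideal_I eu(2)] .
  ultimately have "q p1 + q u = 0"
    using carr q_add[of p1 u] q_zero by simp
  moreover have "q u = 0"
    using u eu(2) by (simp add: q_eq_zero_iff)
  ultimately show ?thesis by simp
qed

end

section \<open>The square of the Dirac element\<close>

text \<open>Representatives in the free algebra are separated from their classes, because parity and
  membership in subalgebras are checked on representatives.\<close>

definition dirac_poly :: "root_type \<Rightarrow> nat \<Rightarrow> (vec \<Rightarrow> complex) \<Rightarrow> falg" where
  "dirac_poly T n k = (\<Sum>i=1..n. x_gen i * c_gen i) +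
      scal (of_real (sqrt 2 / 2)) *
        (\<Sum>\<alpha>\<in>pos_roots T n. scal (k \<alpha> * of_real (ip n \<alpha> \<alpha>)) * s_tilde n \<alpha>)"

definition omega_poly :: "nat \<Rightarrow> falg" where
  "omega_poly n = (\<Sum>i=1..n. x_gen i * x_gen i)"

definition inversions :: "root_type \<Rightarrow> nat \<Rightarrow> (vec \<times> vec) set" where
  "inversions T n = {(\<alpha>, \<beta>). \<alpha> \<in> pos_roots T n \<and> \<beta> \<in> pos_roots T n \<and>
                               - reflection n \<alpha> \<beta> \<in> pos_roots T n}"

definition seg_poly :: "root_type \<Rightarrow> nat \<Rightarrow> (vec \<Rightarrow> complex) \<Rightarrow> falg" where
  "seg_poly T n k = scal (1 / 2) *
        (\<Sum>(\<alpha>, \<beta>)\<in>inversions T n.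
           scal (of_real (\<bar>ip n \<alpha> \<alpha>\<bar> * \<bar>ip n \<beta> \<beta>\<bar>) * k \<alpha> * k \<beta>) *
             (s_tilde n \<alpha> * s_tilde n \<beta>))"

lemma dirac_eq: "dirac T n k N = cls T n k N (dirac_poly T n k)"
  and Omega_H_eq: "Omega_H T n k N = cls T n k N (omega_poly n)"
  and Omega_Seg_eq: "Omega_Seg T n k N = cls T n k N (seg_poly T n k)"
  by (simp_all only: dirac_def dirac_poly_def Omega_H_def omega_poly_def Omega_Seg_def seg_poly_def
      inversions_def)

lemma finite_inversions: "finite (inversions T n)"
  by (rule finite_subset[of _ "pos_roots T n \<times> pos_roots T n"])
     (auto simp only: inversions_def finite_cartesian_product finite_pos_roots mem_Collect_eq mem_Times_iff)

lemma s_tilde_in_subalgebra: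
  assumes "unital_subalgebra V" "w_gen (reflection n \<alpha>) \<in> V" "\<And>i. i \<in> {1..n} \<Longrightarrow> c_gen i \<in> V"
  shows "s_tilde n \<alpha> \<in> V"
  unfolding s_tilde_def c_root_def
  by (intro subalgebra_mult subalgebra_sum subalgebra_scal assms)

lemma dirac_poly_in_subalgebra:
  assumes "unital_subalgebra V" "\<And>\<alpha>. \<alpha> \<in> pos_roots T n \<Longrightarrow> w_gen (reflection n \<alpha>) \<in> V"
    "\<And>i. i \<in> {1..n} \<Longrightarrow> c_gen i \<in> V" "\<And>i. i \<in> {1..n} \<Longrightarrow> x_gen i \<in> V"
  shows "dirac_poly T n k \<in> V"
  unfolding dirac_poly_def
  by (intro subalgebra_mult subalgebra_sum subalgebra_scal subalgebra_add s_tilde_in_subalgebra assms)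

lemma seg_poly_in_subalgebra:
  assumes "unital_subalgebra V" "\<And>\<alpha>. \<alpha> \<in> pos_roots T n \<Longrightarrow> w_gen (reflection n \<alpha>) \<in> V"
    "\<And>i. i \<in> {1..n} \<Longrightarrow> c_gen i \<in> V"
  shows "seg_poly T n k \<in> V"
proof -
  have *: "s_tilde n (fst p) \<in> V" "s_tilde n (snd p) \<in> V" if "p \<in> inversions T n" for p
    using that unfolding inversions_def by (auto intro!: s_tilde_in_subalgebra assms)
  show ?thesis
    unfolding seg_poly_def case_prod_beta
    by (intro subalgebra_mult subalgebra_sum subalgebra_scal assms(1) *)
qed

lemma parity_s_tilde: "parity True (s_tilde n \<alpha>)"
proof -
  have "parity True (c_root n \<alpha>)"
    unfolding c_root_def by (intro parity_mult_rules(1) parity_scal parity_sum parity_gens)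
  then show ?thesis
    unfolding s_tilde_def by (intro parity_mult_rules(1) parity_gens)
qed

lemma parity_seg_poly: "parity False (seg_poly T n k)"
  unfolding seg_poly_def case_prod_beta
  by (rule parity_mult_rules(1)[OF parity_scal parity_sum[OF parity_mult_rules(1)[OF parity_scal
          parity_mult_rules(2)[OF parity_s_tilde parity_s_tilde]]]])

section \<open>Reduction of type D to type B\<close>

lemma pos_roots_D_iff: "\<alpha> \<in> pos_roots TypeD n \<longleftrightarrow> \<alpha> \<in> pos_roots TypeB n \<and> ip n \<alpha> \<alpha> = 2"
  by (auto simp: long_minus_def long_plus_def ip_add_left ip_diff_left ip_unit_vec_left unit_vec_apply)

lemma ext_zero_pos_root:
  assumes "\<alpha> \<in> pos_roots TypeB n"
  shows "ext_zero n k \<alpha> = (if \<alpha> \<in> pos_roots TypeD n then k \<alpha> else 0)"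
proof -
  have "- \<alpha> \<in> pos_roots TypeD n \<longleftrightarrow> False"
    using pos_roots_uminus[OF assms] by (simp only: pos_roots_D_iff simp_thms)
  then show ?thesis
    by (simp only: ext_zero_def roots_iff simp_thms)
qed

text \<open>The short roots, which are the additional positive roots of type B, enter with parameter
  0.\<close>

lemma dirac_poly_D: "dirac_poly TypeD n k = dirac_poly TypeB n (ext_zero n k)"
proof -
  have "(\<Sum>\<alpha>\<in>pos_roots TypeD n. scal (k \<alpha> * of_real (ip n \<alpha> \<alpha>)) * s_tilde n \<alpha>) =
      (\<Sum>\<alpha>\<in>pos_roots TypeB n. scal (ext_zero n k \<alpha> * of_real (ip n \<alpha> \<alpha>)) * s_tilde n \<alpha>)"
  proof (rule sum.mono_neutral_cong_left[OF finite_pos_roots])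
    show "\<forall>\<alpha>\<in>pos_roots TypeB n - pos_roots TypeD n.
        scal (ext_zero n k \<alpha> * of_real (ip n \<alpha> \<alpha>)) * s_tilde n \<alpha> = 0"
      by (simp add: ext_zero_pos_root scal_0 del: pos_roots.simps)
  qed (simp_all add: pos_roots_D_iff ext_zero_pos_root subset_iff del: pos_roots.simps)
  then show ?thesis by (simp only: dirac_poly_def)
qed

text \<open>For two long roots, being an inversion means the same in types B and D, as reflections
  preserve length. A type B inversion involving a short root has a zero coefficient.\<close>

lemma seg_poly_D: "seg_poly TypeD n k = seg_poly TypeB n (ext_zero n k)"
proof -
  have iff: "(\<alpha>, \<beta>) \<in> inversions TypeD n \<longleftrightarrow>
      (\<alpha>, \<beta>) \<in> inversions TypeB n \<and> \<alpha> \<in> pos_roots TypeD n \<and> \<beta> \<in> pos_roots TypeD n" for \<alpha> \<beta>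
  proof -
    have "ip n (- reflection n \<alpha> \<beta>) (- reflection n \<alpha> \<beta>) = 2"
      if "\<alpha> \<in> pos_roots TypeD n" "\<beta> \<in> pos_roots TypeD n"
      unfolding ip_minus_left ip_minus_right minus_minus
      using ip_reflection[OF norm_pos_roots_nz[OF that(1)], of \<beta> \<beta>] that(2) pos_roots_D_iff[of \<beta> n]
      by simp
    then show ?thesis
      unfolding inversions_def mem_Collect_eq case_prod_conv pos_roots_D_iff[of "- reflection n \<alpha> \<beta>"]
      using pos_roots_D_iff[of \<alpha> n] pos_roots_D_iff[of \<beta> n] by blast
  qed
  have "(\<Sum>(\<alpha>, \<beta>)\<in>inversions TypeD n.
           scal (of_real (\<bar>ip n \<alpha> \<alpha>\<bar> * \<bar>ip n \<beta> \<beta>\<bar>) * k \<alpha> * k \<beta>) * (s_tilde n \<alpha> * s_tilde n \<beta>)) =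
      (\<Sum>(\<alpha>, \<beta>)\<in>inversions TypeB n.
           scal (of_real (\<bar>ip n \<alpha> \<alpha>\<bar> * \<bar>ip n \<beta> \<beta>\<bar>) * ext_zero n k \<alpha> * ext_zero n k \<beta>) *
             (s_tilde n \<alpha> * s_tilde n \<beta>))"
  proof (rule sum.mono_neutral_cong_left[OF finite_inversions])
    have pos: "\<alpha> \<in> pos_roots TypeB n" "\<beta> \<in> pos_roots TypeB n"
      if "(\<alpha>, \<beta>) \<in> inversions TypeB n" for \<alpha> \<beta>
      using that by (simp_all only: inversions_def mem_Collect_eq case_prod_conv)
    show "inversions TypeD n \<subseteq> inversions TypeB n"
      using iff by auto
    show "\<forall>p\<in>inversions TypeB n - inversions TypeD n. (case p of (\<alpha>, \<beta>) \<Rightarrow>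
        scal (of_real (\<bar>ip n \<alpha> \<alpha>\<bar> * \<bar>ip n \<beta> \<beta>\<bar>) * ext_zero n k \<alpha> * ext_zero n k \<beta>) *
             (s_tilde n \<alpha> * s_tilde n \<beta>)) = 0"
      using pos iff by (auto simp: ext_zero_pos_root scal_0 simp del: pos_roots.simps)
    show "(case p of (\<alpha>, \<beta>) \<Rightarrow>
        scal (of_real (\<bar>ip n \<alpha> \<alpha>\<bar> * \<bar>ip n \<beta> \<beta>\<bar>) * k \<alpha> * k \<beta>) * (s_tilde n \<alpha> * s_tilde n \<beta>)) =
      (case p of (\<alpha>, \<beta>) \<Rightarrow>
        scal (of_real (\<bar>ip n \<alpha> \<alpha>\<bar> * \<bar>ip n \<beta> \<beta>\<bar>) * ext_zero n k \<alpha> * ext_zero n k \<beta>) *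
             (s_tilde n \<alpha> * s_tilde n \<beta>))" if "p \<in> inversions TypeD n" for p
    proof -
      obtain \<alpha> \<beta> where p: "p = (\<alpha>, \<beta>)" by (cases p)
      then show ?thesis
        using that pos[of \<alpha> \<beta>] iff[of \<alpha> \<beta>] by (simp add: ext_zero_pos_root del: pos_roots.simps)
    qed
  qed
  then show ?thesis by (simp only: seg_poly_def)
qed

section \<open>Computation in types A and B\<close>

context main_presentation
begin

lemma q_s_tilde:
  assumes "\<alpha> \<in> P"
  shows "q (s_tilde n \<alpha>) = st \<alpha>"
proof -
  have c: "c_gen i \<in> carrier A" if "i \<in> {1..n}" for i
    using that by (simp only: gens_carrier)
  have "q (\<Sum>i=1..n. scal (of_real (\<alpha> i)) * c_gen i) = cv \<alpha>"
    unfolding cv_def cq_def by (subst q_sum) (auto simp: q_mult c free_algebra_closed)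
  moreover have "(\<Sum>i=1..n. scal (of_real (\<alpha> i)) * c_gen i) \<in> carrier A"
    by (intro free_algebra_closed c)
  ultimately have "q (c_root n \<alpha>) = cr \<alpha>" "c_root n \<alpha> \<in> carrier A"
    unfolding c_root_def cr_def by (simp_all only: q_mult free_algebra_closed)
  then show ?thesis
    unfolding s_tilde_def st_def
    using weyl_P[OF assms] by (simp only: q_mult gens_carrier wq_def if_True)
qed

lemma w_gen_P: "\<alpha> \<in> P \<Longrightarrow> w_gen (reflection n \<alpha>) \<in> carrier A"
  by (simp only: gens_carrier weyl_P)

lemma s_tilde_carrier: "\<alpha> \<in> P \<Longrightarrow> s_tilde n \<alpha> \<in> carrier A"
  by (intro s_tilde_in_subalgebra unital_subalgebra_free_algebra w_gen_P) (simp_all only: gens_carrier)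

lemma q_dirac: "q (dirac_poly T n k) = D"
proof -
  have "q (\<Sum>i=1..n. x_gen i * c_gen i) = X"
    unfolding X_def by (subst q_sum) (auto simp: q_mult gens_carrier xq_def cq_def)
  moreover have "(\<Sum>i=1..n. x_gen i * c_gen i) \<in> carrier A"
    by (intro free_algebra_closed) (simp_all only: gens_carrier)
  moreover have "q (\<Sum>\<alpha>\<in>P. scal (k \<alpha> * of_real (ip n \<alpha> \<alpha>)) * s_tilde n \<alpha>) =
      (\<Sum>\<alpha>\<in>P. q (scal (k \<alpha> * of_real (ip n \<alpha> \<alpha>))) * st \<alpha>)"
    by (subst q_sum) (auto simp: q_mult free_algebra_closed s_tilde_carrier q_s_tilde)
  moreover have "(\<Sum>\<alpha>\<in>P. scal (k \<alpha> * of_real (ip n \<alpha> \<alpha>)) * s_tilde n \<alpha>) \<in> carrier A"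
    by (intro free_algebra_closed s_tilde_carrier)
  ultimately have "q (dirac_poly T n k) = X + q (scal (of_real (sqrt 2 / 2))) *
      (\<Sum>\<alpha>\<in>P. q (scal (k \<alpha> * of_real (ip n \<alpha> \<alpha>))) * st \<alpha>)"
    unfolding dirac_poly_def by (simp only: q_add q_mult free_algebra_closed)
  then show ?thesis
    by (simp only: D_def S_def sum_distrib_left sc_sc m_def)
qed

lemma q_omega: "q (omega_poly n) = Omega"
  unfolding Omega_def omega_poly_def by (subst q_sum) (auto simp: q_mult gens_carrier xq_def)

lemma q_seg: "q (seg_poly T n k) = S * S"
proof -
  have inv: "inversions T n = Sigma P flipped"
    by (auto simp only: inversions_def flipped_def)
  \<comment> \<open>The factor 1/2 of \<open>Omega_Seg\<close> is the square of the sqrt 2 / 2 in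
    each weight; the absolute values disappear because positive roots have norm 1 or 2.\<close>
  have half: "1 / 2 * (of_real (\<bar>ip n \<alpha> \<alpha>\<bar> * \<bar>ip n \<beta> \<beta>\<bar>) * k \<alpha> * k \<beta>) = m \<alpha> * m \<beta>"
    if "\<alpha> \<in> P" "\<beta> \<in> P" for \<alpha> \<beta>
  proof -
    have "\<bar>ip n \<alpha> \<alpha>\<bar> = ip n \<alpha> \<alpha>" "\<bar>ip n \<beta> \<beta>\<bar> = ip n \<beta> \<beta>"
      using norm_pos_roots[OF that(1)] norm_pos_roots[OF that(2)] by auto
    moreover have "of_real (sqrt 2 / 2) * of_real (sqrt 2 / 2) = (1 / 2 :: complex)"
      by (simp flip: of_real_mult)
    ultimately show ?thesis
      by (simp only: m_def of_real_mult) (simp add: mult_ac)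
  qed
  have carr: "scal a * (s_tilde n \<alpha> * s_tilde n \<beta>) \<in> carrier A" if "(\<alpha>, \<beta>) \<in> inversions T n" for a \<alpha> \<beta>
    using that unfolding inversions_def by (intro free_algebra_closed s_tilde_carrier) auto
  have sum_carr: "(\<Sum>(\<alpha>, \<beta>)\<in>inversions T n.
        scal (of_real (\<bar>ip n \<alpha> \<alpha>\<bar> * \<bar>ip n \<beta> \<beta>\<bar>) * k \<alpha> * k \<beta>) * (s_tilde n \<alpha> * s_tilde n \<beta>))
      \<in> carrier A"
    by (rule free_algebra_closed(8)) (clarify, rule carr)
  have "q (seg_poly T n k) = q (scal (1 / 2)) * (\<Sum>(\<alpha>, \<beta>)\<in>inversions T n.
      q (scal (of_real (\<bar>ip n \<alpha> \<alpha>\<bar> * \<bar>ip n \<beta> \<beta>\<bar>) * k \<alpha> * k \<beta>)) * (st \<alpha> * st \<beta>))"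
  proof -
    have "q (\<Sum>(\<alpha>, \<beta>)\<in>inversions T n.
        scal (of_real (\<bar>ip n \<alpha> \<alpha>\<bar> * \<bar>ip n \<beta> \<beta>\<bar>) * k \<alpha> * k \<beta>) * (s_tilde n \<alpha> * s_tilde n \<beta>)) =
      (\<Sum>(\<alpha>, \<beta>)\<in>inversions T n.
        q (scal (of_real (\<bar>ip n \<alpha> \<alpha>\<bar> * \<bar>ip n \<beta> \<beta>\<bar>) * k \<alpha> * k \<beta>) * (s_tilde n \<alpha> * s_tilde n \<beta>)))"
      by (subst q_sum) (use carr in \<open>auto intro!: sum.cong\<close>)
    also have "\<dots> = (\<Sum>(\<alpha>, \<beta>)\<in>inversions T n.
        q (scal (of_real (\<bar>ip n \<alpha> \<alpha>\<bar> * \<bar>ip n \<beta> \<beta>\<bar>) * k \<alpha> * k \<beta>)) * (st \<alpha> * st \<beta>))"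
      by (rule sum.cong[OF refl])
         (auto simp only: inversions_def mem_Collect_eq case_prod_conv split_paired_all
           q_mult free_algebra_closed s_tilde_carrier q_s_tilde)
    finally show ?thesis
      unfolding seg_poly_def
      by (simp only: q_mult sum_carr free_algebra_closed(1))
  qed
  also have "\<dots> = (\<Sum>(\<alpha>, \<beta>)\<in>inversions T n. q (scal (m \<alpha> * m \<beta>)) * (st \<alpha> * st \<beta>))"
    unfolding sum_distrib_left
    by (rule sum.cong[OF refl])
       (auto simp only: inversions_def mem_Collect_eq case_prod_conv split_paired_all sc_sc half)
  also have "\<dots> = S * S"
    unfolding S_square inv
    by (rule sum.Sigma[symmetric]) (simp_all add: finite_pos_roots finite_kept)
  finally show ?thesis .
qed

lemma q_dirac_square:
  "q (dirac_poly T n k) * q (dirac_poly T n k) = q (omega_poly n) - q (seg_poly T n k) +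
     q (scal (if T = TypeA then 0 else N * of_nat (n * (n - 1)) / 2))"
proof -
  have "(if T = TypeA then 0 else N) * of_nat (n * (n - 1)) / 2 =
      (if T = TypeA then 0 else N * of_nat (n * (n - 1)) / 2)"
    by simp
  then show ?thesis
    using D_square_eq unfolding q_dirac q_omega q_seg S_square by (simp only:)
qed

text \<open>By \<open>free_algebra_least\<close>: the polynomials whose images commute with
  \<open>Omega\<close> form a unital subalgebra, and the generators belong to it.\<close>

lemma q_omega_central:
  assumes "p \<in> carrier A"
  shows "q (omega_poly n) * q p = q p * q (omega_poly n)"
proof -
  let ?V = "{p \<in> carrier A. Omega * q p = q p * Omega}"
  have "unital_subalgebra ?V"
  proof (rule unital_subalgebraI)
    fix p r assume pr: "p \<in> ?V" "r \<in> ?V"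
    show "p + r \<in> ?V"
      using pr by (auto simp: free_algebra_closed q_add algebra_simps)
    have "Omega * (q p * q r) = q p * (Omega * q r)"
      using pr(1) by (simp flip: mult.assoc)
    then show "p * r \<in> ?V"
      using pr by (auto simp: free_algebra_closed q_mult mult.assoc)
  qed (simp add: Omega_sc free_algebra_closed)
  moreover have "letter g \<in> ?V" if "g \<in> generators T n" for g
  proof -
    have carr: "letter g \<in> carrier A"
      using that by (simp only: letter_in_free_algebra)
    have "Omega * q (letter g) = q (letter g) * Omega"
    proof (cases g)
      case (GenX i)
      then show ?thesis
        using Omega_x[of i] that by (simp add: generators_simps xq_def)
    next
      case (GenC i)
      then show ?thesis
        using Omega_c[of i] that by (simp add: generators_simps cq_def)
    next
      case (GenW g)
      then show ?thesis
        using Omega_w[of g] that by (simp only: generators_simps wq_def ambient_T if_True)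
    qed
    with carr show ?thesis by simp
  qed
  ultimately have "carrier A \<subseteq> ?V"
    by (intro free_algebra_least) blast+
  then show ?thesis
    using assms unfolding q_omega by blast
qed

end

section \<open>The algebra as a subring, and supercommutation\<close>

context presentation
begin

text \<open>Generated subrings are pulled back along the quotient map, so that a class is placed in
  one by applying closure rules to a representative.\<close>

lemma gen_subalgebra_unital:
  assumes "S \<subseteq> carrier A"
  shows "subring (gen_subalgebra T n k N S) Q"
    and "unital_subalgebra {p \<in> carrier A. cl p \<in> gen_subalgebra T n k N S}"
    and "S \<subseteq> {p \<in> carrier A. cl p \<in> gen_subalgebra T n k N S}"
proof -
  have "cl ` (range scal \<union> S) \<subseteq> carrier Q"
    using assms by (auto intro!: cl_closed free_algebra_closed)
  then show sub: "subring (gen_subalgebra T n k N S) Q"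
    unfolding gen_subalgebra_def by (rule ring.generate_ring_is_subring[OF ring_Q])
  have incl: "cl p \<in> gen_subalgebra T n k N S" if "p \<in> range scal \<union> S" for p
    unfolding gen_subalgebra_def by (rule generate_ring.incl) (use that in blast)
  then show "S \<subseteq> {p \<in> carrier A. cl p \<in> gen_subalgebra T n k N S}"
    using assms by blast
  show "unital_subalgebra {p \<in> carrier A. cl p \<in> gen_subalgebra T n k N S}"
    by (rule unital_subalgebraI)
       (auto simp: cl_add cl_mult intro!: free_algebra_closed incl subringE(6,7)[OF sub])
qed

abbreviation H where "H \<equiv> hecke_clifford T n k N"

lemma gens_T_carrier:
  "w_gen ` weyl T n \<subseteq> carrier A" "x_gen ` {1..n} \<subseteq> carrier A" "c_gen ` {1..n} \<subseteq> carrier A"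
  using weyl_ambient(1)[of T n]
  by (auto simp only: image_subset_iff x_carrier c_carrier w_carrier)

text \<open>A uniform description of the three cases: the carrier is a generated subalgebra in type
  D and everything otherwise, always with the operations of the presented ring.\<close>

lemma H_subring:
  "subring (carrier H) Q" "H = Q\<lparr>carrier := carrier H\<rparr>"
  "unital_subalgebra {p \<in> carrier A. cl p \<in> carrier H}"
  "w_gen ` weyl T n \<union> x_gen ` {1..n} \<union> c_gen ` {1..n} \<subseteq> {p \<in> carrier A. cl p \<in> carrier H}"
proof -
  note gens = gens_T_carrier
  let ?S = "w_gen ` weyl T n \<union> x_gen ` {1..n} \<union> c_gen ` {1..n}"
  have S: "?S \<subseteq> carrier A" using gens by blast
  have "subring (carrier H) Q \<and> H = Q\<lparr>carrier := carrier H\<rparr> \<and>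
      unital_subalgebra {p \<in> carrier A. cl p \<in> carrier H} \<and>
      ?S \<subseteq> {p \<in> carrier A. cl p \<in> carrier H}"
  proof (cases "T = TypeD")
    case True
    then have "carrier H = gen_subalgebra T n k N ?S" "H = Q\<lparr>carrier := carrier H\<rparr>"
      by (simp_all add: hecke_clifford_def)
    then show ?thesis using gen_subalgebra_unital[OF S] by simp
  next
    case False
    then have "H = Q" by (simp add: hecke_clifford_def)
    moreover have "{p \<in> carrier A. cl p \<in> carrier Q} = carrier A"
      using cl_closed by blast
    ultimately show ?thesis
      using S ring.carrier_is_subring[OF ring_Q] unital_subalgebra_free_algebra by simp
  qed
  then show "subring (carrier H) Q" "H = Q\<lparr>carrier := carrier H\<rparr>"
    "unital_subalgebra {p \<in> carrier A. cl p \<in> carrier H}"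
    "?S \<subseteq> {p \<in> carrier A. cl p \<in> carrier H}"
    by blast+
qed

lemma H_carrier: "carrier H \<subseteq> carrier Q"
  by (rule subringE(1)[OF H_subring(1)])

lemma H_ops: "mult H = mult Q" "add H = add Q" "zero H = zero Q"
  by (subst H_subring(2), simp)+

text \<open>Unlike the operations in \<open>H_ops\<close>, subtraction depends on the carrier
  through the additive inverse, so its agreement with the ambient ring uses closure under
  inverses.\<close>

lemma H_minus:
  assumes "a \<in> carrier H" "b \<in> carrier H"
  shows "a \<ominus>\<^bsub>H\<^esub> b = a \<ominus>\<^bsub>Q\<^esub> b"
proof -
  have "Ring.ring H"
    using ring.subring_is_ring[OF ring_Q H_subring(1)] H_subring(2) by simp
  then have "\<ominus>\<^bsub>H\<^esub> b = \<ominus>\<^bsub>Q\<^esub> b"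
  proof (rule abelian_group.minus_equality[OF ring.is_abelian_group])
    have b: "b \<in> carrier Q" using assms(2) H_carrier by blast
    show "\<ominus>\<^bsub>Q\<^esub> b \<oplus>\<^bsub>H\<^esub> b = \<zero>\<^bsub>H\<^esub>"
      unfolding H_ops using ring.ring_simprules(9)[OF ring_Q b] .
    show "\<ominus>\<^bsub>Q\<^esub> b \<in> carrier H"
      using subringE(5)[OF H_subring(1) assms(2)] .
  qed (rule assms(2))
  then show ?thesis by (simp add: a_minus_def H_ops)
qed

lemma cl_eq_iff: "p \<in> carrier A \<Longrightarrow> r \<in> carrier A \<Longrightarrow> cl p = cl r \<longleftrightarrow> q p = q r"
  unfolding q_def by (metis ring_prod_of_inject[OF ring_Q] cl_closed)

lemma q_of_cl: "ring_prod_of Q (cl p) = q p"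
  by (simp add: q_def)

lemma cl_minus:
  assumes "p \<in> carrier A" "r \<in> carrier A"
  shows "cl p \<ominus>\<^bsub>Q\<^esub> cl r = cl (p - r)"
proof (rule ring_prod_of_inject[OF ring_Q])
  show "cl p \<ominus>\<^bsub>Q\<^esub> cl r \<in> carrier Q"
    using assms cl_closed ring.ring_simprules(4)[OF ring_Q] by blast
  show "cl (p - r) \<in> carrier Q"
    using assms by (intro cl_closed free_algebra_closed)
  show "ring_prod_of Q (cl p \<ominus>\<^bsub>Q\<^esub> cl r) = ring_prod_of Q (cl (p - r))"
    using assms by (simp add: ring_prod_of_minus[OF ring_Q] cl_closed q_of_cl q_diff)
qed

lemma component_elim:
  assumes "a \<in> component T n k N d" "d = (if b then 1 else 0)"
  obtains p where "a = cl p" "p \<in> carrier A" "parity b p" "cl p \<in> carrier H"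
proof -
  obtain p where p: "a = cl p" "p \<in> carrier A" "a \<in> carrier H"
    "\<forall>u \<in> Poly_Mapping.keys p. c_degree u mod 2 = d"
    using assms(1) unfolding component_def by blast
  have "parity b p"
    using p(4) assms(2) unfolding parity_def by (cases b) (auto simp: odd_iff_mod_2_eq_one even_iff_mod_2_eq_zero)
  then show thesis using that p by blast
qed

text \<open>The odd component of the even element is zero by \<open>odd_part_of_even\<close>. The
  terms carrying it, among them the only one with a sign, drop out and leave ordinary
  commutation.\<close>

lemma supercommute_even:
  assumes super: "supercommute T n k N (cl p) (cl r)"
    and carr: "p \<in> carrier A" "r \<in> carrier A" and even: "parity False r"
  shows "q p * q r = q r * q p"
proof -
  obtain a0 a1 b0 b1 where
    a: "a0 \<in> component T n k N 0" "a1 \<in> component T n k N 1"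
    and b: "b0 \<in> component T n k N 0" "b1 \<in> component T n k N 1"
    and sums: "cl p = a0 \<oplus>\<^bsub>H\<^esub> a1" "cl r = b0 \<oplus>\<^bsub>H\<^esub> b1"
    and prod: "cl p \<otimes>\<^bsub>H\<^esub> cl r =
      (b0 \<otimes>\<^bsub>H\<^esub> a0 \<oplus>\<^bsub>H\<^esub> b1 \<otimes>\<^bsub>H\<^esub> a0 \<oplus>\<^bsub>H\<^esub> b0 \<otimes>\<^bsub>H\<^esub> a1) \<ominus>\<^bsub>H\<^esub> b1 \<otimes>\<^bsub>H\<^esub> a1"
    using super unfolding supercommute_def Let_def by blast
  obtain p0 where p0: "a0 = cl p0" "p0 \<in> carrier A" "parity False p0" "cl p0 \<in> carrier H"
    by (rule component_elim[OF a(1), of False]) simp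
  obtain p1 where p1: "a1 = cl p1" "p1 \<in> carrier A" "parity True p1" "cl p1 \<in> carrier H"
    by (rule component_elim[OF a(2), of True]) simp
  obtain r0 where r0: "b0 = cl r0" "r0 \<in> carrier A" "parity False r0" "cl r0 \<in> carrier H"
    by (rule component_elim[OF b(1), of False]) simp
  obtain r1 where r1: "b1 = cl r1" "r1 \<in> carrier A" "parity True r1" "cl r1 \<in> carrier H"
    by (rule component_elim[OF b(2), of True]) simp
  note carrs = carr p0(2) p1(2) r0(2) r1(2)
  note H_closed = subringE(6,7)[OF H_subring(1)]
  have qp: "q p = q p0 + q p1"
    using sums(1) carrs unfolding p0(1) p1(1) H_ops
    by (simp add: cl_eq_iff free_algebra_closed q_add flip: cl_add)
  have qr: "q r = q r0 + q r1"
    using sums(2) carrs unfolding r0(1) r1(1) H_ops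
    by (simp add: cl_eq_iff free_algebra_closed q_add flip: cl_add)
  have r1_0: "q r1 = 0"
    by (rule odd_part_of_even[OF carr(2) r0(2) r1(2) even r0(3) r1(3) qr])
  have "cl p \<otimes>\<^bsub>Q\<^esub> cl r = (cl r0 \<otimes>\<^bsub>Q\<^esub> cl p0 \<oplus>\<^bsub>Q\<^esub> cl r1 \<otimes>\<^bsub>Q\<^esub> cl p0 \<oplus>\<^bsub>Q\<^esub> cl r0 \<otimes>\<^bsub>Q\<^esub> cl p1)
      \<ominus>\<^bsub>Q\<^esub> cl r1 \<otimes>\<^bsub>Q\<^esub> cl p1"
    using prod p0 p1 r0 r1 by (simp only: H_ops H_minus H_closed)
  then have "cl (p * r) = cl ((r0 * p0 + r1 * p0 + r0 * p1) - r1 * p1)"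
    using carrs by (simp only: cl_minus[symmetric] cl_add cl_mult free_algebra_closed)
  then have "q (p * r) = q ((r0 * p0 + r1 * p0 + r0 * p1) - r1 * p1)"
    using carrs by (simp only: cl_eq_iff free_algebra_closed)
  then have "q p * q r = q r0 * q p0 + q r0 * q p1"
    using carrs r1_0 by (simp add: q_mult q_add q_diff free_algebra_closed)
  also have "\<dots> = q r * q p"
    unfolding qr qp r1_0 by (simp add: distrib_left)
  finally show ?thesis .
qed

end

section \<open>Assembly of all three types\<close>

lemma scal_central:
  fixes p :: "'g word \<Rightarrow>\<^sub>0 complex"
  shows "scal a * p = p * scal a"
proof -
  let ?V = "{p :: 'g word \<Rightarrow>\<^sub>0 complex. scal a * p = p * scal a}"
  have "unital_subalgebra ?V"
  proof (rule unital_subalgebraI)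
    fix p r assume pr: "p \<in> ?V" "r \<in> ?V"
    show "p + r \<in> ?V"
      using pr by (simp add: distrib_left distrib_right)
    have "scal a * (p * r) = p * (scal a * r)"
      using pr(1) by (simp flip: mult.assoc)
    then show "p * r \<in> ?V"
      using pr(2) by (simp add: mult.assoc)
  qed (simp add: scal_mult mult.commute)
  \<comment> \<open>Over the alphabet of all letters the free algebra is the whole type, so the
    induction principle reaches every polynomial.\<close>
  then have "carrier (free_algebra UNIV) \<subseteq> ?V"
    by (rule free_algebra_least) (auto simp: scal_letter)
  then show ?thesis by (auto simp: free_algebra_def)
qed

text \<open>The two presentations have the same generators and relators, so equations proved in the
  ambient type B algebra are literally equations about type D.\<close>

lemma q_type_D:
  assumes "1 \<le> n"
  shows "presentation.q TypeD n k N = presentation.q TypeB n (ext_zero n k) N"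
proof -
  have pres: "presentation n" using assms by unfold_locales
  have gens: "generators TypeD n = generators TypeB n"
    by (simp add: generators_def)
  have rels: "relators TypeD n k N = relators TypeB n (ext_zero n k) N" by simp
  show ?thesis
    by (rule ext)
       (simp only: presentation.q_def[OF pres] cls_def rel_ideal_def presented_def gens rels)
qed

lemma q_dirac_square_all:
  assumes "1 \<le> n" and "weyl_invariant T n k"
    and "T = TypeD \<Longrightarrow> weyl_invariant TypeB n (ext_zero n k)"
  shows "presentation.q T n k N (dirac_poly T n k) * presentation.q T n k N (dirac_poly T n k) =
     presentation.q T n k N (omega_poly n) - presentation.q T n k N (seg_poly T n k) +
     presentation.q T n k N (scal (if T = TypeA then 0 else N * of_nat (n * (n - 1)) / 2))"
proof (cases "T = TypeD")
  case True
  interpret main_presentation TypeB n "ext_zero n k" N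
    using assms(1,3) True by unfold_locales auto
  show ?thesis
    using q_dirac_square unfolding True q_type_D[OF assms(1)] dirac_poly_D seg_poly_D by simp
next
  case False
  interpret main_presentation T n k N
    using assms(1,2) False by unfold_locales
  show ?thesis by (rule q_dirac_square)
qed

lemma q_omega_central_all:
  assumes "1 \<le> n" and "weyl_invariant T n k"
    and "T = TypeD \<Longrightarrow> weyl_invariant TypeB n (ext_zero n k)"
    and "p \<in> carrier (free_algebra (generators T n))"
  shows "presentation.q T n k N (omega_poly n) * presentation.q T n k N p =
    presentation.q T n k N p * presentation.q T n k N (omega_poly n)"
proof (cases "T = TypeD")
  case True
  interpret main_presentation TypeB n "ext_zero n k" N
    using assms(1,3) True by unfold_locales auto
  have "p \<in> carrier A"
    using assms(4) True by (simp add: generators_def)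
  then show ?thesis
    unfolding True q_type_D[OF assms(1)] by (rule q_omega_central)
next
  case False
  interpret main_presentation T n k N
    using assms(1,2) False by unfold_locales
  show ?thesis using assms(4) by (rule q_omega_central)
qed

text \<open>The added scalar comes from the commutators of the x_i in X^2. The third assumption lets
  type D be computed inside type B; for n = 2 it forces equal values on e_1 - e_2 and e_1 + e_2,
  which only the larger Weyl group conjugates.\<close>

theorem theorem4p23:
  fixes T :: root_type and n :: nat and k :: "vec \<Rightarrow> complex" and N :: complex
  assumes "1 \<le> n"
    and "weyl_invariant T n k"
    and "T = TypeD \<Longrightarrow> weyl_invariant TypeB n (ext_zero n k)"
  shows "dirac T n k N \<otimes>\<^bsub>hecke_clifford T n k N\<^esub> dirac T n k N =
           (Omega_H T n k N \<ominus>\<^bsub>hecke_clifford T n k N\<^esub> Omega_Seg T n k N)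
             \<oplus>\<^bsub>hecke_clifford T n k N\<^esub> cls T n k N (scal (if T = TypeA then 0 else N * of_nat (n * (n - 1)) / 2))
       \<and> (\<forall>h \<in> carrier (hecke_clifford T n k N).
            (\<forall>g \<in> Seg T n k N. supercommute T n k N h g) \<longrightarrow>
            (dirac T n k N \<otimes>\<^bsub>hecke_clifford T n k N\<^esub> dirac T n k N)
                \<otimes>\<^bsub>hecke_clifford T n k N\<^esub> h
              \<ominus>\<^bsub>hecke_clifford T n k N\<^esub>
                h \<otimes>\<^bsub>hecke_clifford T n k N\<^esub>
                  (dirac T n k N \<otimes>\<^bsub>hecke_clifford T n k N\<^esub> dirac T n k N)
              = \<zero>\<^bsub>hecke_clifford T n k N\<^esub>)"
proof -
  interpret presentation T n k N
    using assms(1) by unfold_locales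
  let ?z = "if T = TypeA then 0 else N * of_nat (n * (n - 1)) / 2"
  let ?d = "dirac_poly T n k" and ?om = "omega_poly n" and ?sg = "seg_poly T n k" and ?s = "scal ?z :: falg"
  let ?V = "{p \<in> carrier A. cl p \<in> carrier H}"
  note V = H_subring(3)
  have refl: "reflection n \<alpha> \<in> weyl T n" if "\<alpha> \<in> pos_roots T n" for \<alpha>
    by (rule pos_reflection_in_weyl[OF that])
  have gens: "w_gen (reflection n \<alpha>) \<in> ?V" if "\<alpha> \<in> pos_roots T n" for \<alpha>
    using H_subring(4) refl[OF that] by blast
  have c: "c_gen i \<in> ?V" and x: "x_gen i \<in> ?V" if "i \<in> {1..n}" for i
    using H_subring(4) that by blast+
  \<comment> \<open>Membership in H matters in type D: all four representatives are built from
    scalars, the c_i, the x_i and reflections in positive roots of type T.\<close>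
  have V_mem: "?d \<in> ?V" "?sg \<in> ?V" "?om \<in> ?V" "?s \<in> ?V"
    unfolding omega_poly_def
    by (intro dirac_poly_in_subalgebra seg_poly_in_subalgebra subalgebra_sum subalgebra_mult
        subalgebra_scal V gens c x; assumption)+
  then have carr: "?d \<in> carrier A" "?sg \<in> carrier A" "?om \<in> carrier A" "?s \<in> carrier A"
    and H: "cl ?d \<in> carrier H" "cl ?sg \<in> carrier H" "cl ?om \<in> carrier H" "cl ?s \<in> carrier H"
    by blast+
  have square: "q ?d * q ?d = q ?om - q ?sg + q ?s"
    by (rule q_dirac_square_all) (fact assms)+
  have 1: "cl ?d \<otimes>\<^bsub>H\<^esub> cl ?d = (cl ?om \<ominus>\<^bsub>H\<^esub> cl ?sg) \<oplus>\<^bsub>H\<^esub> cl ?s"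
  proof -
    have "q (?d * ?d) = q (?om - ?sg + ?s)"
      using square carr by (simp only: q_mult q_add q_diff free_algebra_closed)
    then have "cl (?d * ?d) = cl (?om - ?sg + ?s)"
      using carr by (simp only: cl_eq_iff free_algebra_closed)
    then show ?thesis
      using carr H by (simp only: cl_mult cl_add cl_minus[symmetric] free_algebra_closed H_ops H_minus)
  qed
  have 2: "(cl ?d \<otimes>\<^bsub>H\<^esub> cl ?d) \<otimes>\<^bsub>H\<^esub> h \<ominus>\<^bsub>H\<^esub> h \<otimes>\<^bsub>H\<^esub> (cl ?d \<otimes>\<^bsub>H\<^esub> cl ?d) = \<zero>\<^bsub>H\<^esub>"
    if h: "h \<in> carrier H" and super: "\<And>g. g \<in> Seg T n k N \<Longrightarrow> supercommute T n k N h g" for h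
  proof -
    obtain p where p: "h = cl p" "p \<in> carrier A"
      using h H_carrier carrier_Q by blast
    have S: "w_gen ` weyl T n \<union> c_gen ` {1..n} \<subseteq> carrier A"
      using gens_T_carrier by blast
    \<comment> \<open>As a member of Seg, this class supercommutes with h; its representative is
      even, so it commutes with h.\<close>
    have "cl ?sg \<in> Seg T n k N"
    proof -
      have "?sg \<in> {p \<in> carrier A. cl p \<in> gen_subalgebra T n k N (w_gen ` weyl T n \<union> c_gen ` {1..n})}"
        by (rule seg_poly_in_subalgebra[OF gen_subalgebra_unital(2)[OF S]])
           (use gen_subalgebra_unital(3)[OF S] refl in blast)+
      then show ?thesis by (simp add: Seg_def)
    qed
    then have "q p * q ?sg = q ?sg * q p"
      using super[of "cl ?sg"] p carr by (intro supercommute_even parity_seg_poly) simp_all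
    moreover have "q ?om * q p = q p * q ?om"
      by (rule q_omega_central_all[OF assms p(2)])
    moreover have "q ?s * q p = q p * q ?s"
    proof -
      have "?s * p = p * ?s" using scal_central by blast
      then have "q (?s * p) = q (p * ?s)" by simp
      then show ?thesis using carr p by (simp add: q_mult)
    qed
    \<comment> \<open>The square is a combination of three elements, each of which has been shown to
      commute with the image of h.\<close>
    ultimately have comm: "q ?d * q ?d * q p = q p * (q ?d * q ?d)"
      by (simp only: square distrib_left distrib_right left_diff_distrib right_diff_distrib)
    have "q ((?d * ?d) * p - p * (?d * ?d)) = 0"
      using carr p comm by (simp only: q_mult q_diff free_algebra_closed) simp
    then have "cl ((?d * ?d) * p - p * (?d * ?d)) = \<zero>\<^bsub>Q\<^esub>"
      using carr p by (simp only: q_eq_zero_iff cl_eq_zero_iff free_algebra_closed)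
    moreover have "cl ((?d * ?d) * p - p * (?d * ?d)) =
        (cl ?d \<otimes>\<^bsub>Q\<^esub> cl ?d) \<otimes>\<^bsub>Q\<^esub> h \<ominus>\<^bsub>Q\<^esub> h \<otimes>\<^bsub>Q\<^esub> (cl ?d \<otimes>\<^bsub>Q\<^esub> cl ?d)"
      using carr p by (simp only: cl_mult cl_minus[symmetric] free_algebra_closed)
    ultimately show ?thesis
      using h H(1) subringE(6)[OF H_subring(1)] by (simp only: H_ops H_minus)
  qed
  show ?thesis
    unfolding dirac_eq Omega_H_eq Omega_Seg_eq using 1 2 by blast
qed

end
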